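(* Let $\mathbb P_N$ be the probability measures described in the context (one interval, $\theta=1$), with parameters and weights satisfying the assumptions (P), (W1), (W2) listed there. Let $\mu_N=\frac1N\sum_{i=1}^N\delta(\ell_i)$, where $(\ell_1,\dots,\ell_N)$ is $\mathbb P_N$-distributed. Then there is a deterministic, compactly supported and absolutely continuous probability measure $\mu(x)dx$ such that $\mu_N$ concentrate (in probability) near $\mu$. More precisely, for each Lipschitz function $f$ defined in a real neighborhood of the interval $[1+\mathsf u,\ \mathsf q^{-\mathsf M}+\mathsf u\mathsf q^{\mathsf M}]$ and each $\varepsilon>0$, the random variables $$N^{1/2-\varepsilon}\left|\int_{\mathbb R}f(x)\,\mu_N(dx)-\int_{\mathbb R}f(x)\mu(x)\,dx\right|$$ converge to $0$ as $N\to\infty$ in probability and in the sense of moments.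
   Context: (P) Fixed real parameters $\mathsf q\in(0,1)$, $\mathsf M\ge 1$, $\mathsf u\in[0,1)$ are given, together with sequences $q_N\in(0,1)$, $M_N\in\mathbb N$, $u_N\in[0,1)$ such that $M_N\ge N-1$ and, for some constant $A_1>0$, $\max\big(N^2|q_N-\mathsf q^{1/N}|,\ |M_N-N\mathsf M|,\ N|u_N-\mathsf u|\big)\le A_1$ for all $N$. Measures. Let $\lambda_1<\dots<\lambda_N$ range over integers with $0\le\lambda_1<\dots<\lambda_N\le M_N$ and put $\ell_i=q_N^{-\lambda_i}+u_Nq_N^{\lambda_i}$. The measure $\mathbb P_N$ on such $N$-tuples $(\ell_1,\dots,\ell_N)$ is $$\mathbb P_N(\ell_1,\dots,\ell_N)\ \propto\ \prod_{1\le i<j\le N}(\ell_i-\ell_j)^2\prod_{i=1}^N w(\ell_i;N).$$ (W1) $w(x;N)=\exp(-NV_N(x))$ with $V_N$ continuous on $[1+u_N,\ q_N^{-M_N}+u_Nq_N^{M_N}]$, and $|V_N(s)-V(s)|\le A_2N^{-1}\log N$ there, where $V$ is a continuous function (defined on a real interval containing all the intervals considered here) with $|V(s)|\le A_3$; $A_2,A_3>0$ are constants. (W2) $V$ is differentiable and for some $A_4>0$ $$|V'(s)|\le A_4\Big[1+\big|\log|s-1-\mathsf u|\big|+\big|\log|s-\mathsf q^{-\mathsf M}-\mathsf u\mathsf q^{\mathsf M}|\big|\Big],\qquad s\in[1+\mathsf u,\ \mathsf q^{-\mathsf M}+\mathsf u\mathsf q^{\mathsf M}]$$ (the right-hand side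 being $+\infty$ at the two endpoints). *)

theory Defs
  imports "HOL-Probability.Probability"
begin

definition quad_pt :: "real \<Rightarrow> real \<Rightarrow> real \<Rightarrow> real" where
  "quad_pt q u x = q powr (- x) + u * q powr x"

text \<open>State space of the particle system: \<open>N\<close>-tuples \<open>z\<close>, indexed by \<open>{1..N}\<close> (and \<open>undefined\<close>
  elsewhere), of lattice points coming from integers \<open>0 \<le> l 1 < \<dots> < l N \<le> M\<close>.\<close>

definition configs :: "real \<Rightarrow> nat \<Rightarrow> real \<Rightarrow> nat \<Rightarrow> (nat \<Rightarrow> real) set" where
  "configs q M u N =
     (\<lambda>l. restrict (\<lambda>i. quad_pt q u (real (l i))) {1..N}) `
       {l \<in> {1..N} \<rightarrow>\<^sub>E {0..M}. strict_mono_on {1..N} l}"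

definition gibbs_weight :: "(real \<Rightarrow> real) \<Rightarrow> nat \<Rightarrow> (nat \<Rightarrow> real) \<Rightarrow> real" where
  "gibbs_weight w N z =
     (\<Prod>i\<in>{1..N}. \<Prod>j\<in>{i<..N}. (z i - z j)\<^sup>2) * (\<Prod>i\<in>{1..N}. w (z i))"

definition gibbs_measure ::
    "real \<Rightarrow> nat \<Rightarrow> real \<Rightarrow> (real \<Rightarrow> real) \<Rightarrow> nat \<Rightarrow> (nat \<Rightarrow> real) measure" where
  "gibbs_measure q M u w N =
     point_measure (configs q M u N)
       (\<lambda>z. ennreal (gibbs_weight w N z / (\<Sum>z'\<in>configs q M u N. gibbs_weight w N z')))"

text \<open>The measure \<open>(1/N) \<Sum>\<^sub>i \<delta>(z i)\<close> for \<open>N \<ge> 1\<close>. As a \<open>pmf\<close> it makes every function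
  measurable, so integrating a function that is only prescribed near the particles is harmless.\<close>

definition empirical :: "nat \<Rightarrow> (nat \<Rightarrow> real) \<Rightarrow> real pmf" where
  "empirical N z = map_pmf z (pmf_of_set {1..N})"

text \<open>The random variables \<open>X N\<close> may live on different probability spaces \<open>P N\<close>.\<close>

definition tends_to_0_in_prob :: "(nat \<Rightarrow> 'a measure) \<Rightarrow> (nat \<Rightarrow> 'a \<Rightarrow> real) \<Rightarrow> bool" where
  "tends_to_0_in_prob P X \<longleftrightarrow>
     (\<forall>\<delta>>0. (\<lambda>N. measure (P N) {\<omega> \<in> space (P N). \<bar>X N \<omega>\<bar> > \<delta>}) \<longlonglongrightarrow> 0)"

definition tends_to_0_in_moments :: "(nat \<Rightarrow> 'a measure) \<Rightarrow> (nat \<Rightarrow> 'a \<Rightarrow> real) \<Rightarrow> bool" where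
  "tends_to_0_in_moments P X \<longleftrightarrow>
     (\<forall>k\<ge>1. (\<forall>\<^sub>F N in sequentially. integrable (P N) (\<lambda>\<omega>. X N \<omega> ^ k)) \<and>
             (\<lambda>N. \<integral>\<omega>. X N \<omega> ^ k \<partial>P N) \<longlonglongrightarrow> 0)"

end

theory Submission
  imports Defs "HOL-Real_Asymp.Real_Asymp"
begin

text \<open>Write the density of a configuration as \<open>exp (- E)\<close>, where \<open>E\<close> is a quadratic energy with the
  off-diagonal kernel \<open>ln (R / \<bar>x - y\<bar>) \<ge> 0\<close>, extended to fractional occupations of the lattice sites.
  Since self-interactions are absent, \<open>E\<close> is concave along each exchange of mass between two sites, so
  rounding a fractional occupation to a configuration does not raise \<open>E\<close>. Comparing a configuration with
  the ground state through their midpoint therefore bounds the quadratic form of the difference by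
  the excess energy. The kernel is a mixture of tents \<open>max 0 (r - \<bar>x - y\<bar>)\<close> up to a diagonal term of order
  \<open>ln N\<close> and \<open>- \<bar>x - y\<bar> / R\<close>; the latter controls the \<open>L\<^sup>2\<close> norm of the difference of distribution
  functions, hence every Lipschitz statistic. So all configurations with excess energy \<open>O(N ln N)\<close>
  have statistics within \<open>O(sqrt (ln N / N))\<close> of the ground state, and the others have total
  probability at most \<open>exp (- N)\<close>.

  The ground states for \<open>N\<close> and \<open>N m\<close> particles are compared by spreading each site over a block of \<open>m\<close>
  sites and, conversely, averaging over blocks, at an energy cost of order \<open>N ln N\<close>. Hence their
  statistics form a Cauchy sequence with the same rate; a weak limit point has bounded density because
  the lattice spacing is at least of order \<open>1 / N\<close>.\<close>

section \<open>Positive definiteness of the logarithmic kernel\<close>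

text \<open>Energy errors of order N ln N are affordable throughout: the number of configurations is
  itself only exp(O(N ln N)), so entropy is of the same size, and division by N^2 followed by a
  square root gives the rate. Self-energies, close pairs and boundary blocks can therefore be
  bounded crudely, without exploiting cancellation. The obstacle is that rounding and coercivity
  want opposite diagonals: concavity along exchanges needs a zero diagonal, positive definiteness
  needs about \<open>ln (R / \<delta>)\<close> at every site. The zero diagonal is kept, and the
  missing one is paid for only when the quadratic form of a difference of occupations is estimated.
  The exclusion of two particles from one site is carried by the bound 1 on occupations. Hence no
  constrained variational problem on the line has to be solved; the limit comes from compactness and
  the Cauchy estimate. Averaging over blocks transfers energies only. Statistics travel in the other
  direction: the spread ground state has small excess on the fine lattice, and coercivity there ties
  it to the fine ground state.\<close>

lemma tent_integral:
  fixes x y r :: real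
  assumes "0 \<le> r"
  shows "has_bochner_integral lborel (\<lambda>z. indicator {x..x+r} z * indicator {y..y+r} z) (max 0 (r - \<bar>x - y\<bar>))"
proof -
  have eq: "(\<lambda>z. indicator {x..x+r} z * indicator {y..y+r} z :: real) = indicator {max x y..min x y + r}"
    by (auto simp: indicator_def fun_eq_iff)
  have "has_bochner_integral lborel (indicator {max x y..min x y + r} :: real \<Rightarrow> real) (measure lborel {max x y..min x y + r})"
    by (rule has_bochner_integral_real_indicator) (auto simp: emeasure_lborel_Icc_eq)
  moreover have "measure lborel {max x y..min x y + r} = max 0 (r - \<bar>x - y\<bar>)"
    by (cases "max x y \<le> min x y + r") (auto simp: max_def min_def abs_if split: if_splits)
  ultimately show ?thesis unfolding eq by simp
qed

text \<open>The tent is the autocorrelation of the indicator of an interval of length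
  \<open>r\<close>, so the quadratic form is the integral of a square.\<close>

lemma tent_psd:
  fixes h x :: "'a \<Rightarrow> real" and r :: real
  assumes "0 \<le> r"
  shows "0 \<le> (\<Sum>a\<in>A. \<Sum>b\<in>A. h a * h b * max 0 (r - \<bar>x a - x b\<bar>))"
proof -
  have "has_bochner_integral lborel
     (\<lambda>z. \<Sum>a\<in>A. \<Sum>b\<in>A. h a * h b * (indicator {x a..x a+r} z * indicator {x b..x b+r} z))
     (\<Sum>a\<in>A. \<Sum>b\<in>A. h a * h b * max 0 (r - \<bar>x a - x b\<bar>))"
    by (intro has_bochner_integral_sum has_bochner_integral_mult_right tent_integral assms)
  moreover have "(\<lambda>z. \<Sum>a\<in>A. \<Sum>b\<in>A. h a * h b * (indicator {x a..x a+r} z * indicator {x b..x b+r} z))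
      = (\<lambda>z. (\<Sum>a\<in>A. h a * indicator {x a..x a+r} z)\<^sup>2)"
    by (simp add: fun_eq_iff power2_eq_square sum_product mult_ac)
  ultimately have "(\<integral>z. (\<Sum>a\<in>A. h a * indicator {x a..x a+r} z)\<^sup>2 \<partial>lborel) =
     (\<Sum>a\<in>A. \<Sum>b\<in>A. h a * h b * max 0 (r - \<bar>x a - x b\<bar>))"
    by (simp add: has_bochner_integral_iff)
  moreover have "0 \<le> (\<integral>z. (\<Sum>a\<in>A. h a * indicator {x a..x a+r} z)\<^sup>2 \<partial>lborel)"
    by (rule integral_nonneg_AE) simp
  ultimately show ?thesis by simp
qed

text \<open>Taylor's formula at \<open>R\<close> with integral remainder:
  \<open>ln (R / d) + d / R - 1\<close> vanishes at \<open>R\<close> together with its derivative,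
  and its second derivative \<open>1 / d\<^sup>2\<close> is the mixing weight of the tents.\<close>

lemma has_integral_tent_log:
  fixes d \<delta> R :: real
  assumes "0 < \<delta>" "\<delta> \<le> d" "d \<le> R"
  shows "((\<lambda>r. max 0 (r - d) / r\<^sup>2) has_integral (ln (R / d) + d / R - 1)) {\<delta>..R}"
proof -
  have 1: "((\<lambda>r. max 0 (r - d) / r\<^sup>2) has_integral 0) {\<delta>..d}"
    by (rule has_integral_is_0) auto
  have "((\<lambda>r. (r - d) / r\<^sup>2) has_integral ((ln R + d / R) - (ln d + d / d))) {d..R}"
    using assms
    by (intro fundamental_theorem_of_calculus)
       (auto intro!: derivative_eq_intros simp: has_real_derivative_iff_has_vector_derivative[symmetric]
         field_simps power2_eq_square)
  moreover have "(ln R + d / R) - (ln d + d / d) = ln (R / d) + d / R - 1"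
    using assms by (simp add: ln_div)
  ultimately have "((\<lambda>r. (r - d) / r\<^sup>2) has_integral (ln (R / d) + d / R - 1)) {d..R}"
    by (simp only:)
  then have 2: "((\<lambda>r. max 0 (r - d) / r\<^sup>2) has_integral (ln (R / d) + d / R - 1)) {d..R}"
    by (rule has_integral_eq[rotated]) auto
  show ?thesis
    using has_integral_combine[OF assms(2,3) 1 2] by simp
qed

text \<open>The form is a mixture of tent forms with radii in \<open>{\<delta>..R}\<close>. The
  cutoff at \<open>\<delta>\<close> changes nothing at distances of at least
  \<open>\<delta>\<close>, and it makes the value at distance zero finite, namely
  \<open>ln (R / \<delta>)\<close>.\<close>

lemma log_kernel_psd:
  fixes h x :: "'a \<Rightarrow> real"
  assumes "finite A" "0 < \<delta>" "\<delta> \<le> R"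
    and sep: "\<And>a b. a \<in> A \<Longrightarrow> b \<in> A \<Longrightarrow> a \<noteq> b \<Longrightarrow> \<delta> \<le> \<bar>x a - x b\<bar> \<and> \<bar>x a - x b\<bar> \<le> R"
  shows "0 \<le> (\<Sum>a\<in>A. \<Sum>b\<in>A. h a * h b *
     (if a = b then ln (R / \<delta>) else ln (R / \<bar>x a - x b\<bar>) + \<bar>x a - x b\<bar> / R - 1))"
proof -
  have diag: "((\<lambda>r. max 0 (r - 0) / r\<^sup>2) has_integral ln (R / \<delta>)) {\<delta>..R}"
  proof -
    have "((\<lambda>r. 1 / r) has_integral (ln R - ln \<delta>)) {\<delta>..R}"
      using assms
      by (intro fundamental_theorem_of_calculus)
         (auto intro!: derivative_eq_intros simp: has_real_derivative_iff_has_vector_derivative[symmetric])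
    then show ?thesis
      using assms by (rule_tac has_integral_eq_rhs[OF has_integral_eq[rotated]])
        (auto simp: ln_div power2_eq_square)
  qed
  have "((\<lambda>r. \<Sum>a\<in>A. \<Sum>b\<in>A. h a * h b * (max 0 (r - \<bar>x a - x b\<bar>) / r\<^sup>2)) has_integral
     (\<Sum>a\<in>A. \<Sum>b\<in>A. h a * h b *
     (if a = b then ln (R / \<delta>) else ln (R / \<bar>x a - x b\<bar>) + \<bar>x a - x b\<bar> / R - 1))) {\<delta>..R}"
    by (intro has_integral_sum has_integral_mult_right assms)
       (use sep assms diag in \<open>auto intro!: has_integral_tent_log\<close>)
  then show ?thesis
  proof (rule has_integral_nonneg)
    fix r assume "r \<in> {\<delta>..R}"
    then have "0 \<le> (\<Sum>a\<in>A. \<Sum>b\<in>A. h a * h b * max 0 (r - \<bar>x a - x b\<bar>)) / r\<^sup>2"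
      using tent_psd[of r h x A] assms by auto
    then show "0 \<le> (\<Sum>a\<in>A. \<Sum>b\<in>A. h a * h b * (max 0 (r - \<bar>x a - x b\<bar>) / r\<^sup>2))"
      by (simp add: sum_divide_distrib)
  qed
qed

lemma abel_sum:
  fixes h g :: "nat \<Rightarrow> real"
  shows "(\<Sum>a\<le>n. h a * g a) = (\<Sum>a\<le>n. h a) * g n - (\<Sum>c<n. (\<Sum>b\<le>c. h b) * (g (Suc c) - g c))"
  by (induction n) (simp_all add: algebra_simps)

text \<open>A distance is the sum of the gaps it spans, and gap \<open>c\<close> is spanned by the
  pairs with one point on each side of it. The induction adds the rightmost site; \<open>T\<close>
  collects its weighted distances to the others.\<close>

lemma distance_form:
  fixes h x :: "nat \<Rightarrow> real"
  assumes "\<And>a b. a \<le> b \<Longrightarrow> b \<le> n \<Longrightarrow> x a \<le> x b"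
  shows "(\<Sum>a\<le>n. \<Sum>b\<le>n. h a * h b * \<bar>x a - x b\<bar>) =
    2 * (\<Sum>c<n. (x (Suc c) - x c) * ((\<Sum>b\<le>c. h b) * ((\<Sum>b\<le>n. h b) - (\<Sum>b\<le>c. h b))))"
  using assms
proof (induction n)
  case (Suc n)
  let ?H = "\<lambda>c. \<Sum>b\<le>c. h b"
  define T where "T = (\<Sum>a\<le>n. h a * (x (Suc n) - x a))"
  have T: "T = (\<Sum>c\<le>n. (x (Suc c) - x c) * ?H c)"
  proof -
    have "T = ?H n * (x (Suc n) - x n) - (\<Sum>c<n. ?H c * (- (x (Suc c) - x c)))"
      unfolding T_def by (subst abel_sum) simp
    also have "\<dots> = (\<Sum>c<Suc n. (x (Suc c) - x c) * ?H c)"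
      by (simp add: sum_subtractf algebra_simps)
    finally show ?thesis by (simp only: lessThan_Suc_atMost)
  qed
  have m: "\<bar>x a - x (Suc n)\<bar> = x (Suc n) - x a" "\<bar>x (Suc n) - x a\<bar> = x (Suc n) - x a"
    if "a \<le> n" for a
    using Suc.prems[of a "Suc n"] that by auto
  have "(\<Sum>a\<le>n. h a * h (Suc n) * \<bar>x a - x (Suc n)\<bar>) = h (Suc n) * T"
    "(\<Sum>a\<le>n. h (Suc n) * h a * \<bar>x (Suc n) - x a\<bar>) = h (Suc n) * T"
    unfolding T_def sum_distrib_left using m by (force intro!: sum.cong)+
  then have "(\<Sum>a\<le>Suc n. \<Sum>b\<le>Suc n. h a * h b * \<bar>x a - x b\<bar>) =
     (\<Sum>a\<le>n. \<Sum>b\<le>n. h a * h b * \<bar>x a - x b\<bar>) + 2 * (h (Suc n) * T)"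
    by (simp add: sum.distrib)
  also have "\<dots> = 2 * (\<Sum>c<n. (x (Suc c) - x c) * (?H c * (?H n - ?H c))) + 2 * (h (Suc n) * T)"
    using Suc by simp
  also have "(\<Sum>c<n. (x (Suc c) - x c) * (?H c * (?H n - ?H c))) =
      (\<Sum>c\<le>n. (x (Suc c) - x c) * (?H c * (?H n - ?H c)))"
    by (simp add: lessThan_Suc_atMost[symmetric])
  also have "2 * \<dots> + 2 * (h (Suc n) * T) =
     2 * (\<Sum>c\<le>n. (x (Suc c) - x c) * (?H c * (?H (Suc n) - ?H c)))"
  proof -
    define H where "H c = ?H c" for c
    have H: "H (Suc n) = H n + h (Suc n)" by (simp add: H_def)
    have "2 * (\<Sum>c\<le>n. (x (Suc c) - x c) * (H c * (H n - H c))) +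
        2 * (h (Suc n) * (\<Sum>c\<le>n. (x (Suc c) - x c) * H c)) =
      2 * (\<Sum>c\<le>n. (x (Suc c) - x c) * (H c * (H (Suc n) - H c)))"
      unfolding H sum_distrib_left sum.distrib[symmetric]
      by (auto intro!: sum.cong simp: algebra_simps)
    then show ?thesis by (simp only: T H_def)
  qed
  finally show ?case by (simp add: lessThan_Suc_atMost)
qed simp

text \<open>Neutrality turns minus the distance form into twice the squared L^2 norm of the
  distribution function of \<open>h\<close>, with the gaps as weights. Summation by parts pairs that
  function with the increments of \<open>f\<close>, and Cauchy-Schwarz is applied with the same
  weights.\<close>

lemma neutral_test_bound:
  fixes h x f :: "nat \<Rightarrow> real"
  assumes mono: "\<And>a b. a \<le> b \<Longrightarrow> b \<le> n \<Longrightarrow> x a \<le> x b"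
    and neutral: "(\<Sum>a\<le>n. h a) = 0"
    and lip: "\<And>a b. a \<le> n \<Longrightarrow> b \<le> n \<Longrightarrow> \<bar>f a - f b\<bar> \<le> L * \<bar>x a - x b\<bar>"
    and R: "x n - x 0 \<le> R"
  shows "2 * (\<Sum>a\<le>n. h a * f a)\<^sup>2 \<le> L\<^sup>2 * R * (- (\<Sum>a\<le>n. \<Sum>b\<le>n. h a * h b * \<bar>x a - x b\<bar>))"
proof -
  let ?H = "\<lambda>c. \<Sum>b\<le>c. h b"
  define D where "D c = x (Suc c) - x c" for c
  have D0: "0 \<le> D c" if "c < n" for c using mono[of c "Suc c"] that by (auto simp: D_def)
  have "\<bar>\<Sum>a\<le>n. h a * f a\<bar> = \<bar>\<Sum>c<n. ?H c * (f (Suc c) - f c)\<bar>"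
    by (subst abel_sum) (simp add: neutral)
  also have "\<dots> \<le> (\<Sum>c<n. \<bar>?H c\<bar> * \<bar>f (Suc c) - f c\<bar>)"
    by (rule order_trans[OF sum_abs]) (simp add: abs_mult)
  also have "\<dots> \<le> (\<Sum>c<n. \<bar>?H c\<bar> * (L * D c))"
  proof (intro sum_mono mult_left_mono)
    fix c assume "c \<in> {..<n}"
    then show "\<bar>f (Suc c) - f c\<bar> \<le> L * D c"
      using lip[of "Suc c" c] D0[of c] by (auto simp: D_def)
  qed auto
  also have "\<dots> = (\<Sum>c<n. sqrt (D c) * \<bar>?H c\<bar> * (L * sqrt (D c)))"
  proof (intro sum.cong refl)
    fix c assume "c \<in> {..<n}"
    then have "D c = sqrt (D c) * sqrt (D c)" using D0[of c] by auto
    then have "\<bar>?H c\<bar> * (L * D c) = \<bar>?H c\<bar> * (L * (sqrt (D c) * sqrt (D c)))" by simp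
    then show "\<bar>?H c\<bar> * (L * D c) = sqrt (D c) * \<bar>?H c\<bar> * (L * sqrt (D c))"
      by (simp only: mult_ac)
  qed
  finally have "(\<Sum>a\<le>n. h a * f a)\<^sup>2 \<le> (\<Sum>c<n. sqrt (D c) * \<bar>?H c\<bar> * (L * sqrt (D c)))\<^sup>2"
    by (metis abs_ge_zero power2_abs power_mono)
  also have "\<dots> \<le> (\<Sum>c<n. (sqrt (D c) * \<bar>?H c\<bar>)\<^sup>2) * (\<Sum>c<n. (L * sqrt (D c))\<^sup>2)"
    by (rule Cauchy_Schwarz_ineq_sum)
  also have "(\<Sum>c<n. (sqrt (D c) * \<bar>?H c\<bar>)\<^sup>2) = (\<Sum>c<n. D c * (?H c)\<^sup>2)"
    using D0 by (intro sum.cong) (auto simp: power_mult_distrib)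
  also have "(\<Sum>c<n. (L * sqrt (D c))\<^sup>2) = L\<^sup>2 * (\<Sum>c<n. D c)"
    unfolding sum_distrib_left using D0 by (intro sum.cong) (auto simp: power_mult_distrib)
  also have "(\<Sum>c<n. D c) = x n - x 0" unfolding D_def by (rule sum_lessThan_telescope)
  finally have "(\<Sum>a\<le>n. h a * f a)\<^sup>2 \<le> (\<Sum>c<n. D c * (?H c)\<^sup>2) * (L\<^sup>2 * (x n - x 0))" .
  also have "\<dots> \<le> (\<Sum>c<n. D c * (?H c)\<^sup>2) * (L\<^sup>2 * R)"
    using R D0 by (intro mult_left_mono sum_nonneg mult_nonneg_nonneg) auto
  also have "\<dots> = L\<^sup>2 * R * (\<Sum>c<n. D c * (?H c)\<^sup>2)" by simp
  finally have "2 * (\<Sum>a\<le>n. h a * f a)\<^sup>2 \<le> L\<^sup>2 * R * (2 * (\<Sum>c<n. D c * (?H c)\<^sup>2))" by simp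
  moreover have "- (\<Sum>a\<le>n. \<Sum>b\<le>n. h a * h b * \<bar>x a - x b\<bar>) = 2 * (\<Sum>c<n. D c * (?H c)\<^sup>2)"
    using distance_form[of n x h] mono neutral by (simp add: D_def power2_eq_square sum_negf)
  ultimately show ?thesis by simp
qed

section \<open>Rounding fractional occupations\<close>

definition bilin :: "(nat \<Rightarrow> nat \<Rightarrow> real) \<Rightarrow> nat \<Rightarrow> (nat \<Rightarrow> real) \<Rightarrow> (nat \<Rightarrow> real) \<Rightarrow> real" where
  "bilin K n p r = (\<Sum>a\<le>n. \<Sum>b\<le>n. K a b * p a * r b)"

text \<open>Both orders of each pair are summed, which reproduces the square of the difference in
  \<open>gibbs_weight\<close>.\<close>

definition energy :: "(nat \<Rightarrow> nat \<Rightarrow> real) \<Rightarrow> (nat \<Rightarrow> real) \<Rightarrow> nat \<Rightarrow> (nat \<Rightarrow> real) \<Rightarrow> real" where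
  "energy K v n p = bilin K n p p + (\<Sum>a\<le>n. v a * p a)"

lemma bilin_add_left: "bilin K n (\<lambda>a. p a + r a) s = bilin K n p s + bilin K n r s"
  by (simp add: bilin_def algebra_simps sum.distrib)

lemma bilin_add_right: "bilin K n s (\<lambda>a. p a + r a) = bilin K n s p + bilin K n s r"
  by (simp add: bilin_def algebra_simps sum.distrib)

lemma bilin_scale_left: "bilin K n (\<lambda>a. t * p a) s = t * bilin K n p s"
  by (simp add: bilin_def sum_distrib_left mult_ac)

lemma bilin_scale_right: "bilin K n s (\<lambda>a. t * p a) = t * bilin K n s p"
  by (simp add: bilin_def sum_distrib_left mult_ac)

lemma bilin_commute:
  assumes "\<And>a b. K a b = K b a"
  shows "bilin K n p r = bilin K n r p"
  unfolding bilin_def by (subst sum.swap) (use assms in \<open>simp add: mult_ac\<close>)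

lemma energy_add_scaled:
  assumes "\<And>a b. K a b = K b a"
  shows "energy K v n (\<lambda>a. p a + t * d a) =
    energy K v n p + t * (2 * bilin K n p d + (\<Sum>a\<le>n. v a * d a)) + t\<^sup>2 * bilin K n d d"
  using bilin_commute[of K n d p, OF assms]
  by (simp add: energy_def bilin_add_left bilin_add_right bilin_scale_left bilin_scale_right
      algebra_simps sum.distrib sum_distrib_left power2_eq_square)

abbreviation ind :: "nat set \<Rightarrow> nat \<Rightarrow> real" where
  "ind S \<equiv> \<lambda>a. of_bool (a \<in> S)"

text \<open>The relaxation of indicators of \<open>N\<close>-element sets; the upper bound 1 is the
  exclusion of two particles from one site.\<close>

definition frac_occ :: "nat \<Rightarrow> nat \<Rightarrow> (nat \<Rightarrow> real) \<Rightarrow> bool" where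
  "frac_occ n N p \<longleftrightarrow> (\<forall>a\<le>n. 0 \<le> p a \<and> p a \<le> 1) \<and> (\<Sum>a\<le>n. p a) = real N"

lemma bilin_dipole:
  assumes "a \<le> n" "b \<le> n" "\<And>a. K a a = 0" "\<And>a b. K a b = K b a"
  shows "bilin K n (\<lambda>c. of_bool (c = a) - of_bool (c = b)) (\<lambda>c. of_bool (c = a) - of_bool (c = b)) = - 2 * K a b"
proof -
  have "(\<Sum>d\<le>n. K c d * x * (of_bool (d = a) - of_bool (d = b))) = (K c a - K c b) * x" for c and x :: real
    using assms by (simp add: right_diff_distrib sum_subtractf of_bool_def if_distrib[of "(*) _"] algebra_simps cong: if_cong)
  then show ?thesis
    using assms by (simp add: bilin_def right_diff_distrib sum_subtractf sum_negf of_bool_def if_distrib[of "(*) _"] cong: if_cong)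
qed

lemma sum_dipole:
  fixes a b n :: nat
  assumes "a \<le> n" "b \<le> n"
  shows "(\<Sum>c\<le>n. of_bool (c = a) - of_bool (c = b)) = (0::real)"
  using assms by (simp add: sum_subtractf of_bool_def)

text \<open>The total is an integer, so a single fractional term cannot be the only one.\<close>

lemma frac_occ_two_fractional:
  assumes p: "frac_occ n N p" and a: "a \<le> n" "0 < p a" "p a < 1"
  shows "\<exists>b\<le>n. b \<noteq> a \<and> 0 < p b \<and> p b < 1"
proof (rule ccontr)
  assume "\<not> ?thesis"
  then have "p b \<in> {0, 1}" if "b \<le> n" "b \<noteq> a" for b
    using p that unfolding frac_occ_def by (metis insertCI order_less_le)
  then have "(\<Sum>b\<in>{..n} - {a}. p b) \<in> \<int>"
    by (intro Ints_sum) force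
  moreover have "(\<Sum>b\<le>n. p b) = p a + (\<Sum>b\<in>{..n} - {a}. p b)"
    using a by (intro sum.remove) auto
  ultimately have "p a \<in> \<int>"
    using p unfolding frac_occ_def by (metis Ints_diff Ints_of_nat add_diff_cancel_right')
  then show False using a by (auto elim!: Ints_cases)
qed

text \<open>Along \<open>e\<^sub>a - e\<^sub>b\<close> the energy is concave because the self-interaction is absent, so mass
  can be shifted between two fractional sites, without raising the energy, until one of them is
  empty or full.\<close>
lemma energy_rounding:
  assumes "\<And>a. K a a = 0" "\<And>a b. K a b = K b a" "\<And>a b. a \<le> n \<Longrightarrow> b \<le> n \<Longrightarrow> 0 \<le> K a b"
    and "frac_occ n N p"
  shows "\<exists>S\<subseteq>{..n}. card S = N \<and> energy K v n (ind S) \<le> energy K v n p"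
  using assms(4)
proof (induction "card {a\<in>{..n}. 0 < p a \<and> p a < 1}" arbitrary: p rule: less_induct)
  case less
  let ?F = "\<lambda>p. {a\<in>{..n}. 0 < p a \<and> p a < (1::real)}"
  note p = \<open>frac_occ n N p\<close>
  show ?case
  proof (cases "?F p = {}")
    case True
    then have 01: "of_bool (p a = 1) = p a" if "a \<le> n" for a
      using p that unfolding frac_occ_def by (force simp: of_bool_def order_less_le)
    let ?S = "{a\<in>{..n}. p a = 1}"
    have "energy K v n (ind (?S)) = energy K v n p"
      unfolding energy_def bilin_def
      by (intro arg_cong2[where f="(+)"] sum.cong refl) (use 01 in auto)
    moreover have "real (card ?S) = real N"
    proof -
      have "real N = (\<Sum>a\<le>n. p a)" using p by (simp add: frac_occ_def)
      also have "\<dots> = (\<Sum>a\<le>n. of_bool (p a = 1))" using 01 by (intro sum.cong) auto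
      also have "\<dots> = real (card ?S)" by (simp add: Int_def)
      finally show ?thesis by simp
    qed
    ultimately show ?thesis by (intro exI[of _ ?S]) auto
  next
    case False
    then obtain a0 where a0: "a0 \<le> n" "0 < p a0" "p a0 < 1" by auto
    obtain b0 where b0: "b0 \<le> n" "b0 \<noteq> a0" "0 < p b0" "p b0 < 1"
      using frac_occ_two_fractional[OF p a0] by auto
    define e where "e a b c = (of_bool (c = a) - of_bool (c = b) :: real)" for a b c :: nat
    \<comment> \<open>The first-order change of the energy along the exchange. Reversing the
      exchange flips its sign, so one of the two directions does not increase the energy to first
      order.\<close>
    define lin where "lin a b = 2 * bilin K n p (e a b) + (\<Sum>c\<le>n. v c * e a b c)" for a b
    have "bilin K n p (e a0 b0) = - bilin K n p (e b0 a0)"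
    proof -
      have "e a0 b0 = (\<lambda>c. - 1 * e b0 a0 c)" by (auto simp: e_def)
      then show ?thesis using bilin_scale_right[of K n p "- 1" "e b0 a0"] by simp
    qed
    moreover have "(\<Sum>c\<le>n. v c * e a0 b0 c) = - (\<Sum>c\<le>n. v c * e b0 a0 c)"
      unfolding e_def sum_negf[symmetric] by (intro sum.cong refl) (simp add: algebra_simps)
    ultimately have "lin a0 b0 = - lin b0 a0" by (simp add: lin_def)
    then have "lin a0 b0 \<le> 0 \<or> lin b0 a0 \<le> 0" by linarith
    then obtain a b where ab: "a \<le> n" "b \<le> n" "a \<noteq> b" "0 < p a" "p a < 1" "0 < p b" "p b < 1" "lin a b \<le> 0"
      using a0 b0 by blast
    define t where "t = min (1 - p a) (p b)"
    have t: "0 < t" "t \<le> 1 - p a" "t \<le> p b" "t = 1 - p a \<or> t = p b" using ab by (auto simp: t_def min_def)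
    define p' where "p' c = p c + t * e a b c" for c
    have p'a: "p' a = p a + t" "p' b = p b - t" "\<And>c. c \<noteq> a \<Longrightarrow> c \<noteq> b \<Longrightarrow> p' c = p c"
      using ab by (auto simp: p'_def e_def)
    have "frac_occ n N p'"
      unfolding frac_occ_def
    proof (intro conjI allI impI)
      fix c assume "c \<le> n"
      then show "0 \<le> p' c" "p' c \<le> 1"
        using p t ab p'a unfolding frac_occ_def by (cases "c = a"; cases "c = b"; auto)+
    next
      have "(\<Sum>c\<le>n. p' c) = (\<Sum>c\<le>n. p c) + t * (\<Sum>c\<le>n. e a b c)"
        by (simp add: p'_def sum.distrib sum_distrib_left)
      then show "(\<Sum>c\<le>n. p' c) = real N"
        using p sum_dipole[OF ab(1,2)] by (simp add: frac_occ_def e_def)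
    qed
    moreover have "?F p' \<subset> ?F p"
    proof
      show "?F p' \<subseteq> ?F p"
      proof
        fix c assume "c \<in> ?F p'"
        then show "c \<in> ?F p" using ab p'a by (cases "c = a"; cases "c = b") auto
      qed
      have "a \<in> ?F p" "b \<in> ?F p" "a \<notin> ?F p' \<or> b \<notin> ?F p'" using ab t p'a by auto
      then show "?F p' \<noteq> ?F p" by blast
    qed
    then have "card (?F p') < card (?F p)" by (intro psubset_card_mono) auto
    ultimately obtain S where S: "S \<subseteq> {..n}" "card S = N"
      "energy K v n (ind S) \<le> energy K v n p'"
      using less.hyps[of p'] by auto
    have "energy K v n p' = energy K v n p + t * lin a b + t\<^sup>2 * bilin K n (e a b) (e a b)"
      unfolding p'_def lin_def using assms by (intro energy_add_scaled) auto
    also have "bilin K n (e a b) (e a b) = - 2 * K a b"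
      unfolding e_def using ab assms by (intro bilin_dipole) auto
    also have "energy K v n p + t * lin a b + t\<^sup>2 * (- 2 * K a b) \<le> energy K v n p"
    proof -
      have "t * lin a b \<le> 0" using t ab by (simp add: mult_nonneg_nonpos)
      moreover have "0 \<le> t\<^sup>2 * (2 * K a b)" using ab assms(3)[of a b] by simp
      ultimately show ?thesis by (simp only: mult_minus_left mult_minus_right)
    qed
    finally show ?thesis using S by (intro exI[of _ S]) auto
  qed
qed

text \<open>Parallelogram identity: the linear part of the energy cancels, so the form of a
  difference is exactly the convexity defect at the midpoint.\<close>

lemma energy_midpoint:
  assumes "\<And>a b. K a b = K b a"
  shows "bilin K n (\<lambda>a. p a - r a) (\<lambda>a. p a - r a) =
    2 * (energy K v n p + energy K v n r) - 4 * energy K v n (\<lambda>a. (p a + r a) / 2)"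
proof -
  have 1: "energy K v n p = energy K v n (\<lambda>a. r a + 1 * (p a - r a))" by simp
  have 2: "energy K v n (\<lambda>a. (p a + r a) / 2) = energy K v n (\<lambda>a. r a + 1/2 * (p a - r a))"
    by (rule arg_cong[where f="energy K v n"]) (auto simp: field_simps)
  show ?thesis
    unfolding 1 2 energy_add_scaled[OF assms] by (simp add: algebra_simps power2_eq_square)
qed

text \<open>Division by \<open>R\<close>, a bound on all distances, makes the kernel nonnegative, as
  rounding requires; on sets of a fixed number of sites it only shifts the energy by a
  constant.\<close>

definition logK :: "real \<Rightarrow> (nat \<Rightarrow> real) \<Rightarrow> nat \<Rightarrow> nat \<Rightarrow> real" where
  "logK R x a b = (if a = b then 0 else ln (R / \<bar>x a - x b\<bar>))"

lemma logK_same [simp]: "logK R x a a = 0"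
  by (simp add: logK_def)

lemma logK_commute: "logK R x a b = logK R x b a"
  by (simp add: logK_def abs_minus_commute)

section \<open>Coercivity around a ground state\<close>

definition spaced :: "nat \<Rightarrow> (nat \<Rightarrow> real) \<Rightarrow> real \<Rightarrow> real \<Rightarrow> bool" where
  "spaced n x \<delta> R \<longleftrightarrow> 0 < \<delta> \<and> \<delta> \<le> R \<and> x n - x 0 \<le> R \<and>
     (\<forall>a b. a < b \<and> b \<le> n \<longrightarrow> \<delta> * (real b - real a) \<le> x b - x a)"

lemma spacedD:
  assumes "spaced n x \<delta> R"
  shows "0 < \<delta>" "\<delta> \<le> R" "0 < R" "x n - x 0 \<le> R"
    "\<And>a b. a < b \<Longrightarrow> b \<le> n \<Longrightarrow> \<delta> * (real b - real a) \<le> x b - x a"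
  using assms by (auto simp: spaced_def)

lemma spaced_mono:
  assumes "spaced n x \<delta> R" "a \<le> b" "b \<le> n"
  shows "x a \<le> x b"
proof (cases "a = b")
  case False
  have "0 < \<delta>" by (rule spacedD(1)[OF assms(1)])
  then have "0 \<le> \<delta> * (real b - real a)" using assms(2) by simp
  then show ?thesis using spacedD(5)[OF assms(1), of a b] assms False by auto
qed simp

lemma spaced_dist_ge:
  assumes "spaced n x \<delta> R" "a \<le> n" "b \<le> n"
  shows "\<delta> * \<bar>real a - real b\<bar> \<le> \<bar>x a - x b\<bar>"
proof (cases a b rule: linorder_cases)
  case less then show ?thesis using spacedD(5)[OF assms(1), of a b] assms by auto
next
  case greater then show ?thesis using spacedD(5)[OF assms(1), of b a] assms by auto
qed auto

lemma spaced_dist_le: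
  assumes "spaced n x \<delta> R" "a \<le> n" "b \<le> n"
  shows "\<bar>x a - x b\<bar> \<le> R"
  using spaced_mono[OF assms(1), of a n] spaced_mono[OF assms(1), of b n] spaced_mono[OF assms(1), of 0 a]
    spaced_mono[OF assms(1), of 0 b] spacedD(4)[OF assms(1)] assms by auto

lemma spaced_pos:
  assumes "spaced n x \<delta> R" "a \<le> n" "b \<le> n" "a \<noteq> b"
  shows "\<delta> \<le> \<bar>x a - x b\<bar>" "0 < \<bar>x a - x b\<bar>"
proof -
  have "1 \<le> \<bar>real a - real b\<bar>" using assms(4) by linarith
  then have "\<delta> * 1 \<le> \<delta> * \<bar>real a - real b\<bar>"
    using spacedD(1)[OF assms(1)] by (intro mult_left_mono) auto
  then show "\<delta> \<le> \<bar>x a - x b\<bar>" using spaced_dist_ge[OF assms(1-3)] by linarith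
  then show "0 < \<bar>x a - x b\<bar>" using spacedD(1)[OF assms(1)] by linarith
qed

lemma logK_nonneg:
  assumes "spaced n x \<delta> R" "a \<le> n" "b \<le> n"
  shows "0 \<le> logK R x a b"
proof (cases "a = b")
  case False
  have "1 \<le> R / \<bar>x a - x b\<bar>"
    using spaced_pos(2)[OF assms False] spaced_dist_le[OF assms] by (simp add: divide_simps)
  then show ?thesis using False by (simp add: logK_def)
qed simp

lemma logK_le:
  assumes "spaced n x \<delta> R" "a \<le> n" "b \<le> n" "a \<noteq> b"
  shows "logK R x a b \<le> ln (R / \<delta> / \<bar>real a - real b\<bar>)"
proof -
  have "0 < \<bar>real a - real b\<bar>" using assms by auto
  then have "R / \<bar>x a - x b\<bar> \<le> R / (\<delta> * \<bar>real a - real b\<bar>)"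
    using spaced_dist_ge[OF assms(1-3)] spacedD[OF assms(1)] spaced_pos[OF assms]
    by (intro divide_left_mono mult_pos_pos) auto
  then show ?thesis
    using assms spacedD[OF assms(1)] spaced_pos[OF assms] by (simp add: logK_def)
qed

lemma frac_occ_of_bool:
  assumes "S \<subseteq> {..n}" "card S = N"
  shows "frac_occ n N (ind S)"
  using assms by (auto simp: frac_occ_def Int_absorb1)

definition ground_state :: "real \<Rightarrow> (nat \<Rightarrow> real) \<Rightarrow> (nat \<Rightarrow> real) \<Rightarrow> nat \<Rightarrow> nat \<Rightarrow> nat set \<Rightarrow> bool" where
  "ground_state R x v n N S \<longleftrightarrow> S \<subseteq> {..n} \<and> card S = N \<and>
    (\<forall>S'\<subseteq>{..n}. card S' = N \<longrightarrow>
      energy (logK R x) v n (ind S) \<le> energy (logK R x) v n (ind S'))"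

lemma ground_state_exists:
  assumes "N \<le> Suc n"
  shows "\<exists>S. ground_state R x v n N S"
proof -
  let ?X = "{S. S \<subseteq> {..n} \<and> card S = N}" and ?e = "\<lambda>S. energy (logK R x) v n (ind S)"
  have "{..<N} \<in> ?X" using assms by auto
  then have "?X \<noteq> {}" by blast
  moreover have "finite ?X" by (rule finite_subset[of _ "Pow {..n}"]) auto
  ultimately have "arg_min_on ?e ?X \<in> ?X" "\<And>S'. S' \<in> ?X \<Longrightarrow> ?e (arg_min_on ?e ?X) \<le> ?e S'"
    using arg_min_if_finite(1)[of ?X ?e] arg_min_least[of ?X _ ?e] by blast+
  then show ?thesis unfolding ground_state_def by (intro exI[of _ "arg_min_on ?e ?X"]) simp
qed

text \<open>Rounding extends minimality from sets to fractional occupations, where no convexity of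
  the energy is available.\<close>

lemma ground_state_min:
  assumes "spaced n x \<delta> R" "ground_state R x v n N S" "frac_occ n N p"
  shows "energy (logK R x) v n (ind S) \<le> energy (logK R x) v n p"
proof -
  obtain S' where S': "S' \<subseteq> {..n}" "card S' = N"
    "energy (logK R x) v n (ind S') \<le> energy (logK R x) v n p"
    using energy_rounding[of "logK R x" n N p v, OF logK_same logK_commute logK_nonneg[OF assms(1)] assms(3)]
    by blast
  moreover have "energy (logK R x) v n (ind S) \<le> energy (logK R x) v n (ind S')"
    using assms(2) S'(1,2) unfolding ground_state_def by blast
  ultimately show ?thesis by (rule_tac order_trans)
qed

text \<open>The last summand on the right is the price of restoring the diagonal:
  \<open>ln (R / \<delta>) + 1\<close> at each site, weighted by the squared difference of
  occupations, and these squares sum to at most \<open>2 * real N\<close>.\<close>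

lemma ground_state_coercive:
  assumes sp: "spaced n x \<delta> R" and gs: "ground_state R x v n N S" and p: "frac_occ n N p"
    and lip: "\<And>a b. a \<le> n \<Longrightarrow> b \<le> n \<Longrightarrow> \<bar>f a - f b\<bar> \<le> L * \<bar>x a - x b\<bar>"
  shows "(\<Sum>a\<le>n. (p a - of_bool (a \<in> S)) * f a)\<^sup>2 \<le>
    L\<^sup>2 * R\<^sup>2 * (energy (logK R x) v n p - energy (logK R x) v n (ind S) + (ln (R / \<delta>) + 1) * real N)"
proof -
  let ?K = "logK R x" and ?s = "ind S"
  define h where "h a = p a - ?s a" for a
  note R = spacedD[OF sp]
  have s: "frac_occ n N ?s" using gs frac_occ_of_bool by (auto simp: ground_state_def)
  have "frac_occ n N (\<lambda>a. (p a + ?s a) / 2)"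
    unfolding frac_occ_def
  proof (intro conjI allI impI)
    fix a assume "a \<le> n"
    then have "0 \<le> p a" "p a \<le> 1" using p by (auto simp: frac_occ_def)
    then show "0 \<le> (p a + ?s a) / 2" "(p a + ?s a) / 2 \<le> 1" by auto
  next
    have "(\<Sum>a\<le>n. (p a + ?s a) / 2) = ((\<Sum>a\<le>n. p a) + (\<Sum>a\<le>n. ?s a)) / 2"
      by (simp only: sum_divide_distrib[symmetric] sum.distrib)
    then show "(\<Sum>a\<le>n. (p a + ?s a) / 2) = real N"
      using p s unfolding frac_occ_def by simp
  qed
  from ground_state_min[OF sp gs this] have B: "bilin ?K n h h \<le> 2 * (energy ?K v n p - energy ?K v n ?s)"
    unfolding h_def by (subst energy_midpoint[OF logK_commute, where v = v]) simp
  have h0: "(\<Sum>a\<le>n. h a) = 0" using p s by (simp add: h_def sum_subtractf frac_occ_def)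
  have "(\<Sum>a\<le>n. h a * h a) \<le> (\<Sum>a\<le>n. p a + ?s a)"
  proof (rule sum_mono)
    fix a assume "a \<in> {..n}"
    then have pa: "0 \<le> p a" "p a \<le> 1" using p by (auto simp: frac_occ_def)
    then have "p a * p a \<le> p a" using mult_left_le by blast
    with pa show "h a * h a \<le> p a + ?s a" by (auto simp: h_def algebra_simps)
  qed
  also have "\<dots> = 2 * real N" using p s by (simp add: sum.distrib frac_occ_def)
  finally have h2: "(\<Sum>a\<le>n. h a * h a) \<le> 2 * real N" .
  have "0 \<le> (\<Sum>a\<le>n. \<Sum>b\<le>n. h a * h b *
     (if a = b then ln (R / \<delta>) else ln (R / \<bar>x a - x b\<bar>) + \<bar>x a - x b\<bar> / R - 1))"
    using R spaced_pos[OF sp] spaced_dist_le[OF sp] by (intro log_kernel_psd) auto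
  \<comment> \<open>The constant -1 is extended to the diagonal and compensated there by the
    \<open>+ 1\<close>. Summed over all pairs it gives minus the square of the total charge, which
    vanishes.\<close>
  also have "\<dots> = (\<Sum>a\<le>n. \<Sum>b\<le>n. ?K a b * h a * h b + h a * h b * \<bar>x a - x b\<bar> / R - h a * h b
      + (if b = a then (ln (R / \<delta>) + 1) * (h a * h a) else 0))"
    by (intro sum.cong refl) (auto simp: logK_def algebra_simps)
  also have "\<dots> = bilin ?K n h h + (\<Sum>a\<le>n. \<Sum>b\<le>n. h a * h b * \<bar>x a - x b\<bar>) / R
      - (\<Sum>a\<le>n. h a) * (\<Sum>a\<le>n. h a) + (ln (R / \<delta>) + 1) * (\<Sum>a\<le>n. h a * h a)"
    unfolding sum_product sum_divide_distrib sum_distrib_left[of "ln (R / \<delta>) + 1"]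
    by (simp add: sum.distrib sum_subtractf bilin_def)
  finally have D: "- (\<Sum>a\<le>n. \<Sum>b\<le>n. h a * h b * \<bar>x a - x b\<bar>) / R \<le>
      bilin ?K n h h + (ln (R / \<delta>) + 1) * (\<Sum>a\<le>n. h a * h a)"
    using h0 by simp
  have "0 \<le> ln (R / \<delta>)" using R by simp
  then have "(ln (R / \<delta>) + 1) * (\<Sum>a\<le>n. h a * h a) \<le> (ln (R / \<delta>) + 1) * (2 * real N)"
    using h2 by (intro mult_left_mono) auto
  with D B have "- (\<Sum>a\<le>n. \<Sum>b\<le>n. h a * h b * \<bar>x a - x b\<bar>) / R \<le>
      2 * (energy ?K v n p - energy ?K v n ?s + (ln (R / \<delta>) + 1) * real N)"
    by (simp add: algebra_simps)
  then have D': "- (\<Sum>a\<le>n. \<Sum>b\<le>n. h a * h b * \<bar>x a - x b\<bar>) \<le>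
      R * (2 * (energy ?K v n p - energy ?K v n ?s + (ln (R / \<delta>) + 1) * real N))"
    using R by (simp add: field_simps)
  have "2 * (\<Sum>a\<le>n. h a * f a)\<^sup>2 \<le> L\<^sup>2 * R * (- (\<Sum>a\<le>n. \<Sum>b\<le>n. h a * h b * \<bar>x a - x b\<bar>))"
    by (rule neutral_test_bound) (use R h0 lip spaced_mono[OF sp] in auto)
  also have "\<dots> \<le> L\<^sup>2 * R * (R * (2 * (energy ?K v n p - energy ?K v n ?s + (ln (R / \<delta>) + 1) * real N)))"
    using D' R by (intro mult_left_mono) auto
  also have "\<dots> = 2 * (L\<^sup>2 * R\<^sup>2 * (energy ?K v n p - energy ?K v n ?s + (ln (R / \<delta>) + 1) * real N))"
    by (simp only: power2_eq_square mult_ac)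
  finally show ?thesis unfolding h_def by (simp only: mult_le_cancel_left_pos zero_less_numeral)
qed

text \<open>This is the elementary Stirling bound that n! is at least (n/e)^n.\<close>

lemma sum_ln_ratio_le:
  assumes "0 < A" "1 \<le> n"
  shows "(\<Sum>k=1..n. ln (A / real k)) \<le> real n * (1 + ln (A / real n))"
  using assms(2)
proof (induction n rule: dec_induct)
  case (step n)
  have "ln (1 + 1 / real n) \<le> 1 / real n" using step by (intro ln_add_one_self_le_self) auto
  moreover have "1 + 1 / real n = real (Suc n) / real n" using step by (simp add: field_simps)
  then have "ln (1 + 1 / real n) = ln (real (Suc n)) - ln (real n)"
    using step by (simp only:) (simp add: ln_div)
  ultimately have "real n * (ln (real (Suc n)) - ln (real n)) \<le> real n * (1 / real n)"
    by (intro mult_left_mono) auto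
  then have "real n * (ln (real (Suc n)) - ln (real n)) \<le> 1" using step by simp
  moreover have "real n * (1 + ln (A / real n)) + ln (A / real (Suc n)) =
      real (Suc n) * (1 + ln (A / real (Suc n))) + (real n * (ln (real (Suc n)) - ln (real n)) - 1)"
    using step assms by (simp add: ln_div algebra_simps)
  ultimately show ?case using step by simp
qed simp

text \<open>By \<open>1 + ln y \<le> y\<close> at \<open>y = A / real n\<close>, the bound no longer
  depends on \<open>n\<close>.\<close>

lemma sum_ln_ratio_le':
  assumes "0 < A"
  shows "(\<Sum>k=1..n. ln (A / real k)) \<le> A"
proof (cases "n = 0")
  case False
  have "real n * (1 + ln (A / real n)) \<le> real n * (A / real n)"
    using ln_le_minus_one[of "A / real n"] assms False by (intro mult_left_mono) auto
  with sum_ln_ratio_le[of A n] assms False show ?thesis by auto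
qed (use assms in auto)

lemma real_nat_dist: "real (a - b + (b - a)) = \<bar>real a - real b\<bar>"
  by (cases "a \<le> b") (auto simp: of_nat_diff)

text \<open>With truncated subtraction \<open>a - b + (b - a)\<close> is the distance of the
  indices, and each distance from \<open>a\<close> occurs at most twice.\<close>

lemma sum_two_sided:
  fixes \<phi> :: "nat \<Rightarrow> real"
  assumes "a \<le> n" and nn: "\<And>k. k \<in> {1..n} \<Longrightarrow> 0 \<le> \<phi> k"
  shows "(\<Sum>b\<le>n. if a = b then 0 else \<phi> (a - b + (b - a))) \<le> 2 * (\<Sum>k=1..n. \<phi> k)"
proof -
  let ?g = "\<lambda>b. if a = b then 0 else \<phi> (a - b + (b - a))"
  have "{..n} = {..<a} \<union> ({a} \<union> {a<..n})" using assms by auto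
  then have "(\<Sum>b\<le>n. ?g b) = (\<Sum>b<a. ?g b) + (?g a + (\<Sum>b\<in>{a<..n}. ?g b))"
    by (simp only:) (subst sum.union_disjoint; auto)+
  also have "(\<Sum>b<a. ?g b) = (\<Sum>k=1..a. \<phi> k)"
    by (rule sum.reindex_bij_witness[of _ "\<lambda>k. a - k" "\<lambda>b. a - b"]) auto
  also have "(\<Sum>b\<in>{a<..n}. ?g b) = (\<Sum>k=1..n - a. \<phi> k)"
    by (rule sum.reindex_bij_witness[of _ "\<lambda>k. a + k" "\<lambda>b. b - a"]) auto
  also have "(\<Sum>k=1..a. \<phi> k) \<le> (\<Sum>k=1..n. \<phi> k)" using assms by (intro sum_mono2) auto
  also have "(\<Sum>k=1..n - a. \<phi> k) \<le> (\<Sum>k=1..n. \<phi> k)" using assms by (intro sum_mono2) auto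
  finally show ?thesis by simp
qed

lemma ln_ratio_nonneg:
  assumes sp: "spaced n x \<delta> R" and "k \<in> {1..n}"
  shows "0 \<le> ln (R / \<delta> / real k)"
proof -
  have "\<delta> * real k \<le> R"
    using spaced_dist_ge[OF sp, of k 0] spaced_dist_le[OF sp, of k 0] assms(2) by simp
  then show ?thesis using spacedD(1)[OF sp] assms(2) by (simp add: field_simps)
qed

text \<open>The logarithm is integrable at zero, so a row costs only the order of
  \<open>R / \<delta>\<close>, without a logarithmic factor. Hence adding a bounded number of
  particles is cheap.\<close>

lemma sum_logK_row:
  assumes sp: "spaced n x \<delta> R" and "a \<le> n"
  shows "(\<Sum>b\<le>n. logK R x a b) \<le> 2 * R / \<delta>"
proof -
  have "(\<Sum>b\<le>n. logK R x a b) \<le> (\<Sum>b\<le>n. if a = b then 0 else ln (R / \<delta> / real (a - b + (b - a))))"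
    unfolding real_nat_dist using logK_le[OF sp assms(2)] by (intro sum_mono) auto
  also have "\<dots> \<le> 2 * (\<Sum>k=1..n. ln (R / \<delta> / real k))"
    using assms(2) ln_ratio_nonneg[OF sp] by (rule sum_two_sided)
  also have "(\<Sum>k=1..n. ln (R / \<delta> / real k)) \<le> R / \<delta>" using spacedD[OF sp] by (intro sum_ln_ratio_le') auto
  finally show ?thesis by simp
qed

text \<open>The missing mass is spread in proportion to the room \<open>1 - r a\<close> left at each
  site, which respects the exclusion bound. One unit of mass meets a full row of the kernel at most
  twice.\<close>

lemma fill_up:
  assumes sp: "spaced n x \<delta> R"
    and r: "\<And>a. a \<le> n \<Longrightarrow> 0 \<le> r a \<and> r a \<le> 1"
    and s: "(\<Sum>a\<le>n. r a) = real N - s" "0 \<le> s" and N: "N \<le> Suc n"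
    and v: "\<And>a. a \<le> n \<Longrightarrow> v a \<le> W"
  shows "\<exists>p. frac_occ n N p \<and> (\<forall>a\<le>n. r a \<le> p a) \<and>
    energy (logK R x) v n p \<le> energy (logK R x) v n r + s * (4 * R / \<delta> + W)"
proof -
  let ?K = "logK R x"
  \<comment> \<open>If every site is full, the denominator is zero; then \<open>s = 0\<close> as
    well, and division by zero gives \<open>t = 0\<close>.\<close>
  define t where "t = s / (real (Suc n) - (\<Sum>a\<le>n. r a))"
  define d where "d a = t * (1 - r a)" for a
  have den: "s \<le> real (Suc n) - (\<Sum>a\<le>n. r a)" using s N by linarith
  have t: "0 \<le> t" "t \<le> 1" using den s(2) by (auto simp: t_def divide_simps)
  have ts: "t * (real (Suc n) - (\<Sum>a\<le>n. r a)) = s"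
    using den s(2) by (cases "real (Suc n) - (\<Sum>a\<le>n. r a) = 0") (auto simp: t_def)
  have d: "0 \<le> d a" "r a + d a \<le> 1" if "a \<le> n" for a
  proof -
    show "0 \<le> d a" using r[OF that] t by (simp add: d_def)
    have "d a \<le> 1 * (1 - r a)" unfolding d_def using r[OF that] t by (intro mult_right_mono) auto
    then show "r a + d a \<le> 1" by simp
  qed
  have sd: "(\<Sum>a\<le>n. d a) = s"
    unfolding d_def sum_distrib_left[symmetric] using ts by (simp add: sum_subtractf)
  define p where "p a = r a + d a" for a
  have "frac_occ n N p" using d r sd s by (auto simp: frac_occ_def p_def sum.distrib intro: add_nonneg_nonneg)
  moreover have "energy ?K v n p = energy ?K v n r + (2 * bilin ?K n r d + (\<Sum>a\<le>n. v a * d a)) + bilin ?K n d d"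
    using energy_add_scaled[of ?K v n r 1 d, OF logK_commute] by (simp add: p_def[abs_def])
  moreover have B: "bilin ?K n q d \<le> 2 * R / \<delta> * s" if "\<And>a. a \<le> n \<Longrightarrow> q a \<le> 1" for q
  proof -
    have "bilin ?K n q d \<le> (\<Sum>a\<le>n. \<Sum>b\<le>n. ?K a b * 1 * d b)"
      unfolding bilin_def using that d logK_nonneg[OF sp]
      by (intro sum_mono mult_right_mono mult_left_mono) auto
    also have "\<dots> = (\<Sum>b\<le>n. (\<Sum>a\<le>n. ?K b a) * d b)"
      by (subst sum.swap) (simp add: sum_distrib_right logK_commute)
    also have "\<dots> \<le> (\<Sum>b\<le>n. 2 * R / \<delta> * d b)"
      using sum_logK_row[OF sp] d by (intro sum_mono mult_right_mono) auto
    also have "\<dots> = 2 * R / \<delta> * s" by (simp only: sum_distrib_left[symmetric] sd)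
    finally show ?thesis .
  qed
  have "2 * bilin ?K n r d + bilin ?K n d d \<le> 4 * R / \<delta> * s"
  proof -
    \<comment> \<open>Regrouping the increment as the interaction of \<open>d\<close> with
      \<open>p\<close> and with \<open>r\<close>, both bounded by 1, uses the row bound twice; this
      is the 4 in the statement.\<close>
    have "bilin ?K n r d + bilin ?K n d d = bilin ?K n p d" by (simp add: p_def[abs_def] bilin_add_left)
    then show ?thesis using B[of p] B[of r] d r by (force simp: p_def)
  qed
  moreover have "(\<Sum>a\<le>n. v a * d a) \<le> W * s"
    unfolding sd[symmetric] sum_distrib_left using v d by (intro sum_mono mult_right_mono) auto
  ultimately show ?thesis
    using d by (intro exI[of _ p]) (auto simp: p_def algebra_simps)
qed

section \<open>Refining the lattice\<close>

lemma sum_inverse_le: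
  "(\<Sum>k=1..n. 1 / real k) \<le> 1 + ln (real (Suc n))"
proof (cases "n = 0")
  case False
  then have "1 \<le> n" by simp
  then have "(\<Sum>k=1..n. 1 / real k) \<le> 1 + ln (real n)"
  proof (induction n rule: dec_induct)
    case (step n)
    have "ln (real n / real (Suc n)) \<le> real n / real (Suc n) - 1"
      using step by (intro ln_le_minus_one) auto
    also have "\<dots> = - (1 / real (Suc n))" by (simp add: field_simps)
    finally have "1 / real (Suc n) \<le> ln (real (Suc n)) - ln (real n)"
      using step by (simp add: ln_div)
    then show ?case using step by simp
  qed simp
  also have "\<dots> \<le> 1 + ln (real (Suc n))" using False by simp
  finally show ?thesis .
qed simp

lemma sum_blocks:
  fixes g :: "nat \<Rightarrow> real"
  assumes "1 \<le> m"
  shows "(\<Sum>k<m * n. g (k div m)) = real m * (\<Sum>a<n. g a)"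
proof -
  have "(\<Sum>k<m * n. g (k div m)) = (\<Sum>a<n. \<Sum>k\<in>{a * m..<a * m + m}. g (k div m))"
    using sum.nat_group[of "\<lambda>k. g (k div m)" m n] by (simp add: mult.commute)
  also have "\<dots> = (\<Sum>a<n. \<Sum>k\<in>{a * m..<a * m + m}. g a)"
  proof (intro sum.cong refl)
    fix a k assume "k \<in> {a * m..<a * m + m}"
    then have "k div m = a" by (intro div_nat_eqI) (auto simp: mult.commute)
    then show "g (k div m) = g a" by simp
  qed
  finally show ?thesis by (simp add: sum_distrib_left)
qed

lemma abs_ln_diff_le:
  fixes s t l :: real
  assumes "0 < l" "l \<le> s" "l \<le> t"
  shows "\<bar>ln s - ln t\<bar> \<le> \<bar>s - t\<bar> / l"
proof -
  have *: "ln s - ln t \<le> \<bar>s - t\<bar> / l" if "l \<le> s" "l \<le> t" for s t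
  proof -
    have "ln s - ln t = ln (s / t)" using that assms by (simp add: ln_div)
    also have "\<dots> \<le> s / t - 1" using that assms by (intro ln_le_minus_one) auto
    also have "\<dots> = (s - t) / t" using that assms by (simp add: field_simps)
    also have "\<dots> \<le> \<bar>s - t\<bar> / t" using that assms by (intro divide_right_mono) auto
    also have "\<dots> \<le> \<bar>s - t\<bar> / l" using that assms by (intro divide_left_mono) auto
    finally show ?thesis .
  qed
  show ?thesis using *[of s t] *[of t s] assms by (auto simp: abs_if)
qed

lemma sum_blocks_le:
  fixes g :: "nat \<Rightarrow> real"
  assumes m: "1 \<le> m" and g: "\<And>a. a \<le> n \<Longrightarrow> 0 \<le> g a"
  shows "(\<Sum>k | k \<le> n' \<and> k div m \<le> n. g (k div m)) \<le> real m * (\<Sum>a\<le>n. g a)"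
proof -
  have iff: "k div m \<le> n \<longleftrightarrow> k < m * Suc n" for k
    using m by (simp add: less_Suc_eq_le[symmetric] div_less_iff_less_mult mult.commute)
  have "(\<Sum>k | k \<le> n' \<and> k div m \<le> n. g (k div m)) \<le> (\<Sum>k<m * Suc n. g (k div m))"
    using iff g by (intro sum_mono2) auto
  then show ?thesis using sum_blocks[OF m, of g "Suc n"] by (simp only: lessThan_Suc_atMost)
qed

lemma sum_overhang_le:
  fixes g :: "nat \<Rightarrow> real"
  assumes "\<bar>real i - real j\<bar> \<le> B" "\<And>k. k < i \<Longrightarrow> \<bar>g k\<bar> \<le> G" "0 \<le> G"
  shows "\<bar>(\<Sum>k<i. g k) - (\<Sum>k\<in>{..<i} \<inter> {..<j}. g k)\<bar> \<le> B * G"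
proof -
  have "(\<Sum>k<i. g k) = (\<Sum>k\<in>{..<i} \<inter> {..<j}. g k) + (\<Sum>k\<in>{j..<i}. g k)"
    by (subst sum.union_disjoint[symmetric]) (auto intro!: sum.cong)
  then have "\<bar>(\<Sum>k<i. g k) - (\<Sum>k\<in>{..<i} \<inter> {..<j}. g k)\<bar> = \<bar>\<Sum>k\<in>{j..<i}. g k\<bar>" by simp
  also have "\<dots> \<le> (\<Sum>k\<in>{j..<i}. G)" by (rule order_trans[OF sum_abs], rule sum_mono) (use assms(2) in auto)
  also have "\<dots> = real (i - j) * G" by simp
  also have "\<dots> \<le> B * G" using assms(1,3) by (intro mult_right_mono) (auto simp: of_nat_diff_if)
  finally show ?thesis .
qed

text \<open>A lattice for \<open>N\<close> particles beside one for \<open>N * m\<close> particles,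
  where fine site \<open>k\<close> belongs to the coarse site \<open>k div m\<close>. The numbers of
  sites need not match exactly: \<open>D\<close> bounds the mismatch in blocks. The potentials are
  compared in sum through \<open>T\<close>, not pointwise, because the derivative of the limiting
  potential may blow up at the ends.\<close>

locale refinement =
  fixes n n' m N :: nat and x x' V V' :: "nat \<Rightarrow> real" and c R C W T D :: real
  assumes m: "1 \<le> m" and N: "1 \<le> N"
    and sp: "spaced n x (c / real N) R" and sp': "spaced n' x' (c / (real N * real m)) R"
    and cR: "2 * c \<le> R" and C: "0 \<le> C"
    and near: "\<And>k. k \<le> n' \<Longrightarrow> k div m \<le> n \<Longrightarrow> \<bar>x' k - x (k div m)\<bar> \<le> C / real N"
    and V: "\<And>a. a \<le> n \<Longrightarrow> \<bar>V a\<bar> \<le> W" and V': "\<And>k. k \<le> n' \<Longrightarrow> \<bar>V' k\<bar> \<le> W"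
    and T: "(\<Sum>k | k \<le> n' \<and> k div m \<le> n. \<bar>V' k - V (k div m)\<bar>) \<le> T * real m"
    and D: "\<bar>real (Suc n') - real m * real (Suc n)\<bar> \<le> D * real m"
    and N_le: "N \<le> Suc n" "N * m \<le> Suc n'"
begin

text \<open>The fine sites whose block exists on the coarse lattice. Either lattice may stick out
  beyond the other.\<close>

definition "J = {k. k \<le> n' \<and> k div m \<le> n}"

abbreviation "E \<equiv> energy (logK R x) (\<lambda>a. real N * V a) n"
abbreviation "E' \<equiv> energy (logK R x') (\<lambda>k. real N * real m * V' k) n'"

lemma J_eq: "J = {..n'} \<inter> {..<m * Suc n}"
proof -
  have "k div m \<le> n \<longleftrightarrow> k < m * Suc n" for k
    using m by (simp add: less_Suc_eq_le[symmetric] div_less_iff_less_mult mult.commute)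
  then show ?thesis by (auto simp: J_def)
qed

lemma finite_J [simp]: "finite J" by (simp add: J_eq)

lemma D0: "0 \<le> D"
proof -
  have "0 \<le> D * real m" using D by linarith
  then show ?thesis using m by (simp add: zero_le_mult_iff)
qed

lemma W0: "0 \<le> W" using V[of 0] by simp

lemma c0: "0 < c" using spacedD(1)[OF sp] N by (simp add: zero_less_divide_iff)

lemma R0: "0 < R" using spacedD(3)[OF sp] .

lemma real_ge1: "1 \<le> real m" "1 \<le> real N" using m N by auto

lemma RN: "2 * c \<le> R * real N"
proof -
  have "R * 1 \<le> R * real N" using R0 real_ge1 by (intro mult_left_mono) auto
  then show ?thesis using cR by linarith
qed

lemma sum_J_coarse:
  assumes "\<And>a. a \<le> n \<Longrightarrow> \<bar>g a\<bar> \<le> G"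
  shows "\<bar>(\<Sum>k\<in>J. g (k div m)) - real m * (\<Sum>a\<le>n. g a)\<bar> \<le> D * real m * G"
proof -
  have "\<bar>(\<Sum>k<m * Suc n. g (k div m)) - (\<Sum>k\<in>{..<m * Suc n} \<inter> {..<Suc n'}. g (k div m))\<bar> \<le> D * real m * G"
  proof (rule sum_overhang_le)
    show "\<bar>real (m * Suc n) - real (Suc n')\<bar> \<le> D * real m" using D unfolding of_nat_mult by linarith
    fix k assume "k < m * Suc n"
    then have "k div m < Suc n" using m by (simp add: div_less_iff_less_mult mult.commute)
    then show "\<bar>g (k div m)\<bar> \<le> G" by (intro assms) simp
  qed (use assms[of 0] in simp)
  moreover have "{..<m * Suc n} \<inter> {..<Suc n'} = J" by (auto simp: J_eq)
  ultimately show ?thesis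
    unfolding sum_blocks[OF m, of g "Suc n"] by (simp only: lessThan_Suc_atMost abs_minus_commute)
qed

lemma sum_J_fine:
  assumes "\<And>k. k \<le> n' \<Longrightarrow> \<bar>g k\<bar> \<le> G"
  shows "\<bar>(\<Sum>k\<le>n'. g k) - (\<Sum>k\<in>J. g k)\<bar> \<le> D * real m * G"
proof -
  have "\<bar>(\<Sum>k<Suc n'. g k) - (\<Sum>k\<in>{..<Suc n'} \<inter> {..<m * Suc n}. g k)\<bar> \<le> D * real m * G"
    by (rule sum_overhang_le) (use D assms order_trans[OF abs_ge_zero assms[of 0]] in \<open>auto simp: less_Suc_eq_le simp flip: of_nat_Suc of_nat_mult\<close>)
  then show ?thesis by (simp only: lessThan_Suc_atMost J_eq)
qed

lemma sum_J_le:
  assumes "\<And>a. a \<le> n \<Longrightarrow> 0 \<le> g a"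
  shows "(\<Sum>k\<in>J. g (k div m)) \<le> real m * (\<Sum>a\<le>n. g a)"
  unfolding J_def using m assms by (rule sum_blocks_le)

lemma potential_J:
  assumes "\<And>k. k \<in> J \<Longrightarrow> 0 \<le> t k \<and> t k \<le> 1"
  shows "\<bar>(\<Sum>k\<in>J. V' k * t k) - (\<Sum>k\<in>J. V (k div m) * t k)\<bar> \<le> T * real m"
proof -
  have "\<bar>(\<Sum>k\<in>J. V' k * t k) - (\<Sum>k\<in>J. V (k div m) * t k)\<bar> = \<bar>\<Sum>k\<in>J. (V' k - V (k div m)) * t k\<bar>"
    by (simp add: sum_subtractf left_diff_distrib)
  also have "\<dots> \<le> (\<Sum>k\<in>J. \<bar>V' k - V (k div m)\<bar>)"
    using assms by (intro order_trans[OF sum_abs] sum_mono) (simp add: abs_mult mult_left_le)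
  also have "\<dots> \<le> T * real m" using T by (simp add: J_def)
  finally show ?thesis .
qed

lemma block_dist:
  "real m * \<bar>real (k div m) - real (l div m)\<bar> \<le> \<bar>real k - real l\<bar> + real m"
  "\<bar>real k - real l\<bar> \<le> real m * \<bar>real (k div m) - real (l div m)\<bar> + real m"
proof -
  have k: "real k = real m * real (k div m) + real (k mod m)" for k
    by (metis mult_div_mod_eq of_nat_add of_nat_mult)
  have "real (k mod m) \<le> real m" "real (l mod m) \<le> real m" using m by (auto intro: less_imp_le)
  moreover have "real m * \<bar>real (k div m) - real (l div m)\<bar> = \<bar>real m * real (k div m) - real m * real (l div m)\<bar>"
    by (simp add: abs_mult right_diff_distrib[symmetric])
  ultimately show "real m * \<bar>real (k div m) - real (l div m)\<bar> \<le> \<bar>real k - real l\<bar> + real m"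
    "\<bar>real k - real l\<bar> \<le> real m * \<bar>real (k div m) - real (l div m)\<bar> + real m"
    using k[of k] k[of l] by linarith+
qed

text \<open>Displacements amounting to \<open>2 * C / N\<close> against a distance of at least
  \<open>c * d / (2 * N)\<close>, with \<open>d\<close> the block distance, change the logarithm by
  at most \<open>4 * C / (c * d)\<close>.\<close>

definition "e a b = (if a = b then 0 else 4 * C / c * (1 / \<bar>real a - real b\<bar>))"

lemma e_nonneg: "0 \<le> e a b"
  using C c0 by (simp add: e_def)

text \<open>The harmonic sum makes the error of a whole row logarithmic; this is one source of the N
  ln N in the comparison of energies.\<close>

lemma e_row:
  assumes "a \<le> n"
  shows "(\<Sum>b\<le>n. e a b) \<le> 8 * C / c * (1 + ln (real (Suc n)))"
proof -
  have "(\<Sum>b\<le>n. e a b) = (\<Sum>b\<le>n. if a = b then 0 else 4 * C / c * (1 / real (a - b + (b - a))))"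
    unfolding real_nat_dist e_def ..
  also have "\<dots> \<le> 2 * (\<Sum>k=1..n. 4 * C / c * (1 / real k))"
    using assms by (rule sum_two_sided) (use C c0 in auto)
  also have "\<dots> = 8 * C / c * (\<Sum>k=1..n. 1 / real k)" by (simp add: sum_distrib_left)
  also have "\<dots> \<le> 8 * C / c * (1 + ln (real (Suc n)))"
    using C c0 by (intro mult_left_mono sum_inverse_le) auto
  finally show ?thesis .
qed

text \<open>For equal or adjacent blocks, fine sites may be far closer than coarse ones. At block
  distance \<open>d\<close> of at least 2 the index distance of the fine sites is still at least
  \<open>m * d / 2\<close>, so both distances admit the same lower bound.\<close>

lemma far_compare:
  assumes "k \<in> J" "l \<in> J" "2 \<le> \<bar>real (k div m) - real (l div m)\<bar>"
  shows "\<bar>logK R x' k l - logK R x (k div m) (l div m)\<bar> \<le> e (k div m) (l div m)"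
proof -
  define a b where "a = k div m" and "b = l div m"
  define d where "d = \<bar>real a - real b\<bar>"
  have d: "2 \<le> d" using assms by (simp add: d_def a_def b_def)
  have kl: "k \<le> n'" "l \<le> n'" "a \<le> n" "b \<le> n" using assms by (auto simp: J_def a_def b_def)
  have ab: "a \<noteq> b" "k \<noteq> l" using d by (auto simp: d_def a_def b_def)
  have "real m * d \<le> \<bar>real k - real l\<bar> + real m" unfolding d_def a_def b_def by (rule block_dist)
  moreover have "real m * 2 \<le> real m * d" using d by (intro mult_left_mono) auto
  ultimately have "real m * d / 2 \<le> \<bar>real k - real l\<bar>" by linarith
  then have "c / (real N * real m) * (real m * d / 2) \<le> c / (real N * real m) * \<bar>real k - real l\<bar>"
    using c0 by (intro mult_left_mono) auto
  also have "\<dots> \<le> \<bar>x' k - x' l\<bar>" by (rule spaced_dist_ge[OF sp' kl(1,2)])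
  finally have 1: "c * d / (2 * real N) \<le> \<bar>x' k - x' l\<bar>" using real_ge1 by (simp add: field_simps)
  have "c * d / (2 * real N) \<le> c / real N * d" using c0 d real_ge1 by (simp add: field_simps)
  also have "\<dots> \<le> \<bar>x a - x b\<bar>" unfolding d_def by (rule spaced_dist_ge[OF sp kl(3,4)])
  finally have 2: "c * d / (2 * real N) \<le> \<bar>x a - x b\<bar>" .
  have pos: "0 < c * d / (2 * real N)" using c0 d real_ge1 by simp
  have "\<bar>logK R x' k l - logK R x a b\<bar> = \<bar>ln \<bar>x a - x b\<bar> - ln \<bar>x' k - x' l\<bar>\<bar>"
    using ab R0 spaced_pos[OF sp kl(3,4) ab(1)] spaced_pos[OF sp' kl(1,2) ab(2)]
    by (simp add: logK_def ln_div)
  also have "\<dots> \<le> \<bar>\<bar>x a - x b\<bar> - \<bar>x' k - x' l\<bar>\<bar> / (c * d / (2 * real N))"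
    by (rule abs_ln_diff_le[OF pos 2 1])
  also have "\<dots> \<le> (2 * C / real N) / (c * d / (2 * real N))"
  proof (intro divide_right_mono)
    have "\<bar>x' k - x a\<bar> \<le> C / real N" "\<bar>x' l - x b\<bar> \<le> C / real N"
      using near kl unfolding a_def b_def by auto
    then show "\<bar>\<bar>x a - x b\<bar> - \<bar>x' k - x' l\<bar>\<bar> \<le> 2 * C / real N" by linarith
  qed (use pos in auto)
  also have "\<dots> = e a b" using ab c0 d real_ge1 by (simp add: e_def d_def[symmetric] field_simps)
  finally show ?thesis by (simp add: a_def b_def)
qed

text \<open>These are the pairs not forced into blocks at distance 2 or more. The Stirling bound for
  \<open>2 * m\<close> neighbours divides the ratio of diameter to fine spacing by
  \<open>2 * m\<close>, so the logarithm no longer depends on \<open>m\<close>.\<close>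

lemma near_row:
  assumes "k \<le> n'"
  shows "(\<Sum>l\<le>n'. if k < l + 2 * m \<and> l < k + 2 * m then logK R x' k l else 0)
    \<le> 4 * real m * (1 + ln (R * real N / (2 * c)))"
proof -
  let ?A = "R / (c / (real N * real m))"
  define \<phi> where "\<phi> j = (if j < 2 * m then ln (?A / real j) else 0)" for j
  have nn: "0 \<le> ln (?A / real j)" if "j \<in> {1..2 * m}" for j
  proof -
    have "c * real j \<le> c * (2 * real m)" using that c0 by (intro mult_left_mono) auto
    also have "\<dots> \<le> R * real N * real m" using RN real_ge1 mult_right_mono[OF RN, of "real m"] by (simp add: mult_ac)
    finally show ?thesis using that c0 real_ge1 by (simp add: divide_simps mult_ac)
  qed
  have "(\<Sum>l\<le>n'. if k < l + 2 * m \<and> l < k + 2 * m then logK R x' k l else 0)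
      \<le> (\<Sum>l\<le>n'. if k = l then 0 else \<phi> (k - l + (l - k)))"
    unfolding \<phi>_def real_nat_dist using logK_le[OF sp' assms] by (intro sum_mono) auto
  also have "\<dots> \<le> 2 * (\<Sum>j=1..n'. \<phi> j)"
  proof (rule sum_two_sided[OF assms])
    fix j assume "j \<in> {1..n'}"
    then show "0 \<le> \<phi> j" using nn[of j] by (simp add: \<phi>_def)
  qed
  also have "(\<Sum>j=1..n'. \<phi> j) \<le> (\<Sum>j=1..2 * m. ln (?A / real j))"
  proof -
    have "(\<Sum>j=1..n'. \<phi> j) = (\<Sum>j\<in>{1..n'} \<inter> {..<2 * m}. ln (?A / real j))"
      by (rule sum.mono_neutral_cong_right) (auto simp: \<phi>_def)
    also have "\<dots> \<le> (\<Sum>j=1..2 * m. ln (?A / real j))" using nn by (intro sum_mono2) auto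
    finally show ?thesis .
  qed
  also have "\<dots> \<le> real (2 * m) * (1 + ln (?A / real (2 * m)))"
    using m c0 R0 real_ge1 by (intro sum_ln_ratio_le) auto
  also have "?A / real (2 * m) = R * real N / (2 * c)" using real_ge1 by simp
  finally show ?thesis by simp
qed

text \<open>The energy error per coarse particle, after division by the square of \<open>m\<close>:
  far pairs, near pairs when spreading, adjacent blocks when averaging, the potential, and mass lost
  and refilled at the ends. A single quantity serves both directions.\<close>

definition "err = 8 * C / c * (1 + ln (real (Suc n))) + 4 * (1 + ln (R * real N / (2 * c)))
  + 2 * ln (R * real N / c) + T + D * (4 * R / c + 2 * W)"

text \<open>Copying \<open>p\<close> to all fine sites of a block multiplies mass by
  \<open>m\<close> and energy by its square. Near pairs are estimated without reference to coarse
  pairs. Blocks lacking fine sites lose mass at most \<open>D * m\<close>, which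
  \<open>fill_up\<close> puts back.\<close>

lemma refine_upper:
  assumes p: "frac_occ n N p" and f: "\<And>k. k \<le> n' \<Longrightarrow> \<bar>f (x' k)\<bar> \<le> F" "\<And>a. a \<le> n \<Longrightarrow> \<bar>f (x a)\<bar> \<le> F"
    and lip: "\<And>s t. \<bar>f s - f t\<bar> \<le> L * \<bar>s - t\<bar>" and L: "0 \<le> L"
  shows "\<exists>p'. frac_occ n' (N * m) p' \<and> E' p' \<le> (real m)\<^sup>2 * (E p + real N * err) \<and>
    \<bar>(\<Sum>k\<le>n'. p' k * f (x' k)) - real m * (\<Sum>a\<le>n. p a * f (x a))\<bar> \<le> real m * (2 * D * F + L * C)"
proof -
  let ?K = "logK R x" and ?K' = "logK R x'"
  define H where "H = 8 * C / c * (1 + ln (real (Suc n)))"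
  define Q where "Q = 4 * (1 + ln (R * real N / (2 * c)))"
  define r where "r k = (if k div m \<le> n then p (k div m) else 0)" for k
  have p01: "0 \<le> p a" "p a \<le> 1" if "a \<le> n" for a using p that by (auto simp: frac_occ_def)
  have r01: "0 \<le> r k" "r k \<le> 1" for k using p01 by (auto simp: r_def)
  have to_J: "(\<Sum>k\<le>n'. g k * r k) = (\<Sum>k\<in>J. g k * p (k div m))" for g
    by (rule sum.mono_neutral_cong_right) (auto simp: J_def r_def)
  have Jn: "k \<le> n'" "k div m \<le> n" if "k \<in> J" for k using that by (auto simp: J_def)
  have F: "0 \<le> F" using f(2)[of 0] by simp
  have sr: "\<bar>(\<Sum>k\<le>n'. r k) - real m * real N\<bar> \<le> D * real m"
    using sum_J_coarse[of p 1] to_J[of "\<lambda>_. 1"] p01 p by (simp add: frac_occ_def)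
  have sr': "(\<Sum>k\<le>n'. r k) \<le> real m * real N"
    using sum_J_le[of p] to_J[of "\<lambda>_. 1"] p01 p by (simp add: frac_occ_def)
  have row: "(\<Sum>l\<in>J. ?K' k l * p (l div m)) \<le> real m * ((\<Sum>b\<le>n. ?K (k div m) b * p b) + H + Q)"
    if k: "k \<in> J" for k
  proof -
    let ?a = "k div m"
    let ?g = "\<lambda>b. ?K ?a b * p b + e ?a b"
    let ?near = "\<lambda>l. if k < l + 2 * m \<and> l < k + 2 * m then ?K' k l else 0"
    have g: "0 \<le> ?g b" if "b \<le> n" for b
      using logK_nonneg[OF sp Jn(2)[OF k] that] p01[OF that] e_nonneg by (intro add_nonneg_nonneg mult_nonneg_nonneg) auto
    have "(\<Sum>l\<in>J. ?K' k l * p (l div m)) \<le> (\<Sum>l\<in>J. ?near l + ?g (l div m))"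
    proof (rule sum_mono)
      fix l assume l: "l \<in> J"
      have K0: "0 \<le> ?K' k l" using logK_nonneg[OF sp'] Jn k l by auto
      note pl = p01[OF Jn(2)[OF l]]
      show "?K' k l * p (l div m) \<le> ?near l + ?g (l div m)"
      proof (cases "k < l + 2 * m \<and> l < k + 2 * m")
        case True
        have "?K' k l * p (l div m) \<le> ?K' k l" using K0 pl by (intro mult_left_le)
        then show ?thesis using True g[OF Jn(2)[OF l]] by simp
      next
        case False
        then have "l div m + 2 \<le> k div m \<or> k div m + 2 \<le> l div m"
          using div_le_mono[of "l + 2 * m" k m] div_le_mono[of "k + 2 * m" l m] m by auto
        then have "2 \<le> \<bar>real ?a - real (l div m)\<bar>" by linarith
        from far_compare[OF k l this] have "?K' k l \<le> ?K ?a (l div m) + e ?a (l div m)" by linarith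
        then have "?K' k l * p (l div m) \<le> (?K ?a (l div m) + e ?a (l div m)) * p (l div m)"
          using pl by (intro mult_right_mono) auto
        also have "\<dots> \<le> ?g (l div m)"
          using mult_left_le[OF pl(2) e_nonneg[of ?a "l div m"]] by (simp add: algebra_simps)
        finally show ?thesis unfolding if_not_P[OF False] by simp
      qed
    qed
    also have "\<dots> = (\<Sum>l\<in>J. ?near l) + (\<Sum>l\<in>J. ?g (l div m))" by (rule sum.distrib)
    also have "(\<Sum>l\<in>J. ?near l) \<le> (\<Sum>l\<le>n'. ?near l)"
      using logK_nonneg[OF sp' Jn(1)[OF k]] by (intro sum_mono2) (auto simp: J_def)
    also have "\<dots> \<le> real m * Q" using near_row[OF Jn(1)[OF k]] unfolding Q_def by (simp only: mult_ac)
    also have "(\<Sum>l\<in>J. ?g (l div m)) \<le> real m * (\<Sum>b\<le>n. ?g b)" by (rule sum_J_le) (rule g)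
    also have "(\<Sum>b\<le>n. ?g b) \<le> (\<Sum>b\<le>n. ?K ?a b * p b) + H"
      using e_row[OF Jn(2)[OF k]] by (simp add: sum.distrib H_def)
    finally show ?thesis using real_ge1 by (simp add: algebra_simps)
  qed
  have bil: "bilin ?K' n' r r \<le> (real m)\<^sup>2 * (bilin ?K n p p + real N * (H + Q))"
  proof -
    have HQ: "0 \<le> H" "0 \<le> Q"
    proof -
      show "0 \<le> H" using C c0 by (simp add: H_def)
      have "2 * c \<le> R * real N" by (rule RN)
      then show "0 \<le> Q" using c0 by (simp add: Q_def)
    qed
    have "bilin ?K' n' r r = (\<Sum>k\<le>n'. (\<Sum>l\<le>n'. ?K' k l * r l) * r k)"
      unfolding bilin_def sum_distrib_right by (intro sum.cong refl) (simp only: mult_ac)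
    also have "\<dots> = (\<Sum>k\<in>J. (\<Sum>l\<in>J. ?K' k l * p (l div m)) * p (k div m))"
      by (simp only: to_J)
    also have "\<dots> \<le> (\<Sum>k\<in>J. (real m * ((\<Sum>b\<le>n. ?K (k div m) b * p b) + H + Q)) * p (k div m))"
      using row p01 Jn by (intro sum_mono mult_right_mono) auto
    also have "\<dots> \<le> real m * (\<Sum>a\<le>n. (real m * ((\<Sum>b\<le>n. ?K a b * p b) + H + Q)) * p a)"
      using p01 HQ real_ge1 logK_nonneg[OF sp]
      by (intro sum_J_le[where g = "\<lambda>a. (real m * ((\<Sum>b\<le>n. ?K a b * p b) + H + Q)) * p a"]
          mult_nonneg_nonneg add_nonneg_nonneg sum_nonneg) auto
    also have "(\<Sum>a\<le>n. (real m * ((\<Sum>b\<le>n. ?K a b * p b) + H + Q)) * p a)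
        = real m * ((\<Sum>a\<le>n. (\<Sum>b\<le>n. ?K a b * p b) * p a) + (H + Q) * (\<Sum>a\<le>n. p a))"
      unfolding sum_distrib_left[of _ _ "{..n}"] sum.distrib[symmetric]
      by (intro sum.cong refl) (simp add: algebra_simps sum_distrib_left)
    also have "(\<Sum>a\<le>n. p a) = real N" using p by (simp add: frac_occ_def)
    also have "(\<Sum>a\<le>n. (\<Sum>b\<le>n. ?K a b * p b) * p a) = bilin ?K n p p"
      unfolding bilin_def sum_distrib_right by (intro sum.cong refl) (simp only: mult_ac)
    finally show ?thesis by (simp add: power2_eq_square algebra_simps)
  qed
  have pot: "(\<Sum>k\<le>n'. V' k * r k) \<le> real m * ((\<Sum>a\<le>n. V a * p a) + T + D * W)"
  proof -
    have "(\<Sum>k\<le>n'. V' k * r k) = (\<Sum>k\<in>J. V' k * p (k div m))" by (rule to_J)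
    also have "\<dots> \<le> (\<Sum>k\<in>J. V (k div m) * p (k div m)) + T * real m"
      using potential_J[of "\<lambda>k. p (k div m)"] p01 Jn by fastforce
    also have "(\<Sum>k\<in>J. V (k div m) * p (k div m)) \<le> real m * (\<Sum>a\<le>n. V a * p a) + D * real m * W"
    proof -
      have "\<bar>V a * p a\<bar> \<le> W" if "a \<le> n" for a
      proof -
        have "\<bar>V a\<bar> * \<bar>p a\<bar> \<le> W * 1" using V[OF that] p01[OF that] W0 by (intro mult_mono) auto
        then show ?thesis by (simp add: abs_mult)
      qed
      from sum_J_coarse[of "\<lambda>a. V a * p a", OF this] show ?thesis by linarith
    qed
    finally show ?thesis by (simp add: algebra_simps)
  qed
  define s where "s = real (N * m) - (\<Sum>k\<le>n'. r k)"
  have s: "0 \<le> s" "s \<le> D * real m" using sr sr' by (auto simp: s_def mult.commute)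
  obtain p' where p': "frac_occ n' (N * m) p'" "\<And>k. k \<le> n' \<Longrightarrow> r k \<le> p' k"
    and E': "E' p' \<le> E' r + s * (4 * R / (c / (real N * real m)) + real N * real m * W)"
    using fill_up[OF sp', of r "N * m" s "\<lambda>k. real N * real m * V' k" "real N * real m * W"]
      r01 s N_le V' real_ge1 by (force simp: s_def)
  have "s * (4 * R / (c / (real N * real m)) + real N * real m * W) \<le>
      (D * real m) * (4 * R / (c / (real N * real m)) + real N * real m * W)"
    using s R0 c0 real_ge1 W0 by (intro mult_right_mono) auto
  also have "\<dots> = (real m)\<^sup>2 * (real N * (D * (4 * R / c + W)))"
    using c0 by (simp add: power2_eq_square field_simps)
  finally have s_bound: "s * (4 * R / (c / (real N * real m)) + real N * real m * W) \<le>
    (real m)\<^sup>2 * (real N * (D * (4 * R / c + W)))" .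
  have "E' r = bilin ?K' n' r r + real N * real m * (\<Sum>k\<le>n'. V' k * r k)"
    by (simp add: energy_def sum_distrib_left mult_ac)
  also have "\<dots> \<le> (real m)\<^sup>2 * (bilin ?K n p p + real N * (H + Q)) +
      real N * real m * (real m * ((\<Sum>a\<le>n. V a * p a) + T + D * W))"
    using bil pot by (intro add_mono mult_left_mono) auto
  also have "\<dots> = (real m)\<^sup>2 * (E p + real N * (H + Q + T + D * W))"
    by (simp add: energy_def sum_distrib_left[symmetric] mult.assoc power2_eq_square algebra_simps)
  finally have "E' p' \<le> (real m)\<^sup>2 * (E p + real N * (H + Q + T + D * W)) + (real m)\<^sup>2 * (real N * (D * (4 * R / c + W)))"
    using E' s_bound by linarith
  also have "\<dots> = (real m)\<^sup>2 * (E p + real N * (H + Q + T + D * (4 * R / c + 2 * W)))"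
    by (simp add: algebra_simps)
  also have "\<dots> \<le> (real m)\<^sup>2 * (E p + real N * err)"
  proof -
    have "c * 1 \<le> R * real N" using cR R0 c0 real_ge1 by (intro mult_mono) auto
    then have "0 \<le> ln (R * real N / c)" using c0 by simp
    then show ?thesis using real_ge1 by (intro mult_left_mono add_left_mono) (auto simp: err_def H_def Q_def)
  qed
  finally have "E' p' \<le> (real m)\<^sup>2 * (E p + real N * err)" .
  moreover have "\<bar>(\<Sum>k\<le>n'. p' k * f (x' k)) - real m * (\<Sum>a\<le>n. p a * f (x a))\<bar> \<le> real m * (2 * D * F + L * C)"
  proof -
    have "\<bar>(\<Sum>k\<le>n'. p' k * f (x' k)) - (\<Sum>k\<le>n'. r k * f (x' k))\<bar> \<le> s * F"
    proof -
      have "\<bar>(\<Sum>k\<le>n'. p' k * f (x' k)) - (\<Sum>k\<le>n'. r k * f (x' k))\<bar> = \<bar>\<Sum>k\<le>n'. (p' k - r k) * f (x' k)\<bar>"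
        by (simp add: sum_subtractf algebra_simps)
      also have "\<dots> \<le> (\<Sum>k\<le>n'. (p' k - r k) * F)"
        using f(1) p'(2) by (intro order_trans[OF sum_abs] sum_mono) (auto simp: abs_mult intro!: mult_mono)
      also have "\<dots> = s * F" using p'(1) by (simp add: sum_distrib_right[symmetric] sum_subtractf s_def frac_occ_def)
      finally show ?thesis .
    qed
    also have "\<dots> \<le> D * real m * F" using s F by (intro mult_right_mono)
    finally have 1: "\<bar>(\<Sum>k\<le>n'. p' k * f (x' k)) - (\<Sum>k\<le>n'. r k * f (x' k))\<bar> \<le> D * real m * F" .
    have 2: "\<bar>(\<Sum>k\<le>n'. r k * f (x' k)) - (\<Sum>k\<in>J. p (k div m) * f (x (k div m)))\<bar> \<le> real m * (L * C)"
    proof -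
      have "(\<Sum>k\<le>n'. r k * f (x' k)) = (\<Sum>k\<in>J. p (k div m) * f (x' k))"
        using to_J[of "\<lambda>k. f (x' k)"] by (simp add: mult.commute)
      then have "\<bar>(\<Sum>k\<le>n'. r k * f (x' k)) - (\<Sum>k\<in>J. p (k div m) * f (x (k div m)))\<bar> =
          \<bar>\<Sum>k\<in>J. p (k div m) * (f (x' k) - f (x (k div m)))\<bar>"
        by (simp add: sum_subtractf algebra_simps)
      also have "\<dots> \<le> (\<Sum>k\<in>J. p (k div m) * (L * (C / real N)))"
      proof (rule order_trans[OF sum_abs], rule sum_mono)
        fix k assume k: "k \<in> J"
        have "\<bar>f (x' k) - f (x (k div m))\<bar> \<le> L * \<bar>x' k - x (k div m)\<bar>" by (rule lip)
        also have "\<dots> \<le> L * (C / real N)" using near Jn[OF k] L by (intro mult_left_mono) auto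
        finally have "p (k div m) * \<bar>f (x' k) - f (x (k div m))\<bar> \<le> p (k div m) * (L * (C / real N))"
          using p01(1)[OF Jn(2)[OF k]] by (rule mult_left_mono)
        then show "\<bar>p (k div m) * (f (x' k) - f (x (k div m)))\<bar> \<le> p (k div m) * (L * (C / real N))"
          unfolding abs_mult abs_of_nonneg[OF p01(1)[OF Jn(2)[OF k]]] .
      qed
      also have "\<dots> = (\<Sum>k\<in>J. p (k div m)) * (L * (C / real N))" by (rule sum_distrib_right[symmetric])
      also have "\<dots> \<le> (real m * real N) * (L * (C / real N))"
        using sum_J_le[of p] p01 p L C by (intro mult_right_mono) (auto simp: frac_occ_def)
      finally show ?thesis using real_ge1 by simp
    qed
    have 3: "\<bar>(\<Sum>k\<in>J. p (k div m) * f (x (k div m))) - real m * (\<Sum>a\<le>n. p a * f (x a))\<bar> \<le> D * real m * F"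
    proof (rule sum_J_coarse[where g = "\<lambda>a. p a * f (x a)"])
      fix a assume a: "a \<le> n"
      have "\<bar>p a\<bar> * \<bar>f (x a)\<bar> \<le> 1 * F" using p01[OF a] f(2)[OF a] by (intro mult_mono) auto
      then show "\<bar>p a * f (x a)\<bar> \<le> F" by (simp add: abs_mult)
    qed
    have "real m * (2 * D * F + L * C) = D * real m * F + real m * (L * C) + D * real m * F" by (simp add: algebra_simps)
    then show ?thesis using 1 2 3 by linarith
  qed
  ultimately show ?thesis using p' by blast
qed

text \<open>Averaging over blocks keeps occupations below 1, since a block has at most
  \<open>m\<close> sites. Close fine pairs only help, because the kernel is nonnegative; the
  comparison loses something only for adjacent blocks, for displaced far pairs, in the potential and
  at the ends.\<close>

lemma refine_lower:
  assumes p: "frac_occ n' (N * m) p'"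
  shows "\<exists>p. frac_occ n N p \<and> E p \<le> E' p' / (real m)\<^sup>2 + real N * err"
proof -
  let ?K = "logK R x" and ?K' = "logK R x'"
  define H where "H = 8 * C / c * (1 + ln (real (Suc n)))"
  define Q where "Q = 2 * ln (R * real N / c)"
  have p01: "0 \<le> p' k" "p' k \<le> 1" if "k \<le> n'" for k using p that by (auto simp: frac_occ_def)
  have Jn: "k \<le> n'" "k div m \<le> n" if "k \<in> J" for k using that by (auto simp: J_def)
  define r where "r a = (\<Sum>k | k \<in> J \<and> k div m = a. p' k) / real m" for a
  have r01: "0 \<le> r a \<and> r a \<le> 1" if "a \<le> n" for a
  proof
    show "0 \<le> r a" using p01 Jn by (auto simp: r_def intro!: divide_nonneg_nonneg sum_nonneg)
    have "(\<Sum>k | k \<in> J \<and> k div m = a. p' k) \<le> (\<Sum>k\<in>{a * m..<a * m + m}. 1)"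
    proof (rule order_trans[OF sum_mono])
      show "(\<Sum>k | k \<in> J \<and> k div m = a. 1::real) \<le> (\<Sum>k\<in>{a * m..<a * m + m}. 1)"
      proof (rule sum_mono2)
        show "{k \<in> J. k div m = a} \<subseteq> {a * m..<a * m + m}"
        proof
          fix k assume "k \<in> {k \<in> J. k div m = a}"
          then have "a = k div m" by simp
          moreover have "k div m * m \<le> k \<and> k < k div m * m + m"
            using m mod_less_divisor[of m k] div_mult_mod_eq[of k m] by linarith
          ultimately show "k \<in> {a * m..<a * m + m}" by simp
        qed
      qed auto
    qed (use p01 Jn in auto)
    then show "r a \<le> 1" using real_ge1 by (simp add: r_def)
  qed
  have avg: "(\<Sum>a\<le>n. g a * r a) = (\<Sum>k\<in>J. g (k div m) * p' k) / real m" for g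
  proof -
    have "(\<Sum>k\<in>J. g (k div m) * p' k) = (\<Sum>a\<le>n. \<Sum>k | k \<in> J \<and> k div m = a. g (k div m) * p' k)"
      by (rule sum.group[symmetric]) (auto simp: J_def)
    also have "\<dots> = (\<Sum>a\<le>n. g a * (\<Sum>k | k \<in> J \<and> k div m = a. p' k))"
      by (simp add: sum_distrib_left)
    also have "\<dots> = real m * (\<Sum>a\<le>n. g a * r a)"
      unfolding r_def sum_distrib_left[of _ _ "{..n}"] using real_ge1 by simp
    finally show ?thesis using real_ge1 by simp
  qed
  have sp'1: "(\<Sum>k\<le>n'. p' k) = real N * real m" using p by (simp add: frac_occ_def)
  have sJ: "(\<Sum>k\<in>J. p' k) \<le> real N * real m"
    unfolding sp'1[symmetric] using p01 by (intro sum_mono2) (auto simp: J_def)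
  have sJ': "\<bar>real N * real m - (\<Sum>k\<in>J. p' k)\<bar> \<le> D * real m"
    using sum_J_fine[of p' 1] p01 sp'1 by simp
  define s where "s = real N - (\<Sum>a\<le>n. r a)"
  have "real m * s = real N * real m - (\<Sum>k\<in>J. p' k)"
    using avg[of "\<lambda>_. 1"] real_ge1 by (simp add: s_def field_simps)
  then have "0 \<le> real m * s" "real m * s \<le> real m * D" using sJ sJ' by (auto simp: mult.commute)
  then have s: "0 \<le> s" "s \<le> D" using real_ge1 by (simp_all add: zero_le_mult_iff)
  obtain p where p1: "frac_occ n N p"
    and Ep: "E p \<le> E r + s * (4 * R / (c / real N) + real N * W)"
    using fill_up[OF sp, of r N s "\<lambda>a. real N * V a" "real N * W"]
      r01 s N_le V real_ge1 by (force simp: s_def)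
  have row: "(\<Sum>l\<in>J. ?K (k div m) (l div m) * p' l) \<le> (\<Sum>l\<le>n'. ?K' k l * p' l) + real m * (H + Q)"
    if k: "k \<in> J" for k
  proof -
    let ?a = "k div m"
    define g where "g b = e ?a b + (if b = Suc ?a \<or> ?a = Suc b then ln (R * real N / c) else 0)" for b
    have "c * 1 \<le> R * real N" using cR R0 c0 real_ge1 by (intro mult_mono) auto
    then have l0: "0 \<le> ln (R * real N / c)" using c0 by simp
    have g: "0 \<le> g b" for b using e_nonneg l0 by (simp add: g_def)
    have "(\<Sum>l\<in>J. ?K ?a (l div m) * p' l) \<le> (\<Sum>l\<in>J. ?K' k l * p' l + g (l div m))"
    proof (rule sum_mono)
      fix l assume l: "l \<in> J"
      let ?b = "l div m"
      have K0: "0 \<le> ?K' k l" using logK_nonneg[OF sp'] Jn k l by auto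
      note pl = p01[OF Jn(1)[OF l]]
      \<comment> \<open>The coarse kernel vanishes within a block, is at most
        \<open>ln (R * real N / c)\<close> between neighbours, and is close to the fine one
        otherwise.\<close>
      consider "?a = ?b" | "?a = Suc ?b \<or> ?b = Suc ?a" | "2 \<le> \<bar>real ?a - real ?b\<bar>" by linarith
      then have "?K ?a ?b \<le> ?K' k l + g ?b"
      proof cases
        case 1 then show ?thesis using K0 g[of ?b] by simp
      next
        case 2
        then have "\<bar>real ?a - real ?b\<bar> = 1" "?a \<noteq> ?b" by auto
        then have "?K ?a ?b \<le> ln (R * real N / c)"
          using logK_le[OF sp Jn(2)[OF k] Jn(2)[OF l]] by simp
        then show ?thesis using 2 K0 e_nonneg[of ?a ?b] by (auto simp: g_def)
      next
        case 3
        show ?thesis using far_compare[OF k l 3] l0 by (auto simp: g_def)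
      qed
      then have "?K ?a ?b * p' l \<le> (?K' k l + g ?b) * p' l" using pl by (intro mult_right_mono)
      also have "\<dots> \<le> ?K' k l * p' l + g ?b"
        using mult_left_le[OF pl(2) g[of ?b]] by (simp add: algebra_simps)
      finally show "?K ?a ?b * p' l \<le> ?K' k l * p' l + g ?b" .
    qed
    also have "\<dots> = (\<Sum>l\<in>J. ?K' k l * p' l) + (\<Sum>l\<in>J. g (l div m))" by (rule sum.distrib)
    also have "(\<Sum>l\<in>J. ?K' k l * p' l) \<le> (\<Sum>l\<le>n'. ?K' k l * p' l)"
      using logK_nonneg[OF sp' Jn(1)[OF k]] p01 by (intro sum_mono2) (auto simp: J_def)
    also have "(\<Sum>l\<in>J. g (l div m)) \<le> real m * (\<Sum>b\<le>n. g b)" by (rule sum_J_le) (rule g)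
    also have "(\<Sum>b\<le>n. g b) \<le> H + Q"
    proof -
      have "(\<Sum>b\<le>n. if b = Suc ?a \<or> ?a = Suc b then ln (R * real N / c) else 0)
          = (\<Sum>b\<in>{b. b \<le> n \<and> (b = Suc ?a \<or> ?a = Suc b)}. ln (R * real N / c))"
        by (rule sum.mono_neutral_cong_right) auto
      \<comment> \<open>For \<open>?a = 0\<close> the truncated \<open>?a - 1\<close> is 0, which is
        not a neighbour but only adds a nonnegative term.\<close>
      also have "\<dots> \<le> (\<Sum>b\<in>{Suc ?a, ?a - 1}. ln (R * real N / c))"
        using l0 by (intro sum_mono2) auto
      also have "\<dots> \<le> Q" using l0 by (simp add: Q_def card_insert_if)
      finally show ?thesis
        using e_row[OF Jn(2)[OF k]] by (simp add: g_def sum.distrib H_def)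
    qed
    finally show ?thesis using real_ge1 by (simp add: mult_left_mono)
  qed
  have "0 \<le> H" using C c0 by (simp add: H_def)
  have "c * 1 \<le> R * real N" using cR R0 c0 real_ge1 by (intro mult_mono) auto
  then have "0 \<le> Q" using c0 by (simp add: Q_def)
  have bil: "bilin ?K n r r * (real m)\<^sup>2 \<le> bilin ?K' n' p' p' + (real m)\<^sup>2 * (real N * (H + Q))"
  proof -
    have "bilin ?K n r r = (\<Sum>a\<le>n. (\<Sum>b\<le>n. ?K a b * r b) * r a)"
      unfolding bilin_def sum_distrib_right by (intro sum.cong refl) (simp only: mult_ac)
    also have "\<dots> = (\<Sum>k\<in>J. (\<Sum>l\<in>J. ?K (k div m) (l div m) * p' l) / real m * p' k) / real m"
      by (simp only: avg)
    finally have "bilin ?K n r r * (real m)\<^sup>2 = (\<Sum>k\<in>J. (\<Sum>l\<in>J. ?K (k div m) (l div m) * p' l) * p' k)"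
      using real_ge1 by (simp add: power2_eq_square sum_divide_distrib[symmetric])
    also have "\<dots> \<le> (\<Sum>k\<in>J. ((\<Sum>l\<le>n'. ?K' k l * p' l) + real m * (H + Q)) * p' k)"
      using row p01 Jn by (intro sum_mono mult_right_mono) auto
    also have "\<dots> \<le> (\<Sum>k\<le>n'. ((\<Sum>l\<le>n'. ?K' k l * p' l) + real m * (H + Q)) * p' k)"
      using p01 \<open>0 \<le> H\<close> \<open>0 \<le> Q\<close> logK_nonneg[OF sp']
      by (intro sum_mono2 mult_nonneg_nonneg add_nonneg_nonneg sum_nonneg) (auto simp: J_def)
    also have "\<dots> = (\<Sum>k\<le>n'. (\<Sum>l\<le>n'. ?K' k l * p' l) * p' k) + real m * (H + Q) * (\<Sum>k\<le>n'. p' k)"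
      by (simp add: sum_distrib_left sum.distrib distrib_right)
    also have "(\<Sum>k\<le>n'. (\<Sum>l\<le>n'. ?K' k l * p' l) * p' k) = bilin ?K' n' p' p'"
      unfolding bilin_def sum_distrib_right by (intro sum.cong refl) (simp only: mult_ac)
    finally show ?thesis by (simp add: sp'1 power2_eq_square mult_ac)
  qed
  have pot: "real m * (\<Sum>a\<le>n. V a * r a) \<le> (\<Sum>k\<le>n'. V' k * p' k) + real m * (T + D * W)"
  proof -
    have "real m * (\<Sum>a\<le>n. V a * r a) = (\<Sum>k\<in>J. V (k div m) * p' k)" using avg real_ge1 by simp
    also have "\<dots> \<le> (\<Sum>k\<in>J. V' k * p' k) + T * real m"
      using potential_J[of p'] p01 Jn by fastforce
    also have "(\<Sum>k\<in>J. V' k * p' k) \<le> (\<Sum>k\<le>n'. V' k * p' k) + D * real m * W"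
    proof -
      have "\<bar>V' k * p' k\<bar> \<le> W" if "k \<le> n'" for k
      proof -
        have "\<bar>V' k\<bar> * \<bar>p' k\<bar> \<le> W * 1" using V'[OF that] p01[OF that] W0 by (intro mult_mono) auto
        then show ?thesis by (simp add: abs_mult)
      qed
      from sum_J_fine[of "\<lambda>k. V' k * p' k", OF this] show ?thesis by linarith
    qed
    finally show ?thesis by (simp add: algebra_simps)
  qed
  have "(real m)\<^sup>2 * E r = bilin ?K n r r * (real m)\<^sup>2 + real N * real m * (real m * (\<Sum>a\<le>n. V a * r a))"
    by (simp add: energy_def sum_distrib_left[symmetric] mult.assoc power2_eq_square algebra_simps)
  also have "\<dots> \<le> bilin ?K' n' p' p' + (real m)\<^sup>2 * (real N * (H + Q)) +
      real N * real m * ((\<Sum>k\<le>n'. V' k * p' k) + real m * (T + D * W))"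
    using bil pot by (intro add_mono mult_left_mono) auto
  also have "\<dots> = E' p' + (real m)\<^sup>2 * (real N * (H + Q + T + D * W))"
    by (simp add: energy_def sum_distrib_left[symmetric] mult.assoc power2_eq_square algebra_simps)
  finally have "(real m)\<^sup>2 * E r \<le> E' p' + (real m)\<^sup>2 * (real N * (H + Q + T + D * W))" .
  then have 1: "E r \<le> E' p' / (real m)\<^sup>2 + real N * (H + Q + T + D * W)"
    using real_ge1 by (simp add: field_simps)
  have "s * (4 * R / (c / real N) + real N * W) \<le> D * (4 * R / (c / real N) + real N * W)"
    using s R0 c0 real_ge1 W0 by (intro mult_right_mono) auto
  also have "\<dots> = real N * (D * (4 * R / c + W))" using c0 by (simp add: field_simps)
  finally have "E p \<le> E' p' / (real m)\<^sup>2 + (real N * (H + Q + T + D * W) + real N * (D * (4 * R / c + W)))"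
    using 1 Ep by linarith
  also have "real N * (H + Q + T + D * W) + real N * (D * (4 * R / c + W)) =
      real N * (H + Q + T + D * (4 * R / c + 2 * W))"
    by (simp add: algebra_simps)
  also have "\<dots> \<le> real N * err"
  proof (intro mult_left_mono)
    have "2 * c \<le> R * real N" by (rule RN)
    then have "0 \<le> ln (R * real N / (2 * c))" using c0 by simp
    then show "H + Q + T + D * (4 * R / c + 2 * W) \<le> err" by (simp add: err_def H_def Q_def)
  qed simp
  finally show ?thesis using p1 by auto
qed

end

section \<open>The quadratic lattice and the potential\<close>

lemma exp_diff_lower:
  fixes s t :: real
  assumes "0 \<le> s" "s \<le> t"
  shows "t - s \<le> exp t - exp s"
proof -
  have "exp t = exp s * exp (t - s)" by (simp flip: exp_add)
  moreover have "1 * (exp (t - s) - 1) \<le> exp s * (exp (t - s) - 1)"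
    using assms by (intro mult_right_mono) auto
  moreover have "t - s \<le> exp (t - s) - 1" using exp_ge_add_one_self[of "t - s"] by linarith
  ultimately show ?thesis by (simp add: algebra_simps)
qed

lemma exp_diff_upper:
  fixes s t B :: real
  assumes "s \<le> B" "t \<le> B"
  shows "\<bar>exp t - exp s\<bar> \<le> exp B * \<bar>t - s\<bar>"
proof -
  have *: "exp t - exp s \<le> exp B * (t - s)" if "s \<le> t" "t \<le> B" for s t :: real
  proof -
    have "exp s = exp t * exp (s - t)" by (simp flip: exp_add)
    then have "exp t - exp s = exp t * (1 - exp (s - t))" by (simp add: algebra_simps)
    also have "\<dots> \<le> exp t * (t - s)" using exp_ge_add_one_self[of "s - t"] by (intro mult_left_mono) (linarith, simp)
    also have "\<dots> \<le> exp B * (t - s)" using that by (intro mult_right_mono) auto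
    finally show ?thesis .
  qed
  show ?thesis using *[of s t] *[of t s] assms by (cases "s \<le> t") (auto simp: abs_if)
qed

text \<open>In the scaled position \<open>t\<close> (site index over particle number) and with
  \<open>k\<close> equal to minus the logarithm of the base, this is the lattice map with
  exponential rate \<open>k\<close>.\<close>

definition qlat :: "real \<Rightarrow> real \<Rightarrow> real \<Rightarrow> real" where
  "qlat k v t = exp (k * t) + v * exp (- (k * t))"

text \<open>The derivative \<open>k * (exp (k * t) - v * exp (- (k * t)))\<close> is at least
  \<open>k * (1 - v)\<close>. A parameter \<open>v\<close> bounded away from 1 thus keeps the
  lattice points separated.\<close>

lemma qlat_lower:
  assumes "0 \<le> k" "0 \<le> v" "v \<le> 1" "0 \<le> s" "s \<le> t"
  shows "k * (1 - v) * (t - s) \<le> qlat k v t - qlat k v s"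
proof -
  have ks: "0 \<le> k * s" "k * s \<le> k * t" using assms by (auto intro: mult_left_mono)
  have 1: "k * t - k * s \<le> exp (k * t) - exp (k * s)" by (rule exp_diff_lower[OF ks])
  have "\<bar>exp (- (k * s)) - exp (- (k * t))\<bar> \<le> exp 0 * \<bar>- (k * s) - (- (k * t))\<bar>"
    using ks by (intro exp_diff_upper) auto
  then have "exp (- (k * s)) - exp (- (k * t)) \<le> k * t - k * s" using ks by simp
  then have "v * (exp (- (k * s)) - exp (- (k * t))) \<le> v * (k * t - k * s)"
    using assms by (intro mult_left_mono) auto
  with 1 show ?thesis by (simp add: qlat_def algebra_simps)
qed

lemma qlat_lipschitz:
  assumes "0 \<le> k" "0 \<le> v" "v \<le> 1" "0 \<le> s" "0 \<le> t" "s \<le> B" "t \<le> B"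
  shows "\<bar>qlat k v t - qlat k v s\<bar> \<le> 2 * k * exp (k * B) * \<bar>t - s\<bar>"
proof -
  have "k * s \<le> k * B" "k * t \<le> k * B" "0 \<le> k * s" "0 \<le> k * t" using assms by (auto intro: mult_left_mono)
  then have 1: "\<bar>exp (k * t) - exp (k * s)\<bar> \<le> exp (k * B) * \<bar>k * t - k * s\<bar>"
    and 2: "\<bar>exp (- (k * t)) - exp (- (k * s))\<bar> \<le> exp (k * B) * \<bar>- (k * t) - (- (k * s))\<bar>"
    by (intro exp_diff_upper; linarith)+
  have "\<bar>v * (exp (- (k * t)) - exp (- (k * s)))\<bar> \<le> 1 * \<bar>exp (- (k * t)) - exp (- (k * s))\<bar>"
    using assms unfolding abs_mult by (intro mult_right_mono) auto
  also note 2
  finally have 3: "\<bar>v * (exp (- (k * t)) - exp (- (k * s)))\<bar> \<le> exp (k * B) * \<bar>- (k * t) - (- (k * s))\<bar>" by simp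
  have ab: "\<bar>k * t - k * s\<bar> = k * \<bar>t - s\<bar>" "\<bar>- (k * t) - (- (k * s))\<bar> = k * \<bar>t - s\<bar>"
    using assms(1) by (simp_all add: abs_mult_pos right_diff_distrib[symmetric] abs_minus_commute mult.commute abs_mult)
  have "qlat k v t - qlat k v s = (exp (k * t) - exp (k * s)) + v * (exp (- (k * t)) - exp (- (k * s)))"
    by (simp add: qlat_def algebra_simps)
  then have "\<bar>qlat k v t - qlat k v s\<bar> \<le> exp (k * B) * (k * \<bar>t - s\<bar>) + exp (k * B) * (k * \<bar>t - s\<bar>)"
    using 1 3 unfolding ab by linarith
  then show ?thesis by (simp add: algebra_simps)
qed

text \<open>Only the product of rate and position enters, so the Lipschitz bound in the position
  also serves for a change of the rate.\<close>

lemma qlat_commute: "qlat k v t = qlat t v k"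
  by (simp add: qlat_def mult.commute)

lemma quad_pt_qlat:
  assumes "0 < q"
  shows "quad_pt q v t = qlat (- ln q) v t"
  using assms by (simp add: quad_pt_def qlat_def powr_def mult.commute)

section \<open>The scaled lattice points, their spacing and their limit\<close>

locale log_gas =
  fixes q M u :: real
    and qN uN :: "nat \<Rightarrow> real" and MN :: "nat \<Rightarrow> nat"
    and VN :: "nat \<Rightarrow> real \<Rightarrow> real" and V :: "real \<Rightarrow> real" and I :: "real set"
    and A1 A2 A3 A4 :: real
  assumes q: "0 < q" "q < 1" and M: "1 \<le> M" and u: "0 \<le> u" "u < 1"
    and qN: "\<And>N. 1 \<le> N \<Longrightarrow> 0 < qN N \<and> qN N < 1"
    and uN: "\<And>N. 1 \<le> N \<Longrightarrow> 0 \<le> uN N \<and> uN N < 1"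
    and MN: "\<And>N. 1 \<le> N \<Longrightarrow> N - 1 \<le> MN N"
    and A1: "0 < A1"
    and close: "\<And>N. 1 \<le> N \<Longrightarrow>
          real N ^ 2 * \<bar>qN N - q powr (1 / real N)\<bar> \<le> A1 \<and>
          \<bar>real (MN N) - real N * M\<bar> \<le> A1 \<and>
          real N * \<bar>uN N - u\<bar> \<le> A1"
    and I_lim: "{1 + u .. quad_pt q u M} \<subseteq> I"
    and I_N: "\<And>N. 1 \<le> N \<Longrightarrow> {1 + uN N .. quad_pt (qN N) (uN N) (real (MN N))} \<subseteq> I"
    and A2: "0 < A2"
    and VN_V: "\<And>N s. 1 \<le> N \<Longrightarrow> s \<in> {1 + uN N .. quad_pt (qN N) (uN N) (real (MN N))} \<Longrightarrow>
          \<bar>VN N s - V s\<bar> \<le> A2 * ln (real N) / real N"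
    and A3: "0 < A3" and V_bound: "\<And>s. s \<in> I \<Longrightarrow> \<bar>V s\<bar> \<le> A3"
    and V_diff: "\<And>s. s \<in> {1 + u <..< quad_pt q u M} \<Longrightarrow> V differentiable (at s)"
    and A4: "0 < A4"
    and V_deriv: "\<And>s. s \<in> {1 + u <..< quad_pt q u M} \<Longrightarrow>
          \<bar>deriv V s\<bar> \<le> A4 * (1 + \<bar>ln \<bar>s - 1 - u\<bar>\<bar> + \<bar>ln \<bar>s - quad_pt q u M\<bar>\<bar>)"
begin

definition "X N a = quad_pt (qN N) (uN N) (real a)"

definition "\<kappa> = - ln q"

text \<open>The exponential rate of the \<open>N\<close>-th lattice in the scaled position
  \<open>real a / real N\<close>; its limit is \<open>\<kappa>\<close>.\<close>

definition "\<kappa>N N = - real N * ln (qN N)"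

lemma \<kappa>_pos: "0 < \<kappa>"
  using q by (simp add: \<kappa>_def)

lemma quad_pt_q: "quad_pt q u t = qlat \<kappa> u t"
  using q by (simp add: quad_pt_qlat \<kappa>_def)

lemma X_qlat: "1 \<le> N \<Longrightarrow> X N a = qlat (\<kappa>N N) (uN N) (real a / real N)"
  using qN[of N] by (simp add: X_def quad_pt_qlat qlat_def \<kappa>N_def)

lemma X_0: "1 \<le> N \<Longrightarrow> X N 0 = 1 + uN N"
  by (simp add: X_qlat qlat_def)

text \<open>In order of the summands, this threshold ensures \<open>qN N \<ge> q / 2\<close>, then
  \<open>\<kappa>N N \<ge> \<kappa> / 2\<close>, then \<open>1 - uN N \<ge> (1 - u) / 2\<close>, and
  finally \<open>ln (real N) \<ge> 1\<close>, as 3 exceeds Euler's number.\<close>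

definition "N0 = nat \<lceil>2 * A1 / q + 4 * A1 / (q * \<kappa>) + 2 * A1 / (1 - u) + 3\<rceil>"

lemma N0:
  assumes "N0 \<le> N"
  shows "3 \<le> N" "1 \<le> N" "2 * A1 / q \<le> real N" "4 * A1 / (q * \<kappa>) \<le> real N" "2 * A1 / (1 - u) \<le> real N"
proof -
  have nn: "0 \<le> 2 * A1 / q" "0 \<le> 4 * A1 / (q * \<kappa>)" "0 \<le> 2 * A1 / (1 - u)"
    using A1 q u \<kappa>_pos by auto
  have "2 * A1 / q + 4 * A1 / (q * \<kappa>) + 2 * A1 / (1 - u) + 3 \<le> real N"
    using assms unfolding N0_def by linarith
  then show "3 \<le> N" "1 \<le> N" "2 * A1 / q \<le> real N" "4 * A1 / (q * \<kappa>) \<le> real N" "2 * A1 / (1 - u) \<le> real N"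
    using nn by auto
qed

text \<open>Closeness of the bases to order N^(-2) passes to their logarithms, since both bases
  exceed \<open>q / 2\<close>; the factor \<open>N\<close> in the rate then leaves order
  1/N.\<close>

lemma \<kappa>N_close:
  assumes "N0 \<le> N"
  shows "\<bar>\<kappa>N N - \<kappa>\<bar> \<le> 2 * A1 / q / real N" "\<kappa> / 2 \<le> \<kappa>N N" "\<kappa>N N \<le> \<kappa> + 1"
proof -
  note N = N0[OF assms]
  have N1: "1 \<le> real N" using N by auto
  define d where "d = \<bar>qN N - q powr (1 / real N)\<bar>"
  have d: "d \<le> A1 / (real N)\<^sup>2"
    using close[OF N(2)] N1 by (simp add: d_def field_simps)
  have "A1 / (real N)\<^sup>2 \<le> A1 / real N"
    using A1 N1 by (intro divide_left_mono) (auto simp: power2_eq_square)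
  also have "\<dots> \<le> q / 2" using N(3) q N1 by (simp add: field_simps)
  finally have d2: "d \<le> q / 2" using d by (rule order_trans[rotated])
  have qq: "q \<le> q powr (1 / real N)"
  proof -
    have "q powr 1 \<le> q powr (1 / real N)" using q N1 by (intro powr_mono') auto
    then show ?thesis using q by simp
  qed
  have "\<bar>ln (qN N) - ln (q powr (1 / real N))\<bar> \<le> d / (q / 2)"
    unfolding d_def
  proof (rule abs_ln_diff_le)
    show "q / 2 \<le> qN N" using d2 qq q unfolding d_def by linarith
  qed (use qq q in auto)
  also have "\<dots> \<le> A1 / (real N)\<^sup>2 / (q / 2)" using d q by (intro divide_right_mono) auto
  finally have "\<bar>ln (qN N) - ln q / real N\<bar> \<le> A1 / (real N)\<^sup>2 / (q / 2)" using q by (simp add: ln_powr)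
  then have "real N * \<bar>ln (qN N) - ln q / real N\<bar> \<le> real N * (A1 / (real N)\<^sup>2 / (q / 2))"
    using N1 by (intro mult_left_mono) auto
  also have "real N * (A1 / (real N)\<^sup>2 / (q / 2)) = 2 * A1 / q / real N"
    using N1 q by (simp add: power2_eq_square mult.commute)
  also have "real N * \<bar>ln (qN N) - ln q / real N\<bar> = \<bar>real N * (ln (qN N) - ln q / real N)\<bar>"
    by (simp add: abs_mult)
  also have "real N * (ln (qN N) - ln q / real N) = - (\<kappa>N N - \<kappa>)"
    using N1 by (simp add: \<kappa>N_def \<kappa>_def algebra_simps)
  finally show 1: "\<bar>\<kappa>N N - \<kappa>\<bar> \<le> 2 * A1 / q / real N" by simp
  have "2 * A1 / q / real N \<le> 1" using N(3) N1 q by (simp add: field_simps)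
  then show "\<kappa>N N \<le> \<kappa> + 1" using 1 by linarith
  have "2 * A1 / q / real N \<le> \<kappa> / 2" using N(4) N1 q \<kappa>_pos by (simp add: field_simps)
  then show "\<kappa> / 2 \<le> \<kappa>N N" using 1 by linarith
qed

lemma uN_close:
  assumes "N0 \<le> N"
  shows "\<bar>uN N - u\<bar> \<le> A1 / real N" "0 \<le> uN N" "uN N \<le> 1" "(1 - u) / 2 \<le> 1 - uN N"
proof -
  note N = N0[OF assms]
  show 1: "\<bar>uN N - u\<bar> \<le> A1 / real N" using close[OF N(2)] N(2) by (simp add: field_simps)
  show "0 \<le> uN N" "uN N \<le> 1" using uN[OF N(2)] by auto
  have "A1 / real N \<le> (1 - u) / 2" using N(2,5) u by (simp add: field_simps)
  then have "\<bar>uN N - u\<bar> \<le> (1 - u) / 2" using 1 by (rule order_trans[rotated])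
  then have "uN N - u \<le> (1 - u) / 2" by (simp only: abs_le_iff)
  then show "(1 - u) / 2 \<le> 1 - uN N" by (simp add: field_simps)
qed

definition "Tm = M + A1"

lemma Tm: "1 \<le> Tm" "M \<le> Tm" using M A1 by (auto simp: Tm_def)

lemma site_le:
  assumes "1 \<le> N" "a \<le> MN N"
  shows "real a / real N \<le> Tm"
proof -
  have "real a \<le> real N * M + A1" using close[OF assms(1)] assms(2) by linarith
  also have "A1 \<le> real N * A1" using A1 assms(1) by simp
  finally have "real a \<le> real N * Tm" by (simp add: Tm_def algebra_simps)
  then show ?thesis using assms(1) by (simp add: field_simps)
qed

text \<open>The product of \<open>\<kappa> / 2\<close> and \<open>(1 - u) / 2\<close>, the lower
  bounds for the rate and for \<open>1 - uN N\<close> beyond \<open>N0\<close>. The lattice spacing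
  is at least \<open>gap / real N\<close>.\<close>

definition "gap = \<kappa> * (1 - u) / 4"

definition "C2 = 2 * Tm * exp (Tm * (\<kappa> + 1)) * (2 * A1 / q) + A1"

definition "LQ = 2 * \<kappa> * exp (\<kappa> * Tm)"

text \<open>The exponential bounds the growing part of a lattice point. The remaining summands cover
  the decaying part and secure \<open>1 \<le> diam\<close> and
  \<open>2 * gap \<le> diam\<close>.\<close>

definition "diam = exp ((\<kappa> + 1) * Tm) + 2 + 2 * gap"

lemma const_pos: "0 < gap" "0 < C2" "0 < LQ" "1 \<le> diam" "2 * gap \<le> diam"
  using \<kappa>_pos u Tm A1 q by (auto simp: gap_def C2_def LQ_def diam_def intro!: add_pos_pos mult_pos_pos add_nonneg_nonneg)

lemma X_close:
  assumes "N0 \<le> N" "a \<le> MN N"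
  shows "\<bar>X N a - qlat \<kappa> u (real a / real N)\<bar> \<le> C2 / real N"
proof -
  note N = N0[OF assms(1)] and k = \<kappa>N_close[OF assms(1)] and uu = uN_close[OF assms(1)]
  let ?t = "real a / real N"
  have t: "0 \<le> ?t" "?t \<le> Tm" using site_le[OF N(2) assms(2)] by auto
  have "\<bar>qlat (\<kappa>N N) (uN N) ?t - qlat \<kappa> (uN N) ?t\<bar> \<le> 2 * ?t * exp (?t * (\<kappa> + 1)) * \<bar>\<kappa>N N - \<kappa>\<bar>"
    unfolding qlat_commute[of _ _ ?t] using t k uu \<kappa>_pos by (intro qlat_lipschitz) auto
  also have "\<dots> \<le> 2 * Tm * exp (Tm * (\<kappa> + 1)) * (2 * A1 / q / real N)"
  proof (intro mult_mono)
    show "exp (?t * (\<kappa> + 1)) \<le> exp (Tm * (\<kappa> + 1))"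
      unfolding exp_le_cancel_iff using t \<kappa>_pos by (intro mult_right_mono) auto
  qed (use t k Tm in auto)
  finally have 1: "\<bar>qlat (\<kappa>N N) (uN N) ?t - qlat \<kappa> (uN N) ?t\<bar> \<le> 2 * Tm * exp (Tm * (\<kappa> + 1)) * (2 * A1 / q) / real N"
    by simp
  have "\<bar>qlat \<kappa> (uN N) ?t - qlat \<kappa> u ?t\<bar> = \<bar>uN N - u\<bar> * exp (- (\<kappa> * ?t))"
    by (simp add: qlat_def abs_mult flip: left_diff_distrib)
  also have "\<dots> \<le> \<bar>uN N - u\<bar> * 1" using t \<kappa>_pos by (intro mult_left_mono) auto
  finally have 2: "\<bar>qlat \<kappa> (uN N) ?t - qlat \<kappa> u ?t\<bar> \<le> A1 / real N" using uu by simp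
  show ?thesis unfolding X_qlat[OF N(2)] C2_def add_divide_distrib using 1 2 by linarith
qed

lemma X_spaced:
  assumes "N0 \<le> N"
  shows "spaced (MN N) (X N) (gap / real N) diam"
  unfolding spaced_def
proof (intro conjI allI impI)
  note N = N0[OF assms(1)] and k = \<kappa>N_close[OF assms(1)] and uu = uN_close[OF assms(1)]
  show "0 < gap / real N" using const_pos N by auto
  have "gap / real N \<le> gap / 1" using const_pos N by (intro divide_left_mono) auto
  also have "gap \<le> diam" using const_pos by simp
  finally show "gap / real N \<le> diam" by simp
  let ?t = "real (MN N) / real N"
  have "0 \<le> ?t" "?t \<le> Tm" using site_le[OF N(2), of "MN N"] by auto
  then have "\<kappa>N N * ?t \<le> (\<kappa> + 1) * Tm" "0 \<le> \<kappa>N N * ?t"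
    using k(2,3) \<kappa>_pos by (intro mult_mono mult_nonneg_nonneg; linarith)+
  moreover from this have "uN N * exp (- (\<kappa>N N * ?t)) \<le> 1 * 1" using uu by (intro mult_mono) auto
  ultimately have "X N (MN N) \<le> exp ((\<kappa> + 1) * Tm) + 1"
    unfolding X_qlat[OF N(2)] qlat_def by (intro add_mono) auto
  moreover have "0 \<le> X N 0" using uu by (simp add: X_0[OF N(2)])
  ultimately show "X N (MN N) - X N 0 \<le> diam" unfolding diam_def using const_pos by linarith
next
  note N = N0[OF assms(1)] and k = \<kappa>N_close[OF assms(1)] and uu = uN_close[OF assms(1)]
  fix a b assume ab: "a < b \<and> b \<le> MN N"
  have "(\<kappa> / 2) * ((1 - u) / 2) = gap" by (simp add: gap_def)
  then have "gap / real N * (real b - real a) = (\<kappa> / 2) * ((1 - u) / 2) * (real b / real N - real a / real N)"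
    by (simp only: diff_divide_distrib[symmetric]) simp
  also have "\<dots> \<le> \<kappa>N N * (1 - uN N) * (real b / real N - real a / real N)"
  proof (intro mult_right_mono mult_mono)
    show "0 \<le> real b / real N - real a / real N" using ab by (simp add: divide_right_mono)
  qed (use k uu u \<kappa>_pos in auto)
  also have "\<dots> \<le> X N b - X N a"
    unfolding X_qlat[OF N(2)] using ab k uu \<kappa>_pos by (intro qlat_lower) (auto simp: divide_right_mono)
  finally show "gap / real N * (real b - real a) \<le> X N b - X N a" .
qed

lemma X_dom:
  assumes "N0 \<le> N" "a \<le> MN N"
  shows "X N a \<in> {1 + uN N .. quad_pt (qN N) (uN N) (real (MN N))}"
  using spaced_mono[OF X_spaced[OF assms(1)], of 0 a] spaced_mono[OF X_spaced[OF assms(1)], of a "MN N"]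
    assms X_0[of N] N0(2)[OF assms(1)] by (simp add: X_def[of N "MN N"])

text \<open>Both points are compared with the limiting lattice map, whose two arguments differ by at
  most one block length 1/N.\<close>

lemma X_near:
  assumes "N0 \<le> N" "1 \<le> m" "k \<le> MN (N * m)" "k div m \<le> MN N"
  shows "\<bar>X (N * m) k - X N (k div m)\<bar> \<le> (2 * C2 + LQ) / real N"
proof -
  have Nm: "N0 \<le> N * m" using assms(1,2) by (metis le_trans mult_le_mono2 nat_mult_1_right)
  note N = N0[OF assms(1)] and N' = N0[OF Nm]
  let ?s = "real k / real (N * m)" and ?t = "real (k div m) / real N"
  have kk: "real k = real m * real (k div m) + real (k mod m)"
    by (metis mult_div_mod_eq of_nat_add of_nat_mult)
  have st: "?s - ?t = real (k mod m) / real m / real N"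
    using assms(2) N(2) by (simp add: kk field_simps)
  have "real (k mod m) / real m \<le> 1" using assms(2) by (simp add: less_imp_le)
  then have "real (k mod m) / real m / real N \<le> 1 / real N" by (intro divide_right_mono) auto
  then have st': "\<bar>?s - ?t\<bar> \<le> 1 / real N" unfolding st by simp
  have "\<bar>X (N * m) k - qlat \<kappa> u ?s\<bar> \<le> C2 / real (N * m)" by (rule X_close[OF Nm assms(3)])
  also have "\<dots> \<le> C2 / real N" using const_pos N(2) assms(2) by (intro divide_left_mono) auto
  finally have 1: "\<bar>X (N * m) k - qlat \<kappa> u ?s\<bar> \<le> C2 / real N" .
  have 2: "\<bar>X N (k div m) - qlat \<kappa> u ?t\<bar> \<le> C2 / real N" by (rule X_close[OF assms(1,4)])
  have "\<bar>qlat \<kappa> u ?s - qlat \<kappa> u ?t\<bar> \<le> LQ * \<bar>?s - ?t\<bar>"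
    unfolding LQ_def using site_le[OF N'(2) assms(3)] site_le[OF N(2) assms(4)] \<kappa>_pos u
    by (intro qlat_lipschitz) auto
  also have "\<dots> \<le> LQ * (1 / real N)" using st' const_pos by (intro mult_left_mono) auto
  finally have 3: "\<bar>qlat \<kappa> u ?s - qlat \<kappa> u ?t\<bar> \<le> LQ / real N" by simp
  have "(2 * C2 + LQ) / real N = C2 / real N + C2 / real N + LQ / real N" by (simp add: add_divide_distrib)
  then show ?thesis using 1 2 3 by linarith
qed

section \<open>Comparing the potentials on two lattices\<close>

definition "W = A3 + A2"

lemma VN_bound:
  assumes "N0 \<le> N" "a \<le> MN N"
  shows "\<bar>VN N (X N a)\<bar> \<le> W"
proof -
  note N = N0[OF assms(1)]
  have "\<bar>VN N (X N a) - V (X N a)\<bar> \<le> A2 * ln (real N) / real N"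
    by (rule VN_V[OF N(2) X_dom[OF assms]])
  also have "\<dots> \<le> A2 * real N / real N"
    using A2 N(2) ln_bound[of "real N"] by (intro divide_right_mono mult_left_mono) auto
  also have "\<dots> = A2" using N(2) by simp
  finally have "\<bar>VN N (X N a) - V (X N a)\<bar> \<le> A2" .
  moreover have "\<bar>V (X N a)\<bar> \<le> A3" using X_dom[OF assms] I_N[OF N(2)] by (intro V_bound) auto
  ultimately show ?thesis unfolding W_def by linarith
qed

lemma ln_ratio_mono:
  assumes "N0 \<le> N" "1 \<le> m"
  shows "ln (real (N * m)) / real (N * m) \<le> ln (real N) / real N"
proof -
  note N = N0[OF assms(1)]
  have "exp 1 \<le> real N" using exp_le N(1) by (metis le_trans numeral_le_real_of_nat_iff of_nat_le_iff order_trans)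
  then have l1: "1 \<le> ln (real N)" using N by (simp add: ln_ge_iff)
  have "ln (real m) \<le> real m - 1" using assms(2) by (intro ln_le_minus_one) auto
  also have "\<dots> = (real m - 1) * 1" by simp
  also have "\<dots> \<le> (real m - 1) * ln (real N)" using assms(2) l1 by (intro mult_left_mono) auto
  finally have "ln (real (N * m)) \<le> real m * ln (real N)"
    using N(2) assms(2) by (simp add: ln_mult algebra_simps)
  then show ?thesis using N(2) assms(2) by (simp add: field_simps)
qed

lemma ln_N_ge1:
  assumes "N0 \<le> N"
  shows "1 \<le> ln (real N)"
proof -
  have "exp 1 \<le> (3::real)" by (rule exp_le)
  also have "\<dots> \<le> real N" using N0(1)[OF assms] by simp
  finally show ?thesis using N0(2)[OF assms] by (simp add: ln_ge_iff)
qed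

lemma N0_mult:
  assumes "N0 \<le> N" "1 \<le> m"
  shows "N0 \<le> N * m"
  using assms by (metis le_trans mult_le_mono2 nat_mult_1_right)

text \<open>The limiting map has slope at least \<open>4 * gap\<close>, so a scaled distance
  \<open>(b0 - 1) / real N\<close> from the ends means \<open>(C2 + 1) / real N\<close> in space:
  \<open>C2\<close> absorbs the displacement of the lattice and 1 leaves a distance 1/N from the
  singularities. The last \<open>+ 1\<close> allows for the width of a block.\<close>

definition "b0 = (C2 + 1) / (4 * gap) + 1"

abbreviation "core N \<equiv> {1 + u + 1 / real N .. quad_pt q u M - 1 / real N}"

lemma inner_point:
  assumes "N0 \<le> N" "\<bar>y - qlat \<kappa> u t\<bar> \<le> C2 / real N"
    "(b0 - 1) / real N \<le> t" "t \<le> M - (b0 - 1) / real N"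
  shows "y \<in> core N"
proof -
  note N = N0[OF assms(1)]
  have g: "\<kappa> * (1 - u) = 4 * gap" by (simp add: gap_def)
  have b: "0 \<le> (b0 - 1) / real N" using const_pos by (simp add: b0_def)
  have e: "4 * gap * ((b0 - 1) / real N) = C2 / real N + 1 / real N"
    using const_pos by (simp add: b0_def add_divide_distrib[symmetric])
  have "4 * gap * ((b0 - 1) / real N) \<le> 4 * gap * (t - 0)" using assms const_pos by (intro mult_left_mono) auto
  also have "\<dots> \<le> qlat \<kappa> u t - qlat \<kappa> u 0"
    unfolding g[symmetric] using assms b \<kappa>_pos u by (intro qlat_lower) auto
  finally have 1: "1 + u + C2 / real N + 1 / real N \<le> qlat \<kappa> u t" unfolding e by (simp add: qlat_def)
  have "4 * gap * ((b0 - 1) / real N) \<le> 4 * gap * (M - t)" using assms const_pos by (intro mult_left_mono) auto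
  also have "\<dots> \<le> qlat \<kappa> u M - qlat \<kappa> u t"
    unfolding g[symmetric] using assms b \<kappa>_pos u by (intro qlat_lower) auto
  finally have 2: "qlat \<kappa> u t + C2 / real N + 1 / real N \<le> quad_pt q u M" unfolding e quad_pt_q by simp
  show ?thesis using 1 2 assms(2) by auto
qed

text \<open>Mean value theorem: at distance at least 1/N from both endpoints, each logarithm in the
  bound for the derivative is at most \<open>ln (real N) + ln diam\<close>.\<close>

lemma V_modulus:
  assumes N: "N0 \<le> N"
    and s: "s \<in> core N"
    and t: "t \<in> core N"
  shows "\<bar>V s - V t\<bar> \<le> A4 * (1 + 2 * (ln (real N) + ln diam)) * \<bar>s - t\<bar>"
proof -
  have N1: "1 \<le> real N" using N0(2)[OF N] by simp
  have hi: "quad_pt q u M \<le> diam"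
  proof -
    have "quad_pt q u M \<le> exp (\<kappa> * M) + 1 * 1"
      unfolding quad_pt_q qlat_def using u \<kappa>_pos M by (intro add_mono mult_mono) auto
    also have "\<kappa> * M \<le> (\<kappa> + 1) * Tm" using \<kappa>_pos M Tm by (intro mult_mono) auto
    finally show ?thesis using const_pos by (simp add: diam_def)
  qed
  have lnb: "\<bar>ln y\<bar> \<le> ln (real N) + ln diam" if "1 / real N \<le> y" "y \<le> diam" for y
  proof -
    have "0 < 1 / real N" using N1 by simp
    then have y: "0 < y" using that by linarith
    have "ln (1 / real N) \<le> ln y" using that y N1 by simp
    moreover have "ln y \<le> ln diam" using that y by simp
    moreover have "ln (1 / real N) = - ln (real N)" using N1 by (simp add: ln_div)
    moreover have "0 \<le> ln diam" "0 \<le> ln (real N)" using const_pos N1 by auto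
    ultimately show ?thesis by linarith
  qed
  have main: "\<bar>V t - V s\<bar> \<le> A4 * (1 + 2 * (ln (real N) + ln diam)) * (t - s)"
    if st: "s < t" and s: "s \<in> core N"
    and t: "t \<in> core N" for s t
  proof -
    have inside: "y \<in> {1 + u <..< quad_pt q u M}" if "s \<le> y" "y \<le> t" for y
    proof -
      have "0 < 1 / real N" using N1 by simp
      then show ?thesis using that s t unfolding atLeastAtMost_iff greaterThanLessThan_iff by linarith
    qed
    have D: "(V has_real_derivative deriv V y) (at y)" if "s \<le> y" "y \<le> t" for y
      using V_diff[OF inside[OF that]] by (metis DERIV_deriv_iff_real_differentiable)
    then obtain z where z: "s < z" "z < t" "V t - V s = (t - s) * deriv V z"
      using MVT2[OF st, of V "deriv V"] by blast
    have z': "s \<le> z" "z \<le> t" using z by auto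
    have "\<bar>deriv V z\<bar> \<le> A4 * (1 + \<bar>ln \<bar>z - 1 - u\<bar>\<bar> + \<bar>ln \<bar>z - quad_pt q u M\<bar>\<bar>)"
      by (rule V_deriv[OF inside[OF z']])
    also have "\<dots> \<le> A4 * ((1 + (ln (real N) + ln diam)) + (ln (real N) + ln diam))"
    proof (intro mult_left_mono add_mono)
      have N0': "0 < 1 / real N" using N1 by simp
      have z1: "1 + u + 1 / real N \<le> z" "z \<le> quad_pt q u M - 1 / real N" using s t z' by auto
      show "\<bar>ln \<bar>z - 1 - u\<bar>\<bar> \<le> ln (real N) + ln diam"
        using z1 hi u N0' by (intro lnb; linarith)
      show "\<bar>ln \<bar>z - quad_pt q u M\<bar>\<bar> \<le> ln (real N) + ln diam"
        using z1 hi u N0' by (intro lnb; linarith)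
    qed (use A4 in auto)
    also have "\<dots> = A4 * (1 + 2 * (ln (real N) + ln diam))" by simp
    finally have "\<bar>deriv V z\<bar> * (t - s) \<le> A4 * (1 + 2 * (ln (real N) + ln diam)) * (t - s)"
      using st by (intro mult_right_mono) auto
    then show ?thesis using st z(3) by (simp add: abs_mult mult.commute)
  qed
  consider "s < t" | "t < s" | "s = t" by linarith
  then show ?thesis
  proof cases
    case 1 then show ?thesis using main[OF 1 s t] by (simp add: abs_minus_commute)
  next
    case 2 then show ?thesis using main[OF 2 t s] by simp
  qed simp
qed

definition "C3 = A4 * (3 + 2 * ln diam) * (2 * C2 + LQ) + 2 * A2"

lemma C3_pos: "0 < C3"
  using A4 A2 const_pos by (auto simp: C3_def intro!: add_nonneg_pos mult_nonneg_nonneg)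

text \<open>Coarse sites for which the site and its whole block stay in the core, measured against
  the limiting right end \<open>real N * M\<close>.\<close>

definition good :: "nat \<Rightarrow> nat \<Rightarrow> bool" where
  "good N a \<longleftrightarrow> b0 \<le> real a \<and> real a \<le> real N * M - b0"

lemma VN_good:
  assumes "N0 \<le> N" "1 \<le> m" "k \<le> MN (N * m)" "k div m \<le> MN N" "good N (k div m)"
  shows "\<bar>VN (N * m) (X (N * m) k) - VN N (X N (k div m))\<bar> \<le> C3 * ln (real N) / real N"
proof -
  note Nm = N0_mult[OF assms(1,2)]
  note N = N0[OF assms(1)] and N' = N0[OF Nm] and l1 = ln_N_ge1[OF assms(1)]
  have N1: "0 < real N" "0 < real m" using N assms(2) by auto
  let ?a = "k div m"
  have a: "b0 \<le> real ?a" "real ?a \<le> real N * M - b0" using assms(5) by (auto simp: good_def)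
  have xa: "X N ?a \<in> core N"
  proof (rule inner_point[OF assms(1) X_close[OF assms(1,4)]])
    show "(b0 - 1) / real N \<le> real ?a / real N" using a by (intro divide_right_mono) auto
    have "real ?a / real N \<le> (real N * M - (b0 - 1)) / real N" using a by (intro divide_right_mono) auto
    also have "\<dots> = M - (b0 - 1) / real N" using N1 by (simp add: diff_divide_distrib)
    finally show "real ?a / real N \<le> M - (b0 - 1) / real N" .
  qed
  have kk: "real k = real m * real ?a + real (k mod m)"
    by (metis mult_div_mod_eq of_nat_add of_nat_mult)
  have kb: "real m * real ?a \<le> real k" "real k \<le> real m * (real ?a + 1)"
    using kk assms(2) by (auto simp: algebra_simps less_imp_le)
  have xk: "X (N * m) k \<in> core N"
  proof (rule inner_point[OF assms(1)])
    show "\<bar>X (N * m) k - qlat \<kappa> u (real k / real (N * m))\<bar> \<le> C2 / real N"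
    proof (rule order_trans[OF X_close[OF Nm assms(3)]])
      show "C2 / real (N * m) \<le> C2 / real N" using const_pos N1 assms(2) by (intro divide_left_mono) auto
    qed
    have "(b0 - 1) / real N \<le> real ?a / real N" using a by (intro divide_right_mono) auto
    also have "\<dots> = real m * real ?a / real (N * m)" using N1 by simp
    also have "\<dots> \<le> real k / real (N * m)" using kb by (intro divide_right_mono) auto
    finally show "(b0 - 1) / real N \<le> real k / real (N * m)" .
    have "real k / real (N * m) \<le> real m * (real ?a + 1) / real (N * m)" using kb by (intro divide_right_mono) auto
    also have "\<dots> = (real ?a + 1) / real N" using N1 by simp
    also have "\<dots> \<le> (real N * M - (b0 - 1)) / real N" using a by (intro divide_right_mono) auto
    also have "\<dots> = M - (b0 - 1) / real N" using N1 by (simp add: diff_divide_distrib)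
    finally show "real k / real (N * m) \<le> M - (b0 - 1) / real N" .
  qed
  have "\<bar>V (X (N * m) k) - V (X N ?a)\<bar> \<le>
      A4 * (1 + 2 * (ln (real N) + ln diam)) * \<bar>X (N * m) k - X N ?a\<bar>"
    by (rule V_modulus[OF assms(1) xk xa])
  also have "\<dots> \<le> A4 * (ln (real N) * (3 + 2 * ln diam)) * ((2 * C2 + LQ) / real N)"
  proof (intro mult_mono)
    have "1 * (2 * ln diam) \<le> ln (real N) * (2 * ln diam)" using l1 const_pos by (intro mult_right_mono) auto
    then show "1 + 2 * (ln (real N) + ln diam) \<le> ln (real N) * (3 + 2 * ln diam)"
      using l1 by (simp add: algebra_simps)
    show "\<bar>X (N * m) k - X N ?a\<bar> \<le> (2 * C2 + LQ) / real N" by (rule X_near[OF assms(1-4)])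
  qed (use A4 l1 const_pos in auto)
  also have "\<dots> = A4 * (3 + 2 * ln diam) * (2 * C2 + LQ) * (ln (real N) / real N)" by simp
  finally have 1: "\<bar>V (X (N * m) k) - V (X N ?a)\<bar> \<le> A4 * (3 + 2 * ln diam) * (2 * C2 + LQ) * (ln (real N) / real N)" .
  have 2: "\<bar>VN N (X N ?a) - V (X N ?a)\<bar> \<le> A2 * (ln (real N) / real N)"
    using VN_V[OF N(2) X_dom[OF assms(1,4)]] by simp
  have "\<bar>VN (N * m) (X (N * m) k) - V (X (N * m) k)\<bar> \<le> A2 * (ln (real (N * m)) / real (N * m))"
    using VN_V[OF N'(2) X_dom[OF Nm assms(3)]] by simp
  also have "\<dots> \<le> A2 * (ln (real N) / real N)"
    using ln_ratio_mono[OF assms(1,2)] A2 by (intro mult_left_mono) auto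
  finally have 3: "\<bar>VN (N * m) (X (N * m) k) - V (X (N * m) k)\<bar> \<le> A2 * (ln (real N) / real N)" .
  have "C3 * ln (real N) / real N =
     A4 * (3 + 2 * ln diam) * (2 * C2 + LQ) * (ln (real N) / real N) + A2 * (ln (real N) / real N) + A2 * (ln (real N) / real N)"
    by (simp add: C3_def algebra_simps add_divide_distrib)
  then show ?thesis using 1 2 3 by linarith
qed

text \<open>Excluded sites lie within \<open>b0\<close> indices of the left end or within
  \<open>A1 + b0\<close> of the right end, so their number is bounded uniformly in
  \<open>N\<close>.\<close>

lemma card_bad:
  assumes "N0 \<le> N"
  shows "real (card {a. a \<le> MN N \<and> \<not> good N a}) \<le> 2 * b0 + A1 + 2"
proof -
  note N = N0[OF assms]
  have b: "0 \<le> b0" using const_pos by (simp add: b0_def)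
  let ?L = "{..nat \<lfloor>b0\<rfloor>}" and ?U = "(\<lambda>j. MN N - j) ` {..nat \<lfloor>A1 + b0\<rfloor>}"
  have "{a. a \<le> MN N \<and> \<not> good N a} \<subseteq> ?L \<union> ?U"
  proof
    fix a assume "a \<in> {a. a \<le> MN N \<and> \<not> good N a}"
    then have a: "a \<le> MN N" "real a < b0 \<or> real N * M - b0 < real a" by (auto simp: good_def)
    from a(2) show "a \<in> ?L \<union> ?U"
    proof
      assume "real a < b0" then show ?thesis by (simp add: le_nat_floor)
    next
      assume "real N * M - b0 < real a"
      moreover have "\<bar>real (MN N) - real N * M\<bar> \<le> A1" using close[OF N(2)] by blast
      ultimately have "real (MN N) - real a \<le> A1 + b0" by linarith
      then have "real (MN N - a) \<le> A1 + b0" using a(1) by (simp add: of_nat_diff)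
      then have "MN N - a \<in> {..nat \<lfloor>A1 + b0\<rfloor>}" by (simp add: le_nat_floor)
      moreover have "a = MN N - (MN N - a)" using a(1) by simp
      ultimately show ?thesis by blast
    qed
  qed
  then have "card {a. a \<le> MN N \<and> \<not> good N a} \<le> card (?L \<union> ?U)" by (intro card_mono) auto
  also have "\<dots> \<le> card ?L + card ?U" by (rule card_Un_le)
  also have "\<dots> \<le> (nat \<lfloor>b0\<rfloor> + 1) + (nat \<lfloor>A1 + b0\<rfloor> + 1)"
    using card_image_le[of "{..nat \<lfloor>A1 + b0\<rfloor>}" "\<lambda>j. MN N - j"] by simp
  finally have "real (card {a. a \<le> MN N \<and> \<not> good N a}) \<le> real (nat \<lfloor>b0\<rfloor>) + real (nat \<lfloor>A1 + b0\<rfloor>) + 2" by linarith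
  moreover have "real (nat \<lfloor>b0\<rfloor>) \<le> b0" "real (nat \<lfloor>A1 + b0\<rfloor>) \<le> A1 + b0"
    using b A1 of_nat_floor by auto
  ultimately show ?thesis by linarith
qed

lemma sites_le:
  assumes "N0 \<le> N"
  shows "real (Suc (MN N)) \<le> (Tm + 1) * real N"
proof -
  note N = N0[OF assms]
  have "real (MN N) \<le> Tm * real N" using site_le[OF N(2), of "MN N"] N(2) by (simp add: field_simps)
  then show ?thesis using N(2) by (simp add: algebra_simps)
qed

definition "C4 = (Tm + 1) * C3 + 2 * W * (2 * b0 + A1 + 2)"

lemma W_pos: "0 < W" using A2 A3 by (simp add: W_def)

text \<open>Order \<open>N\<close> interior blocks change by \<open>ln N / N\<close> per site; the
  boundedly many others are charged the trivial bound \<open>2 * W\<close>. Near the singular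
  endpoints nothing better than boundedness is used.\<close>

lemma potential_sum:
  assumes "N0 \<le> N" "1 \<le> m"
  shows "(\<Sum>k | k \<le> MN (N * m) \<and> k div m \<le> MN N. \<bar>VN (N * m) (X (N * m) k) - VN N (X N (k div m))\<bar>)
     \<le> C4 * ln (real N) * real m"
proof -
  note Nm = N0_mult[OF assms] and l1 = ln_N_ge1[OF assms(1)] and N = N0[OF assms(1)]
  define g where "g a = C3 * ln (real N) / real N + (if good N a then 0 else 2 * W)" for a
  have g0: "0 \<le> g a" for a using C3_pos l1 W_pos by (auto simp: g_def)
  have "(\<Sum>k | k \<le> MN (N * m) \<and> k div m \<le> MN N. \<bar>VN (N * m) (X (N * m) k) - VN N (X N (k div m))\<bar>)
     \<le> (\<Sum>k | k \<le> MN (N * m) \<and> k div m \<le> MN N. g (k div m))"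
  proof (rule sum_mono)
    fix k assume "k \<in> {k. k \<le> MN (N * m) \<and> k div m \<le> MN N}"
    then have k: "k \<le> MN (N * m)" "k div m \<le> MN N" by auto
    show "\<bar>VN (N * m) (X (N * m) k) - VN N (X N (k div m))\<bar> \<le> g (k div m)"
    proof (cases "good N (k div m)")
      case True then show ?thesis using VN_good[OF assms k True] by (simp add: g_def)
    next
      case False
      have "0 \<le> C3 * ln (real N) / real N" using C3_pos l1 by simp
      then show ?thesis using VN_bound[OF Nm k(1)] VN_bound[OF assms(1) k(2)] False by (simp add: g_def)
    qed
  qed
  also have "\<dots> \<le> real m * (\<Sum>a\<le>MN N. g a)" using g0 assms(2) by (intro sum_blocks_le) auto
  also have "(\<Sum>a\<le>MN N. g a) = real (Suc (MN N)) * (C3 * ln (real N) / real N)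
      + 2 * W * real (card {a. a \<le> MN N \<and> \<not> good N a})"
  proof -
    have "(\<Sum>a\<le>MN N. if good N a then 0 else 2 * W) = (\<Sum>a | a \<le> MN N \<and> \<not> good N a. 2 * W)"
      by (rule sum.mono_neutral_cong_right) auto
    then show ?thesis by (simp add: g_def sum.distrib)
  qed
  also have "real (Suc (MN N)) * (C3 * ln (real N) / real N) \<le> (Tm + 1) * real N * (C3 * ln (real N) / real N)"
    using sites_le[OF assms(1)] C3_pos l1 by (intro mult_right_mono) auto
  also have "(Tm + 1) * real N * (C3 * ln (real N) / real N) = (Tm + 1) * C3 * ln (real N)"
    using N(2) by simp
  also have "2 * W * real (card {a. a \<le> MN N \<and> \<not> good N a}) \<le> 2 * W * (2 * b0 + A1 + 2) * 1"
    using card_bad[OF assms(1)] W_pos by simp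
  also have "\<dots> \<le> 2 * W * (2 * b0 + A1 + 2) * ln (real N)"
    using l1 W_pos A1 const_pos by (intro mult_left_mono) (auto simp: b0_def)
  finally show ?thesis using assms(2) by (simp add: C4_def algebra_simps)
qed

lemma refinement_N:
  assumes "N0 \<le> N" "1 \<le> m"
  shows "refinement (MN N) (MN (N * m)) m N (X N) (X (N * m)) (\<lambda>a. VN N (X N a))
    (\<lambda>k. VN (N * m) (X (N * m) k)) gap diam (2 * C2 + LQ) W (C4 * ln (real N)) (2 * A1 + 2)"
proof
  note Nm = N0_mult[OF assms] and N = N0[OF assms(1)]
  show "spaced (MN N) (X N) (gap / real N) diam" by (rule X_spaced[OF assms(1)])
  show "spaced (MN (N * m)) (X (N * m)) (gap / (real N * real m)) diam" using X_spaced[OF Nm] by simp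
  show "0 \<le> 2 * C2 + LQ" using const_pos by simp
  \<comment> \<open>The mismatch of the right ends: \<open>m * A1\<close> from the coarse lattice,
    \<open>A1\<close> from the fine one, and the rest from the two successors.\<close>
  have "real m * \<bar>real (MN N) - real N * M\<bar> \<le> real m * A1" using close[OF N(2)] by (intro mult_left_mono) auto
  then have "\<bar>real m * real (MN N) - real m * (real N * M)\<bar> \<le> real m * A1"
    by (simp add: abs_mult flip: right_diff_distrib)
  moreover have "\<bar>real (MN (N * m)) - real m * (real N * M)\<bar> \<le> A1"
    using close[of "N * m"] N0(2)[OF Nm] by (simp add: mult_ac)
  moreover have "A1 \<le> real m * A1" "1 \<le> real m" using assms(2) A1 by auto
  moreover have "(2 * A1 + 2) * real m = real m * A1 + real m * A1 + 2 * real m" "real m * real (Suc (MN N)) = real m * real (MN N) + real m"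
    by (simp_all add: algebra_simps)
  ultimately show "\<bar>real (Suc (MN (N * m))) - real m * real (Suc (MN N))\<bar> \<le> (2 * A1 + 2) * real m" by linarith
  show "N \<le> Suc (MN N)" "N * m \<le> Suc (MN (N * m))" using MN[OF N(2)] MN[OF N0(2)[OF Nm]] by auto
qed (use assms N0(2)[OF assms(1)] N0_mult[OF assms] const_pos X_near VN_bound potential_sum in auto)

end

section \<open>Convergence of the ground states\<close>

context log_gas begin

definition "En N p = energy (logK diam (X N)) (\<lambda>a. real N * VN N (X N a)) (MN N) p"

definition "gs N = (SOME S. ground_state diam (X N) (\<lambda>a. real N * VN N (X N a)) (MN N) N S)"

lemma gs:
  assumes "1 \<le> N"
  shows "ground_state diam (X N) (\<lambda>a. real N * VN N (X N a)) (MN N) N (gs N)"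
  unfolding gs_def by (rule someI_ex, rule ground_state_exists) (use MN[OF assms] in simp)

lemma gs_subset: "1 \<le> N \<Longrightarrow> gs N \<subseteq> {..MN N}" and card_gs: "1 \<le> N \<Longrightarrow> card (gs N) = N"
  using gs by (auto simp: ground_state_def)

definition "mean N f = (\<Sum>a\<in>gs N. f (X N a)) / real N"

definition "rate N = sqrt (ln (real N) / real N)"

lemma rate_nonneg: "0 \<le> rate N"
  by (cases "N = 0") (auto simp: rate_def)

lemma inverse_le_rate:
  assumes "N0 \<le> N"
  shows "1 / real N \<le> rate N"
proof -
  note N = N0[OF assms] and l = ln_N_ge1[OF assms]
  have "(1 / real N)\<^sup>2 \<le> 1 / real N" using N by (simp add: power2_eq_square field_simps)
  also have "\<dots> \<le> ln (real N) / real N" using l by (intro divide_right_mono) auto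
  finally show ?thesis unfolding rate_def by (intro real_le_rsqrt)
qed

definition "C5 = 8 * (2 * C2 + LQ) / gap * (2 + ln (Tm + 1)) + 4 * (2 + ln (diam / (2 * gap)))
  + 2 * (1 + ln (diam / gap)) + C4 + (2 * A1 + 2) * (4 * diam / gap + 2 * W)"

lemma diam_gap: "0 \<le> ln (diam / gap)" "0 \<le> ln (diam / (2 * gap))"
  using const_pos by auto

lemma err_le:
  assumes "N0 \<le> N"
  shows "refinement.err (MN N) N gap diam (2 * C2 + LQ) W (C4 * ln (real N)) (2 * A1 + 2) \<le> C5 * ln (real N)"
proof -
  note NN = N0[OF assms] and l = ln_N_ge1[OF assms]
  \<comment> \<open>The quantity \<open>err\<close> does not involve \<open>m\<close>, so the
    instance with \<open>m = 1\<close> serves to unfold it.\<close>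
  interpret refinement "MN N" "MN (N * 1)" 1 N "X N" "X (N * 1)" "\<lambda>a. VN N (X N a)" "\<lambda>k. VN (N * 1) (X (N * 1) k)"
    gap diam "2 * C2 + LQ" W "C4 * ln (real N)" "2 * A1 + 2"
    by (rule refinement_N[OF assms order_refl])
  let ?l = "ln (real N)"
  have up: "s + t * ?l \<le> (s + t) * ?l" if "0 \<le> s" for s t
    using that l mult_left_mono[of 1 ?l s] by (simp add: algebra_simps)
  have "ln (real (Suc (MN N))) \<le> ln ((Tm + 1) * real N)" using sites_le[OF assms] by (intro ln_mono) auto
  also have "\<dots> = ln (Tm + 1) + ?l" using Tm NN by (simp add: ln_mult)
  finally have "1 + ln (real (Suc (MN N))) \<le> (1 + ln (Tm + 1)) + 1 * ?l" by simp
  also have "\<dots> \<le> (2 + ln (Tm + 1)) * ?l" using up[of "1 + ln (Tm + 1)" 1] Tm by (simp add: algebra_simps)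
  finally have "8 * (2 * C2 + LQ) / gap * (1 + ln (real (Suc (MN N)))) \<le> 8 * (2 * C2 + LQ) / gap * (2 + ln (Tm + 1)) * ?l"
    unfolding mult.assoc[of _ _ ?l] using const_pos by (intro mult_left_mono) auto
  moreover have "4 * (1 + ln (diam * real N / (2 * gap))) \<le> 4 * (2 + ln (diam / (2 * gap))) * ?l"
  proof -
    have "ln (diam * real N / (2 * gap)) = ln (diam / (2 * gap)) + ?l"
      using const_pos NN by (simp add: ln_mult ln_div)
    then show ?thesis using up[of "1 + ln (diam / (2 * gap))" 1] diam_gap by (simp add: algebra_simps)
  qed
  moreover have "2 * ln (diam * real N / gap) \<le> 2 * (1 + ln (diam / gap)) * ?l"
  proof -
    have "ln (diam * real N / gap) = ln (diam / gap) + ?l"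
      using const_pos NN by (simp add: ln_mult ln_div)
    then show ?thesis using up[of "ln (diam / gap)" 1] diam_gap by (simp add: algebra_simps)
  qed
  moreover have "(2 * A1 + 2) * (4 * diam / gap + 2 * W) \<le> (2 * A1 + 2) * (4 * diam / gap + 2 * W) * ?l"
    using up[of "(2 * A1 + 2) * (4 * diam / gap + 2 * W)" 0] A1 const_pos W_pos by simp
  moreover have dist: "(a + b + c + d + e) * ?l = a * ?l + b * ?l + c * ?l + d * ?l + e * ?l" for a b c d e
    by (simp add: algebra_simps)
  ultimately show ?thesis unfolding err_def C5_def dist by linarith
qed

definition "C6 = 2 * C5 + ln (diam / gap) + 2"

definition "Ctest F L = 2 * (2 * A1 + 2) * F + L * (2 * C2 + LQ) + L * diam * sqrt C6"

text \<open>The rate \<open>r\<close> is left free because on the lattice with \<open>N * m\<close>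
  particles the excess is measured by the coarse \<open>rate N\<close>. The diagonal term of order N
  ln N is absorbed into the same scale.\<close>

lemma occupation_deviation:
  assumes N: "N0 \<le> N" and p: "frac_occ (MN N) N p"
    and ex: "En N p - En N (ind (gs N)) \<le> B * (r\<^sup>2 * (real N)\<^sup>2)"
    and r: "0 \<le> r" "ln (real N) / real N \<le> r\<^sup>2"
    and lip: "\<And>s t. \<bar>f s - f t\<bar> \<le> L * \<bar>s - t\<bar>" and L: "0 \<le> L"
  shows "\<bar>\<Sum>a\<le>MN N. (p a - ind (gs N) a) * f (X N a)\<bar> \<le>
    real N * (L * diam * sqrt (B + ln (diam / gap) + 2) * r)"
proof -
  note l1 = ln_N_ge1[OF N]
  have N1: "1 \<le> N" "0 < real N" using N0(2)[OF N] by auto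
  have "ln (diam / (gap / real N)) + 1 = (ln (diam / gap) + 1) + ln (real N)"
    using const_pos N1 by (simp add: ln_mult ln_div)
  also have "\<dots> \<le> (ln (diam / gap) + 2) * ln (real N)"
    using mult_left_mono[OF l1, of "ln (diam / gap) + 1"] diam_gap by (simp add: algebra_simps)
  finally have "(ln (diam / (gap / real N)) + 1) * real N \<le> (ln (diam / gap) + 2) * ln (real N) * real N"
    using N1 by (intro mult_right_mono) auto
  also have "\<dots> = (ln (diam / gap) + 2) * (ln (real N) / real N * (real N)\<^sup>2)"
    using N1(2) by (simp add: power2_eq_square)
  also have "\<dots> \<le> (ln (diam / gap) + 2) * (r\<^sup>2 * (real N)\<^sup>2)"
    using r diam_gap by (intro mult_left_mono mult_right_mono) auto
  finally have ent: "(ln (diam / (gap / real N)) + 1) * real N \<le> (ln (diam / gap) + 2) * (r\<^sup>2 * (real N)\<^sup>2)" .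
  have "(\<Sum>a\<le>MN N. (p a - ind (gs N) a) * f (X N a))\<^sup>2 \<le>
    L\<^sup>2 * diam\<^sup>2 * (En N p - En N (ind (gs N)) + (ln (diam / (gap / real N)) + 1) * real N)"
    unfolding En_def by (rule ground_state_coercive[OF X_spaced[OF N] gs[OF N1(1)] p]) (rule lip)
  also have "\<dots> \<le> L\<^sup>2 * diam\<^sup>2 * (B * (r\<^sup>2 * (real N)\<^sup>2) + (ln (diam / gap) + 2) * (r\<^sup>2 * (real N)\<^sup>2))"
    using ex ent by (intro mult_left_mono add_mono) auto
  also have "\<dots> = (L * diam * real N * r)\<^sup>2 * (B + ln (diam / gap) + 2)"
    by (simp add: power_mult_distrib algebra_simps)
  finally have "\<bar>\<Sum>a\<le>MN N. (p a - ind (gs N) a) * f (X N a)\<bar> \<le> \<bar>L * diam * real N * r\<bar> * sqrt (B + ln (diam / gap) + 2)"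
    unfolding real_sqrt_abs[symmetric] real_sqrt_mult[symmetric] by (rule real_sqrt_le_mono)
  also have "\<bar>L * diam * real N * r\<bar> = L * diam * real N * r"
    using L const_pos r by (intro abs_of_nonneg mult_nonneg_nonneg) auto
  finally show ?thesis by (simp add: mult_ac)
qed

text \<open>Averaging the fine ground state bounds its energy below by
  \<open>m\<^sup>2 * (En - N * err)\<close>, where \<open>En\<close> is the coarse ground energy;
  spreading the coarse one gives \<open>p'\<close> with energy at most
  \<open>m\<^sup>2 * (En + N * err)\<close>. So \<open>p'\<close> has excess of order m^2 N ln N,
  that is \<open>(rate N)\<^sup>2\<close> times the square of the number \<open>N * m\<close> of
  fine particles, and coercivity on the fine lattice gives a bound uniform in
  \<open>m\<close>.\<close>

lemma mean_refine:
  assumes f: "\<And>s. \<bar>f s\<bar> \<le> F" and lip: "\<And>s t. \<bar>f s - f t\<bar> \<le> L * \<bar>s - t\<bar>" and L: "0 \<le> L"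
    and "N0 \<le> N" "1 \<le> m"
  shows "\<bar>mean N f - mean (N * m) f\<bar> \<le> Ctest F L * rate N"
proof -
  note Nm = N0_mult[OF assms(4,5)]
  note NN = N0[OF assms(4)] and l = ln_N_ge1[OF assms(4)] and N' = N0[OF Nm]
  interpret refinement "MN N" "MN (N * m)" m N "X N" "X (N * m)" "\<lambda>a. VN N (X N a)" "\<lambda>k. VN (N * m) (X (N * m) k)"
    gap diam "2 * C2 + LQ" W "C4 * ln (real N)" "2 * A1 + 2"
    by (rule refinement_N[OF assms(4,5)])
  let ?s = "ind (gs N)" and ?s' = "ind (gs (N * m))"
  have fs: "frac_occ (MN N) N ?s" and fs': "frac_occ (MN (N * m)) (N * m) ?s'"
    using frac_occ_of_bool[OF gs_subset[OF NN(2)] card_gs[OF NN(2)]]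
      frac_occ_of_bool[OF gs_subset[OF N'(2)] card_gs[OF N'(2)]] by auto
  have F: "0 \<le> F" using f[of 0] by linarith
  have m0: "0 < real m" "0 < real N" using assms(5) NN by auto
  have E': "E' = En (N * m)" "E = En N" by (auto simp: En_def fun_eq_iff)
  obtain p where p: "frac_occ (MN N) N p" "En N p \<le> En (N * m) ?s' / (real m)\<^sup>2 + real N * err"
    using refine_lower[OF fs'] unfolding E' by blast
  have "En N ?s \<le> En N p" unfolding En_def by (rule ground_state_min[OF X_spaced[OF assms(4)] gs[OF NN(2)] p(1)])
  then have "En N ?s \<le> En (N * m) ?s' / (real m)\<^sup>2 + real N * err" using p(2) by linarith
  then have "(real m)\<^sup>2 * En N ?s \<le> (real m)\<^sup>2 * (En (N * m) ?s' / (real m)\<^sup>2 + real N * err)"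
    by (intro mult_left_mono) auto
  then have low: "(real m)\<^sup>2 * En N ?s \<le> En (N * m) ?s' + (real m)\<^sup>2 * (real N * err)"
    using m0 by (simp add: distrib_left)
  obtain p' where p': "frac_occ (MN (N * m)) (N * m) p'" "En (N * m) p' \<le> (real m)\<^sup>2 * (En N ?s + real N * err)"
    and test: "\<bar>(\<Sum>k\<le>MN (N * m). p' k * f (X (N * m) k)) - real m * (\<Sum>a\<le>MN N. ?s a * f (X N a))\<bar>
      \<le> real m * (2 * (2 * A1 + 2) * F + L * (2 * C2 + LQ))"
    using refine_upper[OF fs f f lip L] unfolding E' by blast
  have "err \<le> C5 * ln (real N)" by (rule err_le[OF assms(4)])
  then have e: "2 * ((real m)\<^sup>2 * (real N * err)) \<le> 2 * ((real m)\<^sup>2 * (real N * (C5 * ln (real N))))"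
    by (intro mult_left_mono) auto
  have ex: "En (N * m) p' - En (N * m) ?s' \<le> 2 * ((real m)\<^sup>2 * (real N * (C5 * ln (real N))))"
    using p'(2) low e unfolding distrib_left by linarith
  define N2 where "N2 = real (N * m)"
  have N2: "0 < N2" "N2 = real N * real m" using m0 by (auto simp: N2_def)
  have lr: "ln N2 / N2 \<le> (rate N)\<^sup>2"
    using ln_ratio_mono[OF assms(4,5)] l NN by (simp add: N2_def rate_def)
  have "2 * ((real m)\<^sup>2 * (real N * (C5 * ln (real N)))) = 2 * C5 * ((rate N)\<^sup>2 * N2\<^sup>2)"
    using m0 l by (simp add: N2(2) power2_eq_square rate_def)
  with ex have dev: "\<bar>\<Sum>a\<le>MN (N * m). (p' a - ?s' a) * f (X (N * m) a)\<bar> \<le>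
      N2 * (L * diam * sqrt C6 * rate N)"
    unfolding C6_def N2_def
    by (intro occupation_deviation[OF Nm p'(1) _ rate_nonneg _ lip L]) (use lr in \<open>simp_all add: N2_def\<close>)
  have sumS: "(\<Sum>a\<le>n. of_bool (a \<in> S) * g a) = (\<Sum>a\<in>S. g a)" if "S \<subseteq> {..n}" for S n and g :: "nat \<Rightarrow> real"
    using that by (intro sum.mono_neutral_cong_right) auto
  have 1: "(\<Sum>a\<le>MN N. ?s a * f (X N a)) = real N * mean N f"
    using m0 sumS[OF gs_subset[OF NN(2)]] by (simp add: mean_def)
  have 2: "(\<Sum>a\<le>MN (N * m). ?s' a * f (X (N * m) a)) = N2 * mean (N * m) f"
    unfolding sumS[OF gs_subset[OF N'(2)]] mean_def N2_def using m0 by simp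
  have "(\<Sum>a\<le>MN (N * m). (p' a - ?s' a) * f (X (N * m) a)) = (\<Sum>k\<le>MN (N * m). p' k * f (X (N * m) k)) - N2 * mean (N * m) f"
    unfolding 2[symmetric] by (simp add: sum_subtractf left_diff_distrib)
  moreover have "real m * (real N * mean N f) = N2 * mean N f" by (simp add: N2(2))
  ultimately have "\<bar>N2 * mean N f - N2 * mean (N * m) f\<bar> \<le>
     real m * (2 * (2 * A1 + 2) * F + L * (2 * C2 + LQ)) + N2 * (L * diam * sqrt C6 * rate N)"
    using dev test unfolding 1 by linarith
  also have "real m * (2 * (2 * A1 + 2) * F + L * (2 * C2 + LQ)) = N2 * ((2 * (2 * A1 + 2) * F + L * (2 * C2 + LQ)) * (1 / real N))"
    using m0 by (simp add: N2(2))
  also have "\<dots> \<le> N2 * ((2 * (2 * A1 + 2) * F + L * (2 * C2 + LQ)) * rate N)"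
    using N2 F L A1 const_pos inverse_le_rate[OF assms(4)] by (intro mult_left_mono) auto
  finally have fin: "\<bar>N2 * mean N f - N2 * mean (N * m) f\<bar> \<le>
     N2 * ((2 * (2 * A1 + 2) * F + L * (2 * C2 + LQ)) * rate N) + N2 * (L * diam * sqrt C6 * rate N)"
    by simp
  have "\<bar>N2 * mean N f - N2 * mean (N * m) f\<bar> = N2 * \<bar>mean N f - mean (N * m) f\<bar>"
    using N2(1) by (simp add: abs_mult flip: right_diff_distrib)
  moreover have "N2 * ((2 * (2 * A1 + 2) * F + L * (2 * C2 + LQ)) * rate N) + N2 * (L * diam * sqrt C6 * rate N) =
     N2 * (Ctest F L * rate N)"
    by (simp add: Ctest_def algebra_simps)
  ultimately have "N2 * \<bar>mean N f - mean (N * m) f\<bar> \<le>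
     N2 * (Ctest F L * rate N)"
    using fin by simp
  then show ?thesis using N2 by (simp only: mult_le_cancel_left_pos)
qed

text \<open>Arbitrary \<open>N\<close> and \<open>N'\<close> are both compared with their product,
  which refines either of them.\<close>

lemma mean_cauchy:
  assumes f: "\<And>s. \<bar>f s\<bar> \<le> F" and lip: "\<And>s t. \<bar>f s - f t\<bar> \<le> L * \<bar>s - t\<bar>" and L: "0 \<le> L"
    and "N0 \<le> N" "N0 \<le> N'"
  shows "\<bar>mean N f - mean N' f\<bar> \<le>
    Ctest F L * (rate N + rate N')"
  using mean_refine[OF f lip L assms(4) N0(2)[OF assms(5)]] mean_refine[OF f lip L assms(5) N0(2)[OF assms(4)]]
  unfolding mult.commute[of N' N] distrib_left by linarith

end

section \<open>The limiting measure\<close>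

text \<open>A bounded piece of a Lebesgue null set is covered by an open set of small measure, and
  this set is filled by intervals with disjoint interiors. The intervals are closed and may share
  endpoints, so their lengths are added through the interiors.\<close>

lemma absolutely_continuous_if_interval_bound:
  fixes \<mu> :: "real measure"
  assumes "finite_measure \<mu>" and sets: "sets \<mu> = sets borel" and C: "0 \<le> C"
    and bound: "\<And>x y. x \<le> y \<Longrightarrow> measure \<mu> {x..y} \<le> C * (y - x)"
  shows "absolutely_continuous lborel \<mu>"
  unfolding absolutely_continuous_def
proof
  interpret finite_measure \<mu> by fact
  fix A :: "real set" assume A: "A \<in> null_sets lborel"
  have AS: "A \<in> sets borel" using A by auto
  have "A \<inter> cbox (- real (Suc n)) (real (Suc n)) \<in> null_sets \<mu>" for n
  proof -
    let ?S = "A \<inter> cbox (- real (Suc n)) (real (Suc n))"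
    have SS: "?S \<in> sets borel" using AS by auto
    have S0: "emeasure lborel ?S = 0"
      by (rule emeasure_eq_0[of A lborel]) (use A in \<open>simp_all add: null_sets_def\<close>)
    have small: "emeasure \<mu> ?S \<le> ennreal C * ennreal e" if e: "0 < e" for e
    proof -
      obtain U where U: "open U" "?S \<subseteq> U" "emeasure lborel (U - ?S) < e"
        by (rule outer_regular_lborel[OF SS e])
      have "emeasure lborel U = emeasure lborel (U - ?S) + emeasure lborel ?S"
      proof -
        have eq: "(U - ?S) \<inter> ?S = {}" "U - ?S \<union> ?S = U" using U(2) by blast+
        have "U - ?S \<in> sets lborel" "?S \<in> sets lborel" using U(1) SS by auto
        from plus_emeasure[OF this eq(1)] show ?thesis unfolding eq(2) by (rule sym)
      qed
      then have Ue: "emeasure lborel U \<le> e" using U S0 by simp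
      \<comment> \<open>Assigning \<open>U\<close> to each of its points makes the covering lemma
        return intervals contained in \<open>U\<close>; that lemma works in a bounded box, hence the
        truncation of \<open>A\<close>.\<close>
      have g: "gauge (\<lambda>x. if x \<in> U then U else UNIV)" using U(1) by (simp add: gauge_def)
      have bne: "box (- real (Suc n)) (real (Suc n)) \<noteq> {}" by (simp add: box_ne_empty)
      obtain \<D> where D: "countable \<D>" "\<And>K. K \<in> \<D> \<Longrightarrow> interior K \<noteq> {} \<and> (\<exists>c d. K = cbox c d)"
        "pairwise (\<lambda>A B. interior A \<inter> interior B = {}) \<D>"
        "\<And>K. K \<in> \<D> \<Longrightarrow> \<exists>x\<in>?S \<inter> K. K \<subseteq> (if x \<in> U then U else UNIV)" "?S \<subseteq> \<Union>\<D>"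
        by (rule covering_lemma[OF Int_lower2[of A] bne g]) (rule that; assumption)
      have DU: "K \<subseteq> U" if "K \<in> \<D>" for K
      proof -
        obtain z where z: "z \<in> ?S" "K \<subseteq> (if z \<in> U then U else UNIV)" using D(4)[OF \<open>K \<in> \<D>\<close>] by blast
        have "z \<in> U" using z(1) U(2) by blast
        then show ?thesis using z(2) by simp
      qed
      \<comment> \<open>At indices that enumerate nothing \<open>from_nat_into\<close> would repeat
        an interval; the empty set there keeps the family disjoint when the cover is finite.\<close>
      define f where "f i = (if i \<in> to_nat_on \<D> ` \<D> then from_nat_into \<D> i else {})" for i
      have fD: "f i \<in> \<D> \<or> f i = {}" for i
        using D(1) by (auto simp: f_def)
      have Uf: "\<Union>\<D> \<subseteq> (\<Union>i. f i)"
      proof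
        fix z assume "z \<in> \<Union>\<D>"
        then obtain K where K: "z \<in> K" "K \<in> \<D>" by auto
        then have "f (to_nat_on \<D> K) = K" using D(1) by (simp add: f_def)
        then show "z \<in> (\<Union>i. f i)" using K by blast
      qed
      have disj: "disjoint_family (\<lambda>i. interior (f i))"
        unfolding disjoint_family_on_def
      proof (intro ballI impI)
        fix i j :: nat assume ij: "i \<noteq> j"
        show "interior (f i) \<inter> interior (f j) = {}"
        proof (cases "i \<in> to_nat_on \<D> ` \<D> \<and> j \<in> to_nat_on \<D> ` \<D>")
          case True
          then obtain K L where KL: "K \<in> \<D>" "L \<in> \<D>" "i = to_nat_on \<D> K" "j = to_nat_on \<D> L" by auto
          then have "f i = K" "f j = L" "K \<noteq> L" using D(1) ij by (auto simp: f_def)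
          then show ?thesis using D(3) KL by (auto simp: pairwise_def)
        qed (auto simp: f_def)
      qed
      have fm: "f i \<in> sets \<mu>" "emeasure \<mu> (f i) \<le> ennreal C * emeasure lborel (interior (f i))" for i
      proof -
        have "f i \<in> sets \<mu> \<and> emeasure \<mu> (f i) \<le> ennreal C * emeasure lborel (interior (f i))"
        proof (cases "f i = {}")
          case False
          then have "f i \<in> \<D>" using fD by auto
          then obtain c d where cd: "f i = cbox c d" "interior (f i) \<noteq> {}" using D(2) by blast
          then have "c < d" by (auto simp: interior_cbox box_real)
          have "emeasure \<mu> (f i) = ennreal (measure \<mu> {c..d})"
            using cd by (simp add: emeasure_eq_measure)
          also have "\<dots> \<le> ennreal (C * (d - c))" using bound \<open>c < d\<close> by (intro ennreal_leI) auto
          also have "\<dots> = ennreal C * emeasure lborel (interior (f i))"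
            using cd \<open>c < d\<close> C by (simp add: interior_cbox box_real ennreal_mult)
          finally show ?thesis using cd sets by simp
        qed simp
        then show "f i \<in> sets \<mu>" "emeasure \<mu> (f i) \<le> ennreal C * emeasure lborel (interior (f i))" by auto
      qed
      have "emeasure \<mu> ?S \<le> emeasure \<mu> (\<Union>i. f i)"
        using D(5) Uf fm by (intro emeasure_mono) auto
      also have "\<dots> \<le> (\<Sum>i. emeasure \<mu> (f i))" using fm by (intro emeasure_subadditive_countably) auto
      also have "\<dots> \<le> (\<Sum>i. ennreal C * emeasure lborel (interior (f i)))" using fm by (intro suminf_le) auto
      also have "\<dots> = ennreal C * (\<Sum>i. emeasure lborel (interior (f i)))" by (rule ennreal_suminf_cmult)
      also have "(\<Sum>i. emeasure lborel (interior (f i))) = emeasure lborel (\<Union>i. interior (f i))"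
        by (rule suminf_emeasure) (use disj in auto)
      also have "\<dots> \<le> emeasure lborel U"
      proof (rule emeasure_mono)
        show "(\<Union>i. interior (f i)) \<subseteq> U"
        proof
          fix z assume "z \<in> (\<Union>i. interior (f i))"
          then obtain i where "z \<in> f i" using interior_subset by blast
          then show "z \<in> U" using fD[of i] DU by auto
        qed
      qed (use U in auto)
      also have "\<dots> \<le> e" by (rule Ue)
      finally show ?thesis by (simp add: mult_left_mono)
    qed
    have "measure \<mu> ?S \<le> 0"
    proof (rule field_le_epsilon)
      fix d :: real assume d: "0 < d"
      have "ennreal (measure \<mu> ?S) \<le> ennreal C * ennreal (d / (C + 1))"
        using small[of "d / (C + 1)"] d C by (simp add: emeasure_eq_measure)
      also have "\<dots> = ennreal (C * (d / (C + 1)))" using d C by (intro ennreal_mult[symmetric]) auto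
      finally have "measure \<mu> ?S \<le> C * (d / (C + 1))" using d C by (subst (asm) ennreal_le_iff) auto
      also have "\<dots> \<le> d" using d C by (simp add: field_simps)
      finally show "measure \<mu> ?S \<le> 0 + d" by simp
    qed
    then have "measure \<mu> ?S = 0" by (simp add: measure_le_0_iff)
    then show ?thesis using SS sets by (simp add: null_sets_def emeasure_eq_measure)
  qed
  then have "(\<Union>n. A \<inter> cbox (- real (Suc n)) (real (Suc n))) \<in> null_sets \<mu>" by (rule null_sets_UN)
  moreover have "(\<Union>n. A \<inter> cbox (- real (Suc n)) (real (Suc n))) = A"
  proof (intro equalityI subsetI)
    fix z assume z: "z \<in> A"
    obtain n where "\<bar>z\<bar> \<le> real n" using real_arch_simple by blast
    then have "z \<in> cbox (- real (Suc n)) (real (Suc n))" by auto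
    then show "z \<in> (\<Union>n. A \<inter> cbox (- real (Suc n)) (real (Suc n)))" using z by blast
  qed auto
  ultimately show "A \<in> null_sets \<mu>" by simp
qed

lemma spaced_card_le:
  assumes sp: "spaced n x \<delta> R" and st: "s \<le> t"
  shows "real (card {a. a \<le> n \<and> s \<le> x a \<and> x a \<le> t}) \<le> (t - s) / \<delta> + 1"
proof (cases "{a. a \<le> n \<and> s \<le> x a \<and> x a \<le> t} = {}")
  case True
  then have "card {a. a \<le> n \<and> s \<le> x a \<and> x a \<le> t} = 0" by simp
  then show ?thesis using st spacedD(1)[OF sp] by (simp only:) (simp add: add_nonneg_nonneg)
next
  case False
  let ?A = "{a. a \<le> n \<and> s \<le> x a \<and> x a \<le> t}"
  have fin: "finite ?A" by (rule finite_subset[of _ "{..n}"]) auto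
  have mi: "Min ?A \<in> ?A" "Max ?A \<in> ?A" using Min_in[OF fin False] Max_in[OF fin False] by blast+
  then have mi3: "Min ?A \<le> Max ?A" using Min_le[OF fin] by blast
  have "?A \<subseteq> {Min ?A..Max ?A}" using fin by auto
  then have "card ?A \<le> card {Min ?A..Max ?A}" by (intro card_mono) auto
  then have "real (card ?A) \<le> \<bar>real (Max ?A) - real (Min ?A)\<bar> + 1" using mi3 by simp
  moreover have "\<delta> * \<bar>real (Max ?A) - real (Min ?A)\<bar> \<le> t - s"
    using spaced_dist_ge[OF sp, of "Max ?A" "Min ?A"] mi by auto
  then have "\<bar>real (Max ?A) - real (Min ?A)\<bar> \<le> (t - s) / \<delta>"
    using spacedD(1)[OF sp] by (simp add: field_simps)
  ultimately show ?thesis by linarith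
qed

context log_gas begin

definition "C7 = A1 + C2 + LQ * A1"

lemma X_range:
  assumes "N0 \<le> N" "a \<le> MN N"
  shows "X N a \<in> {1 + u - C7 / real N .. quad_pt q u M + C7 / real N}"
proof -
  note N = N0[OF assms(1)]
  have C7: "C7 / real N = A1 / real N + C2 / real N + LQ * (A1 / real N)" by (simp add: C7_def add_divide_distrib)
  have nn: "0 \<le> C2 / real N" "0 \<le> LQ * (A1 / real N)" using const_pos A1 by auto
  have dom: "1 + uN N \<le> X N a" "X N a \<le> X N (MN N)" using X_dom[OF assms] by (auto simp: X_def)
  have 1: "1 + u - C7 / real N \<le> X N a" using uN_close(1)[OF assms(1)] dom(1) nn unfolding C7 by linarith
  let ?t = "real (MN N) / real N"
  have "\<bar>real (MN N) - real N * M\<bar> \<le> A1" using close[OF N(2)] by blast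
  then have "\<bar>real (MN N) - real N * M\<bar> / real N \<le> A1 / real N" by (intro divide_right_mono) auto
  also have "\<bar>real (MN N) - real N * M\<bar> / real N = \<bar>?t - M\<bar>"
  proof -
    have "?t - M = (real (MN N) - real N * M) / real N" using N(2) by (simp add: diff_divide_distrib)
    then show ?thesis by (simp only: abs_divide abs_of_nat)
  qed
  finally have tM: "\<bar>?t - M\<bar> \<le> A1 / real N" .
  have "\<bar>qlat \<kappa> u ?t - qlat \<kappa> u M\<bar> \<le> LQ * \<bar>?t - M\<bar>"
    unfolding LQ_def using site_le[OF N(2), of "MN N"] Tm \<kappa>_pos u M by (intro qlat_lipschitz) auto
  also have "\<dots> \<le> LQ * (A1 / real N)" using tM const_pos by (intro mult_left_mono) auto
  finally have "qlat \<kappa> u ?t \<le> quad_pt q u M + LQ * (A1 / real N)" unfolding quad_pt_q by linarith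
  moreover have "X N (MN N) \<le> qlat \<kappa> u ?t + C2 / real N" using X_close[OF assms(1), of "MN N"] by simp
  moreover have "0 \<le> A1 / real N" using A1 by simp
  ultimately have "X N a \<le> quad_pt q u M + C7 / real N" using dom(2) unfolding C7 by linarith
  with 1 show ?thesis by simp
qed

lemma rate_tendsto: "rate \<longlonglongrightarrow> 0"
proof -
  have "(\<lambda>n. sqrt (ln (real n) / real n)) \<longlonglongrightarrow> sqrt 0" by (intro tendsto_real_sqrt lim_ln_over_n)
  then show ?thesis by (simp add: rate_def[abs_def])
qed

text \<open>The empirical measures of the ground states, indexed so that all particle numbers are
  beyond the threshold \<open>N0\<close>.\<close>

definition "nu n = distr (measure_pmf (pmf_of_set (gs (N0 + n)))) borel (X (N0 + n))"

lemma gs_finite: "1 \<le> N \<Longrightarrow> finite (gs N)" and gs_nonempty: "1 \<le> N \<Longrightarrow> gs N \<noteq> {}"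
  using gs_subset[of N] card_gs[of N] by (auto intro: finite_subset)

lemma N0_add: "N0 \<le> N0 + n" "1 \<le> N0 + n"
  using N0(2)[of "N0 + n"] by auto

lemma nu_distribution: "real_distribution (nu n)"
proof -
  interpret p: prob_space "measure_pmf (pmf_of_set (gs (N0 + n)))" by (rule measure_pmf.prob_space_axioms)
  show ?thesis
    unfolding nu_def real_distribution_def real_distribution_axioms_def
    by (intro conjI measure_pmf.prob_space_distr) auto
qed

lemma integral_nu:
  assumes "f \<in> borel_measurable borel"
  shows "(\<integral>s. f s \<partial>nu n) = mean (N0 + n) f"
  unfolding nu_def using assms N0_add gs_finite[of "N0 + n"] gs_nonempty[of "N0 + n"] card_gs[of "N0 + n"]
  by (subst integral_distr) (auto simp: integral_pmf_of_set mean_def)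

lemma tight_nu: "tight nu"
  unfolding tight_def
proof (intro conjI allI impI nu_distribution)
  fix \<epsilon> :: real assume e: "0 < \<epsilon>"
  have "measure (nu n) {0<..diam + 2} = 1" for n
  proof -
    interpret real_distribution "nu n" by (rule nu_distribution)
    let ?N = "N0 + n"
    have "X ?N a \<in> {0<..diam + 2}" if "a \<in> gs ?N" for a
    proof -
      have a: "a \<le> MN ?N" using that gs_subset[OF N0_add(2)] by auto
      have "1 + uN ?N \<le> X ?N a" using X_dom[OF N0_add(1) a] by auto
      moreover have "\<bar>X ?N a - X ?N 0\<bar> \<le> diam" using spaced_dist_le[OF X_spaced[OF N0_add(1)] a] by simp
      moreover have "0 \<le> uN ?N" "uN ?N \<le> 1" using uN_close[OF N0_add(1)] by auto
      ultimately show ?thesis using X_0[OF N0_add(2)] by auto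
    qed
    then have "AE s in nu n. s \<in> {0<..diam + 2}"
      unfolding nu_def using gs_finite[OF N0_add(2)] gs_nonempty[OF N0_add(2)]
      by (subst AE_distr_iff) (auto simp: AE_measure_pmf_iff)
    then have "prob {0<..diam + 2} = 1" by (subst prob_eq_1) auto
    then show ?thesis .
  qed
  then show "\<exists>a b. a < b \<and> (\<forall>n. 1 - \<epsilon> < measure (nu n) {a<..b})"
    using e const_pos by (intro exI[of _ 0] exI[of _ "diam + 2"]) auto
qed

text \<open>Tightness yields a limit only along a subsequence. In the Cauchy estimate
  \<open>N\<close> is fixed while the other particle number runs along it, which gives the rate for
  every \<open>N\<close>.\<close>

lemma limit_measure:
  obtains \<mu> where "real_distribution \<mu>"
    "\<And>f F L N. (\<And>s. \<bar>f s\<bar> \<le> F) \<Longrightarrow> (\<And>s t. \<bar>f s - f t\<bar> \<le> L * \<bar>s - t\<bar>) \<Longrightarrow> 0 \<le> L \<Longrightarrow> N0 \<le> N \<Longrightarrow>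
       \<bar>mean N f - (\<integral>s. f s \<partial>\<mu>)\<bar> \<le> Ctest F L * rate N"
    "\<And>x y. x \<le> y \<Longrightarrow> measure \<mu> {x..y} \<le> 1 / gap * (y - x)"
    "measure \<mu> {1 + u .. quad_pt q u M} = 1"
proof -
  obtain r \<mu> where r: "strict_mono (r :: nat \<Rightarrow> nat)" and \<mu>: "real_distribution \<mu>"
    and weak: "weak_conv_m (nu \<circ> id \<circ> r) \<mu>"
    using tight_imp_convergent_subsubsequence[OF tight_nu, of id] by (auto simp: strict_mono_def)
  interpret \<mu>: real_distribution \<mu> by fact
  define k where "k n = N0 + r n" for n
  have conv: "(\<lambda>n. mean (k n) f) \<longlonglongrightarrow> (\<integral>s. f s \<partial>\<mu>)"
    if "\<And>x. isCont f x" "\<And>x. \<bar>f x\<bar> \<le> B" for f B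
  proof -
    have "(\<lambda>n. integral\<^sup>L ((nu \<circ> id \<circ> r) n) f) \<longlonglongrightarrow> integral\<^sup>L \<mu> f"
      by (rule weak_conv_imp_integral_bdd_continuous_conv)
        (use that \<mu> nu_distribution weak in \<open>auto simp: comp_def\<close>)
    moreover have "f \<in> borel_measurable borel"
      using that by (intro borel_measurable_continuous_onI) (auto simp: continuous_on_eq_continuous_at)
    ultimately show ?thesis by (simp add: integral_nu k_def)
  qed
  have k_top: "filterlim k at_top sequentially"
  proof (rule filterlim_at_top_mono[OF filterlim_ident])
    show "\<forall>\<^sub>F n in sequentially. n \<le> k n"
      using seq_suble[OF r] by (auto simp: k_def intro!: always_eventually le_trans[OF _ le_add2])
  qed
  have k0: "N0 \<le> k n" for n by (simp add: k_def)
  have inv0: "(\<lambda>n. c / real (k n)) \<longlonglongrightarrow> 0" for c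
    by (intro tendsto_divide_0[OF tendsto_const] filterlim_at_top_imp_at_infinity
        filterlim_compose[OF filterlim_real_sequentially k_top])
  show thesis
  proof (rule that[OF \<mu>])
    fix f :: "real \<Rightarrow> real" and F L :: real and N :: nat
    assume f: "\<And>s. \<bar>f s\<bar> \<le> F" and lip: "\<And>s t. \<bar>f s - f t\<bar> \<le> L * \<bar>s - t\<bar>" and L: "0 \<le> L" and N: "N0 \<le> N"
    let ?C = "Ctest F L"
    have "L-lipschitz_on UNIV f" using lip L by (intro lipschitz_onI) (auto simp: dist_real_def)
    then have "continuous_on UNIV f" by (rule lipschitz_on_continuous_on)
    then have cont: "isCont f x" for x by (simp add: continuous_on_eq_continuous_at)
    have lim1: "(\<lambda>n. \<bar>mean N f - mean (k n) f\<bar>) \<longlonglongrightarrow> \<bar>mean N f - (\<integral>s. f s \<partial>\<mu>)\<bar>"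
      by (intro tendsto_intros conv[OF cont f])
    have lim2: "(\<lambda>n. ?C * (rate N + rate (k n))) \<longlonglongrightarrow> ?C * (rate N + 0)"
      by (intro tendsto_intros filterlim_compose[OF rate_tendsto k_top])
    have "\<bar>mean N f - (\<integral>s. f s \<partial>\<mu>)\<bar> \<le> ?C * (rate N + 0)"
      by (rule tendsto_le[OF trivial_limit_sequentially lim2 lim1])
         (intro always_eventually allI mean_cauchy f lip L N k0)
    then show "\<bar>mean N f - (\<integral>s. f s \<partial>\<mu>)\<bar> \<le> ?C * rate N" by simp
  next
    fix x y :: real assume xy: "x \<le> y"
    show "measure \<mu> {x..y} \<le> 1 / gap * (y - x)"
    proof (rule field_le_epsilon)
      fix d :: real assume d: "0 < d"
      \<comment> \<open>The trapezoid \<open>\<phi>\<close> below is 1 on \<open>{x..y}\<close> and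
        vanishes beyond distance \<open>\<eta>\<close>. Its two margins contribute
        \<open>2 * \<eta> / gap = d\<close>.\<close>
      define \<eta> where "\<eta> = d * gap / 2"
      have \<eta>: "0 < \<eta>" using d const_pos by (simp add: \<eta>_def)
      define \<phi> where "\<phi> s = max 0 (min 1 (1 + min (s - x) (y - s) / \<eta>))" for s
      have c: "isCont \<phi> s" for s
        unfolding \<phi>_def[abs_def] using \<eta> by (intro continuous_intros) auto
      have b: "\<bar>\<phi> s\<bar> \<le> 1" for s by (simp add: \<phi>_def)
      have one: "\<phi> s = 1" if "s \<in> {x..y}" for s
      proof -
        have "0 \<le> min (s - x) (y - s) / \<eta>" using that \<eta> by auto
        then show ?thesis by (simp add: \<phi>_def)
      qed
      have zero: "\<phi> s = 0" if "\<not> (x - \<eta> \<le> s \<and> s \<le> y + \<eta>)" for s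
      proof -
        have "min (s - x) (y - s) \<le> - \<eta>" using that by auto
        then have "min (s - x) (y - s) / \<eta> \<le> - \<eta> / \<eta>" using \<eta> by (intro divide_right_mono) auto
        then show ?thesis using \<eta> by (simp add: \<phi>_def)
      qed
      have "measure \<mu> {x..y} = (\<integral>s. indicator {x..y} s \<partial>\<mu>)" by simp
      also have "\<dots> \<le> (\<integral>s. \<phi> s \<partial>\<mu>)"
      proof (rule integral_mono)
        have "\<phi> \<in> borel_measurable borel"
          using c by (intro borel_measurable_continuous_onI) (auto simp: continuous_on_eq_continuous_at)
        then show "integrable \<mu> \<phi>" using b by (intro \<mu>.integrable_const_bound[of _ 1]) auto
        show "integrable \<mu> (indicator {x..y} :: real \<Rightarrow> real)" by (simp add: \<mu>.emeasure_eq_measure)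
        show "indicator {x..y} s \<le> \<phi> s" for s using one[of s] by (auto simp: indicator_def \<phi>_def)
      qed
      finally have 1: "measure \<mu> {x..y} \<le> (\<integral>s. \<phi> s \<partial>\<mu>)" .
      have "(\<integral>s. \<phi> s \<partial>\<mu>) \<le> (y - x + 2 * \<eta>) / gap + 0"
      proof (rule tendsto_le[OF trivial_limit_sequentially _ conv[OF c b]])
        show "(\<lambda>n. (y - x + 2 * \<eta>) / gap + 1 / real (k n)) \<longlonglongrightarrow> (y - x + 2 * \<eta>) / gap + 0"
          by (intro tendsto_intros inv0)
        show "\<forall>\<^sub>F n in sequentially. mean (k n) \<phi> \<le> (y - x + 2 * \<eta>) / gap + 1 / real (k n)"
        proof (intro always_eventually allI)
          fix n
          note N = N0[OF k0[of n]]
          let ?A = "{a. a \<le> MN (k n) \<and> x - \<eta> \<le> X (k n) a \<and> X (k n) a \<le> y + \<eta>}"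
          have "(\<Sum>a\<in>gs (k n). \<phi> (X (k n) a)) \<le> (\<Sum>a\<in>gs (k n). of_bool (a \<in> ?A))"
          proof (rule sum_mono)
            fix a assume "a \<in> gs (k n)"
            then have "a \<le> MN (k n)" using gs_subset[OF N(2)] by auto
            then show "\<phi> (X (k n) a) \<le> of_bool (a \<in> ?A)"
              using zero[of "X (k n) a"] b[of "X (k n) a"] by auto
          qed
          also have "\<dots> = real (card (gs (k n) \<inter> ?A))"
            using gs_finite[OF N(2)] by (simp add: Int_def)
          also have "\<dots> \<le> real (card ?A)"
            by (intro of_nat_mono card_mono) (auto intro: finite_subset[of _ "{..MN (k n)}"])
          also have "\<dots> \<le> ((y + \<eta>) - (x - \<eta>)) / (gap / real (k n)) + 1"
            using xy \<eta> by (intro spaced_card_le[OF X_spaced[OF k0]]) auto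
          finally have "mean (k n) \<phi> \<le> (((y + \<eta>) - (x - \<eta>)) / (gap / real (k n)) + 1) / real (k n)"
            unfolding mean_def by (intro divide_right_mono) auto
          also have "\<dots> = (y - x + 2 * \<eta>) / gap + 1 / real (k n)"
            using N(2) by (simp add: add_divide_distrib)
          finally show "mean (k n) \<phi> \<le> (y - x + 2 * \<eta>) / gap + 1 / real (k n)" .
        qed
      qed
      also have "\<dots> = 1 / gap * (y - x) + d" using const_pos by (simp add: \<eta>_def field_simps)
      finally show "measure \<mu> {x..y} \<le> 1 / gap * (y - x) + d" using 1 by linarith
    qed
  next
    \<comment> \<open>The distance to the limiting interval, truncated at 1: continuous, zero
      exactly on the interval, and at most \<open>C7 / real N\<close> at lattice points.\<close>
    define \<phi> where "\<phi> s = min 1 (max 0 (max (1 + u - s) (s - quad_pt q u M)))" for s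
    have c: "isCont \<phi> s" for s unfolding \<phi>_def[abs_def] by (intro continuous_intros)
    have b: "\<bar>\<phi> s\<bar> \<le> 1" for s by (simp add: \<phi>_def)
    have m: "\<phi> \<in> borel_measurable borel"
      using c by (intro borel_measurable_continuous_onI) (auto simp: continuous_on_eq_continuous_at)
    have \<phi>0: "AE s in \<mu>. 0 \<le> \<phi> s" by (simp add: \<phi>_def)
    have C7: "0 \<le> C7" using A1 const_pos by (simp add: C7_def)
    have "(\<integral>s. \<phi> s \<partial>\<mu>) \<le> 0"
    proof (rule tendsto_le[OF trivial_limit_sequentially inv0[of C7] conv[OF c b]])
      show "\<forall>\<^sub>F n in sequentially. mean (k n) \<phi> \<le> C7 / real (k n)"
      proof (intro always_eventually allI)
        fix n
        note N = N0[OF k0[of n]]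
        have "(\<Sum>a\<in>gs (k n). \<phi> (X (k n) a)) \<le> (\<Sum>a\<in>gs (k n). C7 / real (k n))"
        proof (rule sum_mono)
          fix a assume "a \<in> gs (k n)"
          then have "a \<le> MN (k n)" using gs_subset[OF N(2)] by auto
          from X_range[OF k0 this] show "\<phi> (X (k n) a) \<le> C7 / real (k n)"
            using C7 unfolding \<phi>_def by (intro min.coboundedI2 max.boundedI) (auto simp: algebra_simps)
        qed
        also have "\<dots> = C7" using card_gs[OF N(2)] N(2) by simp
        finally show "mean (k n) \<phi> \<le> C7 / real (k n)" unfolding mean_def by (intro divide_right_mono) auto
      qed
    qed
    moreover have "0 \<le> (\<integral>s. \<phi> s \<partial>\<mu>)" by (rule integral_nonneg_AE) (simp add: \<phi>_def)
    moreover have "integrable \<mu> \<phi>" using m b by (intro \<mu>.integrable_const_bound[of _ 1]) auto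
    ultimately have "AE s in \<mu>. \<phi> s = 0"
      using integral_nonneg_eq_0_iff_AE[of \<mu> \<phi>] \<phi>0 by simp
    then have "AE s in \<mu>. s \<in> {1 + u .. quad_pt q u M}"
    proof (rule AE_mp, intro AE_I2 impI)
      fix s assume s: "\<phi> s = 0"
      show "s \<in> {1 + u .. quad_pt q u M}"
      proof (rule ccontr)
        assume "s \<notin> {1 + u .. quad_pt q u M}"
        then have "0 < \<phi> s" by (auto simp: \<phi>_def less_max_iff_disj)
        then show False using s by simp
      qed
    qed
    then show "measure \<mu> {1 + u .. quad_pt q u M} = 1" by (subst \<mu>.prob_eq_1) auto
  qed
qed

end

section \<open>Concentration\<close>

text \<open>Off the bad set a deterministic bound acts. On it the variable grows at most linearly,
  so the \<open>k\<close>-th moment gains at most a constant times N^k exp(-N).\<close>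

lemma tends_to_0_point_measure:
  fixes A :: "nat \<Rightarrow> 'a set" and p X :: "nat \<Rightarrow> 'a \<Rightarrow> real"
  assumes fin: "\<And>N. n0 \<le> N \<Longrightarrow> finite (A N)"
    and p0: "\<And>N z. n0 \<le> N \<Longrightarrow> z \<in> A N \<Longrightarrow> 0 \<le> p N z"
    and p1: "\<And>N. n0 \<le> N \<Longrightarrow> (\<Sum>z\<in>A N. p N z) = 1"
    and bad: "\<And>N. n0 \<le> N \<Longrightarrow> bad N \<subseteq> A N" "\<And>N. n0 \<le> N \<Longrightarrow> (\<Sum>z\<in>bad N. p N z) \<le> exp (- real N)"
    and XC: "\<And>N z. n0 \<le> N \<Longrightarrow> z \<in> A N \<Longrightarrow> \<bar>X N z\<bar> \<le> C * real N"
    and Xg: "\<And>N z. n0 \<le> N \<Longrightarrow> z \<in> A N - bad N \<Longrightarrow> \<bar>X N z\<bar> \<le> g N"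
    and g: "g \<longlonglongrightarrow> 0"
  defines "P \<equiv> \<lambda>N. point_measure (A N) (\<lambda>z. ennreal (p N z))"
  shows "tends_to_0_in_prob P X \<and> tends_to_0_in_moments P X"
proof
  have expo: "(\<lambda>N. exp (- real N)) \<longlonglongrightarrow> 0"
    by real_asymp
  show "tends_to_0_in_prob P X"
    unfolding tends_to_0_in_prob_def
  proof (intro allI impI)
    fix \<delta> :: real assume \<delta>: "0 < \<delta>"
    have "\<forall>\<^sub>F N in sequentially. g N < \<delta>" using g \<delta> by (rule order_tendstoD)
    then have "\<forall>\<^sub>F N in sequentially. measure (P N) {\<omega> \<in> space (P N). \<bar>X N \<omega>\<bar> > \<delta>} \<le> exp (- real N)"
      using eventually_ge_at_top[of n0]
    proof eventually_elim
      case (elim N)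
      let ?B = "{\<omega> \<in> space (P N). \<bar>X N \<omega>\<bar> > \<delta>}"
      have B: "?B \<subseteq> bad N" using Xg[OF elim(2)] elim(1) by (force simp: P_def space_point_measure)
      have "measure (P N) ?B = (\<Sum>z\<in>?B. p N z)"
        unfolding P_def using fin p0 elim by (subst measure_point_measure_finite_if) (auto simp: space_point_measure)
      also have "\<dots> \<le> (\<Sum>z\<in>bad N. p N z)"
        using B bad(1)[OF elim(2)] p0[OF elim(2)] fin[OF elim(2)] by (intro sum_mono2) (auto intro: finite_subset)
      also have "\<dots> \<le> exp (- real N)" by (rule bad(2)[OF elim(2)])
      finally show ?case .
    qed
    then show "(\<lambda>N. measure (P N) {\<omega> \<in> space (P N). \<bar>X N \<omega>\<bar> > \<delta>}) \<longlonglongrightarrow> 0"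
      by (intro tendsto_sandwich[OF _ _ tendsto_const expo]) auto
  qed
  show "tends_to_0_in_moments P X"
    unfolding tends_to_0_in_moments_def
  proof (intro allI impI conjI)
    fix k :: nat assume k: "1 \<le> k"
    show "\<forall>\<^sub>F N in sequentially. integrable (P N) (\<lambda>\<omega>. X N \<omega> ^ k)"
      using eventually_ge_at_top[of n0]
    proof eventually_elim
      case (elim N)
      show ?case unfolding P_def by (rule integrable_point_measure_finite) (rule fin[OF elim])
    qed
    have bound: "\<forall>\<^sub>F N in sequentially. norm (\<integral>\<omega>. X N \<omega> ^ k \<partial>P N) \<le> \<bar>g N\<bar> ^ k + \<bar>C\<bar> ^ k * (real N ^ k / exp (real N))"
      using eventually_ge_at_top[of n0]
    proof eventually_elim
      case (elim N)
      note f = fin[OF elim] and q = p0[OF elim]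
      have "(\<integral>\<omega>. X N \<omega> ^ k \<partial>P N) = (\<Sum>z\<in>A N. p N z * X N z ^ k)"
        unfolding P_def using f q by (subst lebesgue_integral_point_measure_finite) auto
      also have "\<bar>\<dots>\<bar> \<le> (\<Sum>z\<in>A N. p N z * \<bar>X N z\<bar> ^ k)"
        by (rule order_trans[OF sum_abs]) (use q in \<open>simp add: abs_mult power_abs\<close>)
      also have "\<dots> \<le> (\<Sum>z\<in>A N. p N z * \<bar>g N\<bar> ^ k + (if z \<in> bad N then p N z * (\<bar>C\<bar> * real N) ^ k else 0))"
      proof (rule sum_mono)
        fix z assume z: "z \<in> A N"
        have nn: "0 \<le> p N z * \<bar>g N\<bar> ^ k" using q[OF z] by simp
        show "p N z * \<bar>X N z\<bar> ^ k \<le> p N z * \<bar>g N\<bar> ^ k + (if z \<in> bad N then p N z * (\<bar>C\<bar> * real N) ^ k else 0)"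
        proof (cases "z \<in> bad N")
          case True
          have "C * real N \<le> \<bar>C\<bar> * real N" by (intro mult_right_mono) auto
          then have "\<bar>X N z\<bar> \<le> \<bar>C\<bar> * real N" using XC[OF elim z] by linarith
          then have "p N z * \<bar>X N z\<bar> ^ k \<le> p N z * (\<bar>C\<bar> * real N) ^ k"
            using q[OF z] by (intro mult_left_mono power_mono) auto
          then show ?thesis using True nn by simp
        next
          case False
          then have "\<bar>X N z\<bar> \<le> \<bar>g N\<bar>" using Xg[OF elim, of z] z by auto
          then have "p N z * \<bar>X N z\<bar> ^ k \<le> p N z * \<bar>g N\<bar> ^ k"
            using q[OF z] by (intro mult_left_mono power_mono) auto
          then show ?thesis using False by simp
        qed
      qed
      also have "\<dots> = \<bar>g N\<bar> ^ k + (\<Sum>z\<in>bad N. p N z) * (\<bar>C\<bar> * real N) ^ k"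
      proof -
        have "(\<Sum>z\<in>A N. if z \<in> bad N then p N z * (\<bar>C\<bar> * real N) ^ k else 0) = (\<Sum>z\<in>bad N. p N z * (\<bar>C\<bar> * real N) ^ k)"
          using bad(1)[OF elim] f by (intro sum.mono_neutral_cong_right) auto
        then show ?thesis by (simp add: sum.distrib p1[OF elim] flip: sum_distrib_right)
      qed
      also have "\<dots> \<le> \<bar>g N\<bar> ^ k + exp (- real N) * (\<bar>C\<bar> * real N) ^ k"
        using bad(2)[OF elim] by (intro add_left_mono mult_right_mono) auto
      also have "exp (- real N) * (\<bar>C\<bar> * real N) ^ k = \<bar>C\<bar> ^ k * (real N ^ k / exp (real N))"
        by (simp add: power_mult_distrib exp_minus field_simps)
      finally show ?case by simp
    qed
    have "(\<lambda>N. \<bar>g N\<bar> ^ k + \<bar>C\<bar> ^ k * (real N ^ k / exp (real N))) \<longlonglongrightarrow> \<bar>0\<bar> ^ k + \<bar>C\<bar> ^ k * 0"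
      by (intro tendsto_intros g filterlim_compose[OF tendsto_power_div_exp_0 filterlim_real_sequentially])
    moreover have "\<bar>0\<bar> ^ k + \<bar>C\<bar> ^ k * 0 = 0" using k by (simp add: zero_power)
    ultimately have "(\<lambda>N. \<bar>g N\<bar> ^ k + \<bar>C\<bar> ^ k * (real N ^ k / exp (real N))) \<longlonglongrightarrow> 0" by (simp only:)
    with bound show "(\<lambda>N. \<integral>\<omega>. X N \<omega> ^ k \<partial>P N) \<longlonglongrightarrow> 0" by (rule Lim_null_comparison)
  qed
qed

section \<open>Configurations as sets of occupied sites\<close>

lemma sum_square_symmetric:
  fixes k :: "nat \<Rightarrow> nat \<Rightarrow> real"
  assumes sym: "\<And>i j. k i j = k j i" and diag: "\<And>i. k i i = 0"
  shows "(\<Sum>i\<in>{1..N}. \<Sum>j\<in>{1..N}. k i j) = 2 * (\<Sum>i\<in>{1..N}. \<Sum>j\<in>{i<..N}. k i j)"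
proof (induction N)
  case (Suc N)
  have "(\<Sum>j\<in>{i<..Suc N}. k i j) = (\<Sum>j\<in>{i<..N}. k i j) + k i (Suc N)" if "i \<in> {1..N}" for i
  proof -
    have "{i<..Suc N} = insert (Suc N) {i<..N}" using that by auto
    then show ?thesis by simp
  qed
  then have "(\<Sum>i\<in>{1..Suc N}. \<Sum>j\<in>{i<..Suc N}. k i j) =
      (\<Sum>i\<in>{1..N}. \<Sum>j\<in>{i<..N}. k i j) + (\<Sum>i\<in>{1..N}. k i (Suc N))"
    by (simp add: sum.distrib)
  moreover have "(\<Sum>i\<in>{1..Suc N}. \<Sum>j\<in>{1..Suc N}. k i j) =
      (\<Sum>i\<in>{1..N}. \<Sum>j\<in>{1..N}. k i j) + 2 * (\<Sum>i\<in>{1..N}. k i (Suc N))"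
    by (simp add: sum.distrib diag sym[of "Suc N"])
  ultimately show ?case using Suc.IH by (simp only: distrib_left)
qed simp

lemma increasing_enumeration:
  assumes "S \<subseteq> {..n::nat}" "card S = N"
  shows "\<exists>l. l \<in> {1..N} \<rightarrow>\<^sub>E {0..n} \<and> strict_mono_on {1..N} l \<and> l ` {1..N} = S"
proof -
  have "finite S" using assms(1) by (rule finite_subset) simp
  then obtain h where h: "bij_betw h {..<N} S" "strict_mono_on {..<N} h"
    using ex_bij_betw_strict_mono_card[of S] assms(2) by blast
  define l where "l = restrict (\<lambda>i. h (i - 1)) {1..N}"
  have "(\<lambda>i. i - 1) ` {1..N} = {..<N}"
    by (auto simp: image_iff intro!: bexI[of _ "Suc _"])
  moreover have "l ` {1..N} = h ` ((\<lambda>i. i - 1) ` {1..N})"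
    unfolding image_image by (intro image_cong refl) (simp add: l_def)
  ultimately have im: "l ` {1..N} = S" using h(1) by (simp add: bij_betw_def)
  moreover have "l \<in> {1..N} \<rightarrow>\<^sub>E {0..n}"
  proof (rule PiE_I)
    fix i assume "i \<in> {1..N}"
    then have "l i \<in> S" using im by blast
    then show "l i \<in> {0..n}" using assms(1) by auto
  qed (auto simp: l_def)
  moreover have "strict_mono_on {1..N} l"
  proof (rule strict_mono_onI)
    fix i j assume "i \<in> {1..N}" "j \<in> {1..N}" "i < j"
    then show "l i < l j" using strict_mono_onD[OF h(2), of "i - 1" "j - 1"] by (auto simp: l_def)
  qed
  ultimately show ?thesis by blast
qed

locale weighted_log_gas = log_gas +
  fixes w :: "nat \<Rightarrow> real \<Rightarrow> real"
  assumes w: "\<And>N s. 1 \<le> N \<Longrightarrow> s \<in> {1 + uN N .. quad_pt (qN N) (uN N) (real (MN N))} \<Longrightarrow>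
          w N s = exp (- real N * VN N s)"
begin

abbreviation "Cf N \<equiv> configs (qN N) (MN N) (uN N) N"

definition sites :: "nat \<Rightarrow> (nat \<Rightarrow> real) \<Rightarrow> nat set" where
  "sites N z = {a. a \<le> MN N \<and> X N a \<in> z ` {1..N}}"

lemma X_inj: "N0 \<le> N \<Longrightarrow> a \<le> MN N \<Longrightarrow> b \<le> MN N \<Longrightarrow> X N a = X N b \<Longrightarrow> a = b"
  using spaced_pos(2)[OF X_spaced, of N a b] by auto

lemma config_sites:
  assumes "N0 \<le> N" "l \<in> {1..N} \<rightarrow>\<^sub>E {0..MN N}"
  shows "sites N (restrict (\<lambda>i. quad_pt (qN N) (uN N) (real (l i))) {1..N}) = l ` {1..N}"
proof -
  have "sites N (restrict (\<lambda>i. quad_pt (qN N) (uN N) (real (l i))) {1..N}) = {a. a \<le> MN N \<and> X N a \<in> (\<lambda>i. X N (l i)) ` {1..N}}"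
    by (simp add: sites_def X_def)
  also have "\<dots> = l ` {1..N}"
  proof (intro equalityI subsetI)
    fix a assume "a \<in> {a. a \<le> MN N \<and> X N a \<in> (\<lambda>i. X N (l i)) ` {1..N}}"
    then obtain i where i: "a \<le> MN N" "i \<in> {1..N}" "X N a = X N (l i)" by auto
    then have "a = l i" using assms by (intro X_inj[of N]) (auto dest: PiE_mem)
    then show "a \<in> l ` {1..N}" using i by auto
  qed (use assms in \<open>auto dest: PiE_mem\<close>)
  finally show ?thesis .
qed

lemma config_card:
  assumes "N0 \<le> N"
  shows "finite (Cf N)"
    "real (card (Cf N)) \<le> real (Suc (MN N)) ^ N"
proof -
  let ?L = "{l \<in> {1..N} \<rightarrow>\<^sub>E {0..MN N}. strict_mono_on {1..N} l}"
  have fin: "finite ({1..N} \<rightarrow>\<^sub>E {0..MN N})" by (intro finite_PiE) auto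
  then have finL: "finite ?L" by auto
  then show "finite (Cf N)" unfolding configs_def by (rule finite_imageI)
  have "card (Cf N) \<le> card ?L" unfolding configs_def by (rule card_image_le[OF finL])
  also have "\<dots> \<le> card ({1..N} \<rightarrow>\<^sub>E {0..MN N})" using fin by (intro card_mono) auto
  also have "\<dots> = Suc (MN N) ^ N" by (simp add: card_PiE)
  finally show "real (card (Cf N)) \<le> real (Suc (MN N)) ^ N"
    by (metis of_nat_le_iff of_nat_power)
qed

text \<open>One factor for each pair, undoing the division by \<open>diam\<close> in
  \<open>logK\<close>; it cancels after normalisation.\<close>

definition "pref N = (\<Prod>i\<in>{1..N}. \<Prod>j\<in>{i<..N}. diam\<^sup>2)"

lemma pref_pos: "0 < pref N"
  using const_pos by (auto simp: pref_def intro!: prod_pos)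

lemma config_props:
  fixes f :: "real \<Rightarrow> real"
  assumes N: "N0 \<le> N" and z: "z \<in> Cf N"
  shows "sites N z \<subseteq> {..MN N}" "card (sites N z) = N"
    "(\<Sum>i\<in>{1..N}. f (z i)) = (\<Sum>a\<in>sites N z. f (X N a))"
    "gibbs_weight (w N) N z = pref N * exp (- En N (ind (sites N z)))"
proof -
  obtain l where l: "l \<in> {1..N} \<rightarrow>\<^sub>E {0..MN N}" "strict_mono_on {1..N} l"
    "z = restrict (\<lambda>i. quad_pt (qN N) (uN N) (real (l i))) {1..N}"
    using z by (auto simp: configs_def)
  have S: "sites N z = l ` {1..N}" unfolding l(3) by (rule config_sites[OF N l(1)])
  have inj: "inj_on l {1..N}" using l(2) by (rule strict_mono_on_imp_inj_on)
  have lM: "l i \<le> MN N" if "i \<in> {1..N}" for i using PiE_mem[OF l(1) that] by simp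
  have zX: "z i = X N (l i)" if "i \<in> {1..N}" for i using that by (simp add: l(3) X_def)
  have re: "(\<Sum>a\<in>sites N z. g a) = (\<Sum>i\<in>{1..N}. g (l i))" for g :: "nat \<Rightarrow> real"
    unfolding S using sum.reindex[OF inj] by simp
  show S1: "sites N z \<subseteq> {..MN N}" by (auto simp: sites_def)
  show "card (sites N z) = N" unfolding S using card_image[OF inj] by simp
  show "(\<Sum>i\<in>{1..N}. f (z i)) = (\<Sum>a\<in>sites N z. f (X N a))" unfolding re using zX by (intro sum.cong) auto
  let ?K = "logK diam (X N)"
  have ind: "(\<Sum>a\<le>MN N. g a * of_bool (a \<in> sites N z)) = (\<Sum>a\<in>sites N z. g a)" for g :: "nat \<Rightarrow> real"
    using S1 by (intro sum.mono_neutral_cong_right) auto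
  have "bilin ?K (MN N) (ind (sites N z)) (ind (sites N z)) =
      (\<Sum>a\<le>MN N. (\<Sum>b\<le>MN N. ?K a b * of_bool (b \<in> sites N z)) * of_bool (a \<in> sites N z))"
    unfolding bilin_def sum_distrib_right by (intro sum.cong refl) (simp only: mult_ac)
  also have "\<dots> = (\<Sum>i\<in>{1..N}. \<Sum>j\<in>{1..N}. ?K (l i) (l j))" unfolding ind re by (rule refl)
  also have "\<dots> = 2 * (\<Sum>i\<in>{1..N}. \<Sum>j\<in>{i<..N}. ?K (l i) (l j))"
    by (rule sum_square_symmetric) (auto simp: logK_commute)
  finally have E: "En N (ind (sites N z)) =
      (\<Sum>i\<in>{1..N}. \<Sum>j\<in>{i<..N}. 2 * ?K (l i) (l j)) + (\<Sum>i\<in>{1..N}. real N * VN N (z i))"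
    unfolding En_def energy_def ind re using zX by (simp add: sum_distrib_left)
  have pair: "(z i - z j)\<^sup>2 = diam\<^sup>2 * exp (- (2 * ?K (l i) (l j)))" if ij: "i \<in> {1..N}" "j \<in> {i<..N}" for i j
  proof -
    have j: "j \<in> {1..N}" using ij by auto
    have ne: "l i \<noteq> l j" using strict_mono_onD[OF l(2) ij(1) j] ij by auto
    have pos: "0 < \<bar>X N (l i) - X N (l j)\<bar>" by (rule spaced_pos(2)[OF X_spaced[OF N] lM[OF ij(1)] lM[OF j] ne])
    have R: "0 < diam" using const_pos by simp
    have "exp (- (2 * ?K (l i) (l j))) = (inverse (exp (?K (l i) (l j))))\<^sup>2"
      by (simp add: exp_minus power_inverse exp_double)
    also have "exp (?K (l i) (l j)) = diam / \<bar>X N (l i) - X N (l j)\<bar>"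
      using ne pos R by (simp add: logK_def)
    finally show ?thesis using R zX[OF ij(1)] zX[OF j] by (simp add: power_divide)
  qed
  have pot: "w N (z i) = exp (- (real N * VN N (z i)))" if "i \<in> {1..N}" for i
    unfolding zX[OF that] using w[OF N0(2)[OF N] X_dom[OF N lM[OF that]]] by simp
  have "gibbs_weight (w N) N z = (\<Prod>i\<in>{1..N}. \<Prod>j\<in>{i<..N}. diam\<^sup>2 * exp (- (2 * ?K (l i) (l j)))) *
      (\<Prod>i\<in>{1..N}. exp (- (real N * VN N (z i))))"
    unfolding gibbs_weight_def using pair pot by (intro arg_cong2[where f="(*)"] prod.cong refl) auto
  also have "\<dots> = pref N * exp (- (\<Sum>i\<in>{1..N}. \<Sum>j\<in>{i<..N}. 2 * ?K (l i) (l j))) * exp (- (\<Sum>i\<in>{1..N}. real N * VN N (z i)))"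
    by (simp add: pref_def prod.distrib exp_sum sum_negf[symmetric])
  also have "\<dots> = pref N * exp (- En N (ind (sites N z)))"
    unfolding E by (simp add: exp_add[symmetric])
  finally show "gibbs_weight (w N) N z = pref N * exp (- En N (ind (sites N z)))" .
qed

lemma ground_config:
  assumes "N0 \<le> N"
  obtains z where "z \<in> Cf N" "sites N z = gs N"
proof -
  note N = N0[OF assms]
  obtain l where l: "l \<in> {1..N} \<rightarrow>\<^sub>E {0..MN N}" "strict_mono_on {1..N} l" "l ` {1..N} = gs N"
    using increasing_enumeration[OF gs_subset[OF N(2)] card_gs[OF N(2)]] by blast
  show thesis
  proof (rule that)
    show "restrict (\<lambda>i. quad_pt (qN N) (uN N) (real (l i))) {1..N} \<in> Cf N"
      using l by (auto simp: configs_def)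
    show "sites N (restrict (\<lambda>i. quad_pt (qN N) (uN N) (real (l i))) {1..N}) = gs N"
      using config_sites[OF assms l(1)] l(3) by simp
  qed
qed

definition "excess N z = En N (ind (sites N z)) - En N (ind (gs N))"

text \<open>At most \<open>((Tm + 1) * N) ^ N\<close> configurations exist, which costs
  \<open>ln (Tm + 1) + 1\<close> in units of N ln N; the remaining unit makes the bad set
  improbable.\<close>

definition "B0 = ln (Tm + 1) + 2"

definition "bad N = {z \<in> Cf N. B0 * (real N * ln (real N)) < excess N z}"

text \<open>The partition function is at least the weight of the ground state alone, so a normalised
  weight is at most \<open>exp (- excess N z)\<close>. Counting configurations suffices for the
  sum.\<close>

lemma bad_probability:
  assumes N: "N0 \<le> N"
  defines "Z \<equiv> \<Sum>z'\<in>Cf N. gibbs_weight (w N) N z'"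
  shows "0 < Z" "(\<Sum>z\<in>bad N. gibbs_weight (w N) N z / Z) \<le> exp (- real N)"
proof -
  let ?gw = "gibbs_weight (w N) N"
  let ?e0 = "En N (ind (gs N))"
  note fin = config_card(1)[OF N] and NN = N0[OF N] and l1 = ln_N_ge1[OF N]
  have gw: "?gw z = pref N * exp (- ?e0) * exp (- excess N z)" if "z \<in> Cf N" for z
    using config_props(4)[OF N that] by (simp add: excess_def exp_add[symmetric])
  have gw0: "0 < ?gw z" if "z \<in> Cf N" for z unfolding gw[OF that] using pref_pos by (intro mult_pos_pos) auto
  obtain z0 where z0: "z0 \<in> Cf N" "sites N z0 = gs N" by (rule ground_config[OF N])
  have "?gw z0 \<le> Z" unfolding Z_def by (rule member_le_sum[OF z0(1) _ fin]) (use gw0 in \<open>auto intro: less_imp_le\<close>)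
  moreover have "?gw z0 = pref N * exp (- ?e0)" using gw[OF z0(1)] z0(2) by (simp add: excess_def)
  ultimately have Zl: "pref N * exp (- ?e0) \<le> Z" by simp
  have pp: "0 < pref N * exp (- ?e0)" by (rule mult_pos_pos[OF pref_pos exp_gt_zero])
  then show Z: "0 < Z" using Zl by linarith
  have "(\<Sum>z\<in>bad N. ?gw z / Z) \<le> (\<Sum>z\<in>bad N. exp (- (B0 * (real N * ln (real N)))))"
  proof (rule sum_mono)
    fix z assume "z \<in> bad N"
    then have z: "z \<in> Cf N" "B0 * (real N * ln (real N)) < excess N z" by (auto simp: bad_def)
    have "?gw z / Z \<le> ?gw z / (pref N * exp (- ?e0))"
      by (rule divide_left_mono[OF Zl less_imp_le[OF gw0[OF z(1)]] mult_pos_pos[OF Z pp]])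
    also have "\<dots> = exp (- excess N z)" using gw[OF z(1)] pref_pos[of N] by simp
    also have "\<dots> \<le> exp (- (B0 * (real N * ln (real N))))" using z by simp
    finally show "?gw z / Z \<le> exp (- (B0 * (real N * ln (real N))))" .
  qed
  also have "\<dots> = real (card (bad N)) * exp (- (B0 * (real N * ln (real N))))" by simp
  also have "\<dots> \<le> exp ((ln (Tm + 1) + 1) * (real N * ln (real N))) * exp (- (B0 * (real N * ln (real N))))"
  proof (rule mult_right_mono)
    have "real (card (bad N)) \<le> real (card (Cf N))" using fin by (intro of_nat_mono card_mono) (auto simp: bad_def)
    also have "\<dots> \<le> real (Suc (MN N)) ^ N" by (rule config_card(2)[OF N])
    also have "\<dots> \<le> ((Tm + 1) * real N) ^ N" using sites_le[OF N] by (intro power_mono) auto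
    also have "\<dots> = exp (real N * ln ((Tm + 1) * real N))"
    proof -
      have "0 < (Tm + 1) * real N" using Tm NN by simp
      then show ?thesis by (simp add: exp_of_nat_mult)
    qed
    also have "\<dots> \<le> exp ((ln (Tm + 1) + 1) * (real N * ln (real N)))"
    proof -
      have "ln ((Tm + 1) * real N) = ln (Tm + 1) + ln (real N)" using Tm NN by (simp add: ln_mult)
      also have "\<dots> \<le> (ln (Tm + 1) + 1) * ln (real N)"
        using mult_left_mono[OF l1, of "ln (Tm + 1)"] Tm by (simp add: algebra_simps)
      finally have "real N * ln ((Tm + 1) * real N) \<le> real N * ((ln (Tm + 1) + 1) * ln (real N))"
        by (intro mult_left_mono) auto
      then show ?thesis by (simp add: mult.left_commute)
    qed
    finally show "real (card (bad N)) \<le> exp ((ln (Tm + 1) + 1) * (real N * ln (real N)))" .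
  qed simp
  also have "\<dots> = exp (- (real N * ln (real N)))"
    unfolding B0_def exp_add[symmetric] by (rule arg_cong[where f = exp]) (simp add: algebra_simps)
  also have "\<dots> \<le> exp (- real N)" using mult_left_mono[OF l1, of "real N"] by simp
  finally show "(\<Sum>z\<in>bad N. ?gw z / Z) \<le> exp (- real N)" .
qed

lemma good_deviation:
  assumes N: "N0 \<le> N" and S: "S \<subseteq> {..MN N}" "card S = N"
    and ex: "En N (ind S) - En N (ind (gs N)) \<le> B0 * (real N * ln (real N))"
    and lip: "\<And>s t. \<bar>f s - f t\<bar> \<le> L * \<bar>s - t\<bar>" and L: "0 \<le> L"
  shows "\<bar>(\<Sum>a\<in>S. f (X N a)) / real N - mean N f\<bar> \<le> L * diam * sqrt (B0 + ln (diam / gap) + 2) * rate N"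
proof -
  note NN = N0[OF N] and l1 = ln_N_ge1[OF N]
  have N1: "0 < real N" using NN by simp
  have sumS: "(\<Sum>a\<le>n. of_bool (a \<in> S) * g a) = (\<Sum>a\<in>S. g a)" if "S \<subseteq> {..n}" for S n and g :: "nat \<Rightarrow> real"
    using that by (intro sum.mono_neutral_cong_right) auto
  let ?d = "(\<Sum>a\<in>S. f (X N a)) / real N - mean N f"
  have d: "(\<Sum>a\<le>MN N. (ind S a - ind (gs N) a) * f (X N a)) = real N * ?d"
    using N1 sumS[OF S(1)] sumS[OF gs_subset[OF NN(2)]]
    by (simp add: left_diff_distrib sum_subtractf mean_def right_diff_distrib)
  have r: "(rate N)\<^sup>2 = ln (real N) / real N" using l1 by (simp add: rate_def)
  have "(rate N)\<^sup>2 * (real N)\<^sup>2 = real N * ln (real N)" unfolding r using N1 by (simp add: power2_eq_square)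
  then have "\<bar>real N * ?d\<bar> \<le> real N * (L * diam * sqrt (B0 + ln (diam / gap) + 2) * rate N)"
    unfolding d[symmetric] using ex r
    by (intro occupation_deviation[OF N frac_occ_of_bool[OF S] _ rate_nonneg _ lip L]) simp_all
  moreover have "\<bar>real N * ?d\<bar> = real N * \<bar>?d\<bar>" by (simp add: abs_mult)
  ultimately show ?thesis using N1 by (simp only: mult_le_cancel_left_pos)
qed

text \<open>What remains is \<open>sqrt (ln N)\<close> times the power \<open>- \<epsilon>\<close>
  of \<open>N\<close>; the loss of \<open>\<epsilon>\<close> in the exponent pays for the
  logarithm.\<close>

lemma rate_scaled_tendsto:
  assumes "0 < \<epsilon>"
  shows "(\<lambda>N. real N powr (1 / 2 - \<epsilon>) * (C * rate N)) \<longlonglongrightarrow> 0"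
proof -
  have "(\<lambda>N. real N powr (1 / 2 - \<epsilon>) * sqrt (ln (real N) / real N)) \<longlonglongrightarrow> 0"
    using assms by real_asymp
  from tendsto_mult_right_zero[OF this, of C] show ?thesis by (simp add: rate_def mult_ac)
qed

lemma interval_nonempty: "1 + u \<le> quad_pt q u M"
proof -
  have "0 \<le> \<kappa> * (1 - u) * (M - 0)" using \<kappa>_pos u M by (intro mult_nonneg_nonneg) auto
  also have "\<dots> \<le> qlat \<kappa> u M - qlat \<kappa> u 0" using \<kappa>_pos u M by (intro qlat_lower) auto
  finally show ?thesis by (simp add: quad_pt_q qlat_def)
qed

text \<open>A Lipschitz function near the limiting interval is replaced by its composition with a
  clamp, which is bounded and Lipschitz on the whole line.\<close>
lemma clamped_extension:
  fixes f :: "real \<Rightarrow> real"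
  assumes "open U" "{a..b} \<subseteq> U" "a \<le> b" "L-lipschitz_on U f"
  obtains g F e where "0 < e" "\<And>s. s \<in> {a - e..b + e} \<Longrightarrow> g s = f s" "\<And>s. \<bar>g s\<bar> \<le> F"
    "\<And>s t. \<bar>g s - g t\<bar> \<le> L * \<bar>s - t\<bar>"
proof -
  obtain e where e: "0 < e" "(\<Union>x\<in>{a..b}. cball x e) \<subseteq> U"
    by (rule compact_subset_open_imp_cball_epsilon_subset[OF compact_Icc assms(1,2)])
  have U: "{a - e..b + e} \<subseteq> U"
  proof
    fix s assume s: "s \<in> {a - e..b + e}"
    have "s \<in> cball (max a (min b s)) e" using s assms(3) e(1) by (auto simp: dist_real_def max_def min_def)
    moreover have "max a (min b s) \<in> {a..b}" using assms(3) by auto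
    ultimately show "s \<in> U" using e(2) by blast
  qed
  have L: "0 \<le> L" using assms(4) by (rule lipschitz_on_nonneg)
  define c where "c s = max (a - e) (min (b + e) s)" for s
  have c: "c s \<in> {a - e..b + e}" for s using assms(3) e(1) by (auto simp: c_def)
  have lip: "\<bar>f (c s) - f (c t)\<bar> \<le> L * \<bar>s - t\<bar>" for s t
  proof -
    have "\<bar>f (c s) - f (c t)\<bar> \<le> L * \<bar>c s - c t\<bar>"
      using lipschitz_onD[OF assms(4) subsetD[OF U c[of s]] subsetD[OF U c[of t]]] by (simp add: dist_real_def)
    also have "\<dots> \<le> L * \<bar>s - t\<bar>" using L by (intro mult_left_mono) (auto simp: c_def max_def min_def)
    finally show ?thesis .
  qed
  have cc: "c (c s) = c s" for s using c[of s] by (auto simp: c_def)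
  have bd: "\<bar>f (c s)\<bar> \<le> \<bar>f (c a)\<bar> + L * (b - a + 2 * e)" for s
  proof -
    have "\<bar>f (c s) - f (c a)\<bar> \<le> L * \<bar>c s - a\<bar>" using lip[of "c s" a] by (simp add: cc)
    also have "\<dots> \<le> L * (b - a + 2 * e)" using L c[of s] e(1) assms(3) by (intro mult_left_mono) auto
    finally show ?thesis by linarith
  qed
  show thesis
    by (rule that[of e "\<lambda>s. f (c s)" "\<bar>f (c a)\<bar> + L * (b - a + 2 * e)"])
      (use e lip bd in \<open>auto simp: c_def\<close>)
qed

text \<open>The Radon-Nikodym density takes extended values and is supported in the interval only
  almost everywhere; changing it on a null set gives a real density that vanishes outside.\<close>

lemma density_of_measure:
  assumes "real_distribution \<mu>" "absolutely_continuous lborel \<mu>" "measure \<mu> {a..b} = 1"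
  obtains \<rho> :: "real \<Rightarrow> real" where "\<rho> \<in> borel_measurable borel" "\<And>x. 0 \<le> \<rho> x"
    "density lborel (\<lambda>x. ennreal (\<rho> x)) = \<mu>" "\<And>x. x \<notin> {a..b} \<Longrightarrow> \<rho> x = 0"
proof -
  interpret \<mu>: real_distribution \<mu> by fact
  obtain h where h: "h \<in> borel_measurable lborel" "density lborel h = \<mu>"
    using sigma_finite_measure.Radon_Nikodym[OF sigma_finite_lborel assms(2)] by auto
  define \<rho> where "\<rho> x = indicator {a..b} x * enn2real (h x)" for x
  have m: "\<rho> \<in> borel_measurable borel" using h(1) unfolding \<rho>_def by measurable
  have "(\<integral>\<^sup>+x. h x \<partial>lborel) = emeasure (density lborel h) UNIV"
    using h(1) by (simp add: emeasure_density)
  also have "\<dots> = 1" unfolding h(2) using \<mu>.emeasure_space_1 by simp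
  finally have "AE x in lborel. h x \<noteq> \<infinity>" using h(1) by (intro nn_integral_PInf_AE) auto
  moreover have "AE x in lborel. x \<notin> {a..b} \<longrightarrow> h x = 0"
  proof -
    have "(\<integral>\<^sup>+x. h x * indicator (- {a..b}) x \<partial>lborel) = emeasure (density lborel h) (- {a..b})"
      using h(1) by (simp add: emeasure_density)
    also have "\<dots> = 0" unfolding h(2)
      using \<mu>.prob_compl[of "{a..b}"] assms(3) by (simp add: \<mu>.emeasure_eq_measure Compl_eq_Diff_UNIV)
    finally have "AE x in lborel. h x * indicator (- {a..b}) x = 0"
      using h(1) by (subst (asm) nn_integral_0_iff_AE) auto
    then show ?thesis by (auto simp: indicator_def)
  qed
  ultimately have "AE x in lborel. ennreal (\<rho> x) = h x"
  proof eventually_elim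
    case (elim x)
    then show ?case by (cases "x \<in> {a..b}") (auto simp: \<rho>_def less_top)
  qed
  then have "density lborel (\<lambda>x. ennreal (\<rho> x)) = density lborel h"
    using m h(1) by (intro density_cong) auto
  then show thesis using m h(2) by (intro that[of \<rho>]) (auto simp: \<rho>_def)
qed

lemma expectation_empirical:
  assumes "1 \<le> N"
  shows "(\<integral>x. f x \<partial>measure_pmf (empirical N z)) = (\<Sum>i\<in>{1..N}. f (z i)) / real N"
  using assms by (simp add: empirical_def integral_map_pmf integral_pmf_of_set)

end

theorem theorem1p2p1:
  fixes q M u :: real
    and qN uN :: "nat \<Rightarrow> real" and MN :: "nat \<Rightarrow> nat"
    and w VN :: "nat \<Rightarrow> real \<Rightarrow> real" and V :: "real \<Rightarrow> real" and I :: "real set"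
    and A1 A2 A3 A4 :: real
  assumes q: "0 < q" "q < 1" and M: "1 \<le> M" and u: "0 \<le> u" "u < 1"
    and qN: "\<And>N. 1 \<le> N \<Longrightarrow> 0 < qN N \<and> qN N < 1"
    and uN: "\<And>N. 1 \<le> N \<Longrightarrow> 0 \<le> uN N \<and> uN N < 1"
    and MN: "\<And>N. 1 \<le> N \<Longrightarrow> N - 1 \<le> MN N"
    and A1: "0 < A1"
    and close: "\<And>N. 1 \<le> N \<Longrightarrow>
          real N ^ 2 * \<bar>qN N - q powr (1 / real N)\<bar> \<le> A1 \<and>
          \<bar>real (MN N) - real N * M\<bar> \<le> A1 \<and>
          real N * \<bar>uN N - u\<bar> \<le> A1"
    and I: "is_interval I"
    and I_lim: "{1 + u .. quad_pt q u M} \<subseteq> I"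
    and I_N: "\<And>N. 1 \<le> N \<Longrightarrow> {1 + uN N .. quad_pt (qN N) (uN N) (real (MN N))} \<subseteq> I"
    and w: "\<And>N s. 1 \<le> N \<Longrightarrow> s \<in> {1 + uN N .. quad_pt (qN N) (uN N) (real (MN N))} \<Longrightarrow>
          w N s = exp (- real N * VN N s)"
    and VN_cont: "\<And>N. 1 \<le> N \<Longrightarrow>
          continuous_on {1 + uN N .. quad_pt (qN N) (uN N) (real (MN N))} (VN N)"
    and A2: "0 < A2"
    and VN_V: "\<And>N s. 1 \<le> N \<Longrightarrow> s \<in> {1 + uN N .. quad_pt (qN N) (uN N) (real (MN N))} \<Longrightarrow>
          \<bar>VN N s - V s\<bar> \<le> A2 * ln (real N) / real N"
    and V_cont: "continuous_on I V"
    and A3: "0 < A3" and V_bound: "\<And>s. s \<in> I \<Longrightarrow> \<bar>V s\<bar> \<le> A3"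
    and V_diff: "\<And>s. s \<in> {1 + u <..< quad_pt q u M} \<Longrightarrow> V differentiable (at s)"
    and A4: "0 < A4"
    and V_deriv: "\<And>s. s \<in> {1 + u <..< quad_pt q u M} \<Longrightarrow>
          \<bar>deriv V s\<bar> \<le> A4 * (1 + \<bar>ln \<bar>s - 1 - u\<bar>\<bar> + \<bar>ln \<bar>s - quad_pt q u M\<bar>\<bar>)"
  shows "\<exists>\<rho> :: real \<Rightarrow> real.
      \<rho> \<in> borel_measurable borel \<and> (\<forall>x. 0 \<le> \<rho> x) \<and>
      prob_space (density lborel (\<lambda>x. ennreal (\<rho> x))) \<and>
      (\<forall>x. x \<notin> {1 + u .. quad_pt q u M} \<longrightarrow> \<rho> x = 0) \<and>
      (\<forall>(f :: real \<Rightarrow> real) U L \<epsilon>.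
         open U \<and> {1 + u .. quad_pt q u M} \<subseteq> U \<and> L-lipschitz_on U f \<and> 0 < \<epsilon> \<longrightarrow>
         (let P = (\<lambda>N. gibbs_measure (qN N) (MN N) (uN N) (w N) N);
              X = (\<lambda>N z. real N powr (1 / 2 - \<epsilon>) *
                     \<bar>(\<integral>x. f x \<partial>measure_pmf (empirical N z)) - (\<integral>x. f x * \<rho> x \<partial>lborel)\<bar>)
          in tends_to_0_in_prob P X \<and> tends_to_0_in_moments P X))"
proof -
  interpret weighted_log_gas q M u qN uN MN VN V I A1 A2 A3 A4 w
    by unfold_locales (fact assms)+
  let ?I = "{1 + u .. quad_pt q u M}"
  obtain \<mu> where \<mu>: "real_distribution \<mu>"
    and lim: "\<And>f F L N. (\<And>s. \<bar>f s\<bar> \<le> F) \<Longrightarrow> (\<And>s t. \<bar>f s - f t\<bar> \<le> L * \<bar>s - t\<bar>) \<Longrightarrow> 0 \<le> L \<Longrightarrow> N0 \<le> N \<Longrightarrow>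
       \<bar>mean N f - (\<integral>s. f s \<partial>\<mu>)\<bar> \<le> Ctest F L * rate N"
    and intv: "\<And>x y. x \<le> y \<Longrightarrow> measure \<mu> {x..y} \<le> 1 / gap * (y - x)"
    and supp: "measure \<mu> ?I = 1"
    by (rule limit_measure) blast
  interpret \<mu>: real_distribution \<mu> by fact
  have "absolutely_continuous lborel \<mu>"
    using \<mu>.finite_measure_axioms intv const_pos by (intro absolutely_continuous_if_interval_bound[of \<mu> "1 / gap"]) auto
  from density_of_measure[OF \<mu> this supp] obtain \<rho> where \<rho>: "\<rho> \<in> borel_measurable borel" "\<And>x. 0 \<le> \<rho> x"
    "density lborel (\<lambda>x. ennreal (\<rho> x)) = \<mu>" "\<And>x. x \<notin> ?I \<Longrightarrow> \<rho> x = 0" by blast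
  show ?thesis
  proof (intro exI[of _ \<rho>] conjI allI impI)
    show "prob_space (density lborel (\<lambda>x. ennreal (\<rho> x)))" unfolding \<rho>(3) by (rule \<mu>.prob_space_axioms)
  next
    fix f :: "real \<Rightarrow> real" and U :: "real set" and L \<epsilon> :: real
    assume "open U \<and> ?I \<subseteq> U \<and> L-lipschitz_on U f \<and> 0 < \<epsilon>"
    then have U: "open U" "?I \<subseteq> U" and lipf: "L-lipschitz_on U f" and \<epsilon>: "0 < \<epsilon>" by auto
    have L: "0 \<le> L" using lipf by (rule lipschitz_on_nonneg)
    obtain g F e where e: "0 < e" and gf: "\<And>s. s \<in> {1 + u - e..quad_pt q u M + e} \<Longrightarrow> g s = f s"
      and gF: "\<And>s. \<bar>g s\<bar> \<le> F" and lip: "\<And>s t. \<bar>g s - g t\<bar> \<le> L * \<bar>s - t\<bar>"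
      by (rule clamped_extension[OF U interval_nonempty lipf]) blast
    have F: "0 \<le> F" using gF[of 0] by linarith
    have "L-lipschitz_on UNIV g" using lip L by (intro lipschitz_onI) (auto simp: dist_real_def)
    then have gm: "g \<in> borel_measurable borel"
      by (intro borel_measurable_continuous_onI lipschitz_on_continuous_on)
    have "(\<integral>x. f x * \<rho> x \<partial>lborel) = (\<integral>x. \<rho> x * g x \<partial>lborel)"
    proof (intro Bochner_Integration.integral_cong refl)
      fix x
      show "f x * \<rho> x = \<rho> x * g x" using gf[of x] e \<rho>(4)[of x] by (cases "x \<in> ?I") auto
    qed
    also have "\<dots> = (\<integral>x. g x \<partial>\<mu>)"
      unfolding \<rho>(3)[symmetric] using \<rho>(1,2) gm by (subst integral_density) auto
    finally have int: "(\<integral>x. f x * \<rho> x \<partial>lborel) = (\<integral>x. g x \<partial>\<mu>)" .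
    have intF: "\<bar>\<integral>x. g x \<partial>\<mu>\<bar> \<le> F"
    proof -
      have "integrable \<mu> g" using gm gF by (intro \<mu>.integrable_const_bound[of _ F]) auto
      then have "(\<integral>x. g x \<partial>\<mu>) \<le> F" "- F \<le> (\<integral>x. g x \<partial>\<mu>)"
        using gF by (auto intro!: \<mu>.integral_le_const \<mu>.integral_ge_const simp: abs_le_iff minus_le_iff)
      then show ?thesis by linarith
    qed
    \<comment> \<open>The first summand takes a typical configuration to the ground state, the
      second the ground state to the limit.\<close>
    define C where "C = L * diam * sqrt (B0 + ln (diam / gap) + 2) +
       Ctest F L"
    \<comment> \<open>Beyond \<open>n0\<close> all lattice points are within \<open>e\<close> of the
      limiting interval, where \<open>g\<close> and \<open>f\<close> agree.\<close>
    define n0 where "n0 = max N0 (nat \<lceil>C7 / e\<rceil>)"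
    have n0: "N0 \<le> N" "C7 / real N \<le> e" if "n0 \<le> N" for N
    proof -
      show *: "N0 \<le> N" using that by (simp add: n0_def)
      have "C7 / e \<le> real N" using that unfolding n0_def by linarith
      then show "C7 / real N \<le> e" using e N0(2)[OF *] by (simp add: field_simps)
    qed
    let ?p = "\<lambda>N z. gibbs_weight (w N) N z / (\<Sum>z'\<in>Cf N. gibbs_weight (w N) N z')"
    define d where "d N z = \<bar>(\<integral>x. f x \<partial>measure_pmf (empirical N z)) - (\<integral>x. f x * \<rho> x \<partial>lborel)\<bar>" for N z
    define Y where "Y N z = real N powr (1 / 2 - \<epsilon>) * d N z" for N z
    have emp: "(\<integral>x. f x \<partial>measure_pmf (empirical N z)) = (\<Sum>a\<in>sites N z. g (X N a)) / real N"
      and sub: "sites N z \<subseteq> {..MN N}" and crd: "card (sites N z) = N"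
      if "n0 \<le> N" "z \<in> Cf N" for N z
    proof -
      note N = n0(1)[OF that(1)] and pr = config_props[OF n0(1)[OF that(1)] that(2)]
      show s: "sites N z \<subseteq> {..MN N}" by (rule pr(1))
      show "card (sites N z) = N" by (rule pr(2))
      have "(\<Sum>i\<in>{1..N}. f (z i)) = (\<Sum>a\<in>sites N z. f (X N a))"
        by (rule config_props(3)[OF N that(2)])
      also have "\<dots> = (\<Sum>a\<in>sites N z. g (X N a))"
      proof (intro sum.cong refl)
        fix a assume "a \<in> sites N z"
        then have "a \<le> MN N" using s by auto
        from X_range[OF N this] n0(2)[OF that(1)] show "f (X N a) = g (X N a)" by (intro gf[symmetric]) auto
      qed
      finally show "(\<integral>x. f x \<partial>measure_pmf (empirical N z)) = (\<Sum>a\<in>sites N z. g (X N a)) / real N"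
        by (simp only: expectation_empirical[OF N0(2)[OF N]])
    qed
    have "tends_to_0_in_prob (\<lambda>N. point_measure (Cf N) (\<lambda>z. ennreal (?p N z))) Y \<and>
      tends_to_0_in_moments (\<lambda>N. point_measure (Cf N) (\<lambda>z. ennreal (?p N z))) Y"
    proof (rule tends_to_0_point_measure[where ?n0.0 = n0 and bad = bad and C = "2 * F"
          and g = "\<lambda>N. real N powr (1 / 2 - \<epsilon>) * (C * rate N)"])
      fix N assume N: "n0 \<le> N"
      note N' = n0(1)[OF N]
      note Z = bad_probability[OF N']
      show "finite (Cf N)" by (rule config_card(1)[OF N'])
      show "(\<Sum>z\<in>Cf N. ?p N z) = 1" using Z(1) by (simp add: sum_divide_distrib[symmetric])
      show "bad N \<subseteq> Cf N" by (auto simp: bad_def)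
      show "(\<Sum>z\<in>bad N. ?p N z) \<le> exp (- real N)" by (rule Z(2))
      have N1: "1 \<le> real N" using N0(2)[OF N'] by simp
      fix z
      show "0 \<le> ?p N z" if "z \<in> Cf N"
        using config_props(4)[OF N' that] pref_pos[of N] Z(1) by simp
      \<comment> \<open>A crude bound, sufficient on the bad set because its probability is
        exponentially small.\<close>
      show "\<bar>Y N z\<bar> \<le> 2 * F * real N" if z: "z \<in> Cf N"
      proof -
        have "\<bar>\<Sum>a\<in>sites N z. g (X N a)\<bar> \<le> (\<Sum>a\<in>sites N z. F)"
          by (rule order_trans[OF sum_abs], rule sum_mono) (rule gF)
        then have "\<bar>(\<Sum>a\<in>sites N z. g (X N a)) / real N\<bar> \<le> F"
          using N1 crd[OF N z] by (simp add: field_simps)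
        then have "d N z \<le> 2 * F"
          using intF unfolding d_def emp[OF N z] int by linarith
        moreover have "real N powr (1 / 2 - \<epsilon>) \<le> real N powr 1" using N1 \<epsilon> by (intro powr_mono) auto
        ultimately have "Y N z \<le> real N * (2 * F)" using N1 unfolding Y_def by (intro mult_mono) (auto simp: d_def)
        then show ?thesis by (simp add: Y_def d_def abs_mult mult.commute)
      qed
      show "\<bar>Y N z\<bar> \<le> real N powr (1 / 2 - \<epsilon>) * (C * rate N)" if "z \<in> Cf N - bad N"
      proof -
        from that have z: "z \<in> Cf N" and ex: "excess N z \<le> B0 * (real N * ln (real N))" by (auto simp: bad_def)
        have "\<bar>(\<Sum>a\<in>sites N z. g (X N a)) / real N - mean N g\<bar> \<le> L * diam * sqrt (B0 + ln (diam / gap) + 2) * rate N"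
          by (rule good_deviation[OF N' sub[OF N z] crd[OF N z] ex[unfolded excess_def] lip L])
        moreover have "\<bar>mean N g - (\<integral>s. g s \<partial>\<mu>)\<bar> \<le> Ctest F L * rate N"
          by (rule lim[OF gF lip L N'])
        ultimately have "d N z \<le> C * rate N"
          unfolding d_def emp[OF N z] int C_def distrib_right[of "L * diam * sqrt (B0 + ln (diam / gap) + 2)"] by linarith
        then show ?thesis unfolding Y_def d_def abs_mult by (simp add: mult_left_mono)
      qed
    qed (rule rate_scaled_tendsto[OF \<epsilon>])
    then show "let P = (\<lambda>N. gibbs_measure (qN N) (MN N) (uN N) (w N) N);
              X = (\<lambda>N z. real N powr (1 / 2 - \<epsilon>) *
                     \<bar>(\<integral>x. f x \<partial>measure_pmf (empirical N z)) - (\<integral>x. f x * \<rho> x \<partial>lborel)\<bar>)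
          in tends_to_0_in_prob P X \<and> tends_to_0_in_moments P X"
      unfolding Let_def gibbs_measure_def Y_def[abs_def] d_def .
  qed (use \<rho> in auto)
qed

end
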